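(* Let $d\geq 3$, and let $n_3,\ldots,n_d\geq 5$ be integers. Then there exists a finite regular $d$-polytope $\mathcal P$ with the following properties. (a) $\mathcal P$ is of type $\{\{4,4\}^{(n_3)},\{4,4\}^{(n_4)},\ldots,\{4,4\}^{(n_{d})}\}$. (b) The automorphism group of $\mathcal P$ is a 2-group of order $2^{n_3+n_4+\cdots+n_d-3(d-3)}$. (c) $\mathcal P$ is flat if $d\geq 4$; in fact, $\mathcal P$ is $(d-4,d-1)$-flat if $d\geq 4$. (d) $\mathcal P$ has the FAP with respect to its co-$(d-4)$-faces, its co-$(d-3)$-faces, and its facets.
   Context: **Polytopes.** An (abstract) polytope of rank $d$ (a $d$-polytope) is a partially ordered set $\mathcal P$ with a strictly monotone rank function with values in $\{-1,0,\ldots,d\}$, having a unique least face $F_{-1}$ (rank $-1$) and a unique greatest face $F_d$ (rank $d$), such that: every flag (maximal totally ordered subset) has exactly $d+2$ faces, one of each rank; $\mathcal P$ is strongly flag-connected (any two flags $\Phi,\Psi$ are joined by a finite sequence of flags, each containing $\Phi\cap\Psi$, in which successive flags are adjacent, i.e. differ in exactly one face); and the diamond condition holds (if $F\le G$ have ranks $j-1$ and $j+1$, there are exactly two $j$-faces $H$ with $F\le H\le G$). Elements of rank $j$ are $j$-faces; $0$-faces are vertices, $(d-1)$-faces are facets. $\Phi^j$ denotes the unique flag differing from the flag $\Phi$ exactly in its $j$-face. For $F\le G$, the section $G/F=\{H: F\le H\le G\}$ is a polytope of rank $\operatorname{rank}G-\operatorname{rank}F-1$; a face $F$ is identified with $F/F_{-1}$,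 and $F_d/F$ is called the co-$j$-face at $F$ if $F$ has rank $j$. $\mathcal P$ is regular if its automorphism group $\Gamma(\mathcal P)$ is transitive on flags. Then, for a fixed base flag $\Phi=\{F_{-1},F_0,\ldots,F_d\}$, $\Gamma(\mathcal P)=\langle\rho_0,\ldots,\rho_{d-1}\rangle$, where the involution $\rho_i$ maps $\Phi$ to $\Phi^i$. **Toroidal polyhedra.** For $s\ge2,\ t=0$ or $s=t\ge 2$, $\{4,4\}_{(s,t)}$ is the regular 3-polytope obtained as the quotient of the square tessellation of the plane with vertex set $\mathbb Z^2$ by the lattice spanned by $(s,t)$ and $(-t,s)$. For $n\ge5$, $\{4,4\}^{(n)}$ denotes $\{4,4\}_{(2^e,0)}$ if $n=2e+3$ is odd and $\{4,4\}_{(2^e,2^e)}$ if $n=2e+4$ is even; its automorphism group has order $2^n$. **Type.** A regular $d$-polytope $\mathcal P$ with base flag $\{F_{-1},\ldots,F_d\}$ is of type $\{\mathcal P_3,\ldots,\mathcal P_d\}$, where the $\mathcal P_j$ are regular 3-polytopes, if the section $F_j/F_{j-4}$ is isomorphic to $\mathcal P_j$ for each $j=3,\ldots,d$. **Flatness.** For $0\le k<l\le d-1$, a $d$-polytope is $(k,l)$-flat if each of its $k$-faces is incident with each of its $l$-faces; it is flat if it is $(0,d-1)$-flat. **FAP (flat amalgamation property).** Let $\mathcal P$ be a regular $d$-polytope with $\Gamma(\mathcal P)=\langle\rho_0,\ldots,\rho_{d-1}\rangle$. Let $N_k^+$ and $N_k^-$ be the normal closures in $\Gamma(\mathcal P)$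 of $\{\rho_k,\ldots,\rho_{d-1}\}$ and $\{\rho_0,\ldots,\rho_k\}$, respectively. $\mathcal P$ has the FAP with respect to its $k$-faces if $N_k^+\cap\langle\rho_0,\ldots,\rho_{k-1}\rangle=1$ (equivalently $\Gamma(\mathcal P)= N_k^+\rtimes\langle\rho_0,\ldots,\rho_{k-1}\rangle$); with respect to its facets means $k=d-1$. $\mathcal P$ has the FAP with respect to its co-$k$-faces if $N_k^-\cap\langle\rho_{k+1},\ldots,\rho_{d-1}\rangle=1$ (equivalently $\Gamma(\mathcal P)= N_k^-\rtimes\langle\rho_{k+1},\ldots,\rho_{d-1}\rangle$). For $k=-1$, $N_{-1}^-$ is the trivial group, so the FAP with respect to co-$(-1)$-faces holds trivially (this occurs in (d) when $d=3$). *)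

theory Defs
  imports "HOL-Algebra.Bij" "HOL-Algebra.Generated_Groups" "HOL-Library.Product_Plus"
begin

section \<open>Abstract polytopes\<close>

text \<open>Ranks are integers because the least face has rank \<open>-1\<close>. Only the restriction of \<open>leq\<close>
  and \<open>rk\<close> to \<open>faces\<close> is meaningful.\<close>

record 'a ranked_poset =
  faces :: "'a set"
  leq :: "'a \<Rightarrow> 'a \<Rightarrow> bool"
  rk :: "'a \<Rightarrow> int"

definition flag :: "'a ranked_poset \<Rightarrow> 'a set \<Rightarrow> bool" where
  "flag P \<Phi> \<longleftrightarrow> pred_on.maxchain (faces P) (leq P) \<Phi>"

definition adjacent_flags :: "'a ranked_poset \<Rightarrow> 'a set \<Rightarrow> 'a set \<Rightarrow> bool" where
  "adjacent_flags P \<Phi> \<Psi> \<longleftrightarrow>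
     flag P \<Phi> \<and> flag P \<Psi> \<and> card (\<Phi> - \<Psi>) = 1 \<and> card (\<Psi> - \<Phi>) = 1"

definition strongly_flag_connected :: "'a ranked_poset \<Rightarrow> bool" where
  "strongly_flag_connected P \<longleftrightarrow>
     (\<forall>\<Phi> \<Psi>. flag P \<Phi> \<longrightarrow> flag P \<Psi> \<longrightarrow>
        (\<lambda>A B. adjacent_flags P A B \<and> \<Phi> \<inter> \<Psi> \<subseteq> A \<and> \<Phi> \<inter> \<Psi> \<subseteq> B)\<^sup>*\<^sup>* \<Phi> \<Psi>)"

definition diamond_condition :: "'a ranked_poset \<Rightarrow> bool" where
  "diamond_condition P \<longleftrightarrow>
     (\<forall>F\<in>faces P. \<forall>G\<in>faces P. leq P F G \<and> rk P G = rk P F + 2 \<longrightarrow>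
        card {H \<in> faces P. rk P H = rk P F + 1 \<and> leq P F H \<and> leq P H G} = 2)"

definition polytope :: "int \<Rightarrow> 'a ranked_poset \<Rightarrow> bool" where
  "polytope d P \<longleftrightarrow>
     d \<ge> -1 \<and>
     reflp_on (faces P) (leq P) \<and> antisymp_on (faces P) (leq P) \<and> transp_on (faces P) (leq P) \<and>
     rk P ` faces P \<subseteq> {-1..d} \<and>
     (\<forall>F\<in>faces P. \<forall>G\<in>faces P. leq P F G \<and> F \<noteq> G \<longrightarrow> rk P F < rk P G) \<and>
     (\<exists>F\<in>faces P. rk P F = -1 \<and> (\<forall>G\<in>faces P. leq P F G)) \<and>
     (\<exists>F\<in>faces P. rk P F = d \<and> (\<forall>G\<in>faces P. leq P G F)) \<and>
     (\<forall>\<Phi>. flag P \<Phi> \<longrightarrow> bij_betw (rk P) \<Phi> {-1..d}) \<and>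
     strongly_flag_connected P \<and>
     diamond_condition P"

definition section_of :: "'a ranked_poset \<Rightarrow> 'a \<Rightarrow> 'a \<Rightarrow> 'a ranked_poset" where
  "section_of P F G =
     \<lparr>faces = {H \<in> faces P. leq P F H \<and> leq P H G},
      leq = leq P,
      rk = (\<lambda>H. rk P H - rk P F - 1)\<rparr>"

definition isomorphic :: "'a ranked_poset \<Rightarrow> 'b ranked_poset \<Rightarrow> bool" where
  "isomorphic P Q \<longleftrightarrow>
     (\<exists>f. bij_betw f (faces P) (faces Q) \<and>
          (\<forall>F\<in>faces P. \<forall>G\<in>faces P. leq Q (f F) (f G) \<longleftrightarrow> leq P F G))"

definition incident :: "'a ranked_poset \<Rightarrow> 'a \<Rightarrow> 'a \<Rightarrow> bool" where
  "incident P F G \<longleftrightarrow> leq P F G \<or> leq P G F"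

definition kl_flat :: "int \<Rightarrow> 'a ranked_poset \<Rightarrow> int \<Rightarrow> int \<Rightarrow> bool" where
  "kl_flat d P k l \<longleftrightarrow>
     0 \<le> k \<and> k < l \<and> l \<le> d - 1 \<and>
     (\<forall>F\<in>faces P. \<forall>G\<in>faces P. rk P F = k \<and> rk P G = l \<longrightarrow> incident P F G)"

definition flat :: "int \<Rightarrow> 'a ranked_poset \<Rightarrow> bool" where
  "flat d P \<longleftrightarrow> kl_flat d P 0 (d - 1)"


section \<open>Automorphisms and regularity\<close>

definition aut_group :: "'a ranked_poset \<Rightarrow> ('a \<Rightarrow> 'a) monoid" where
  "aut_group P = BijGroup (faces P)
     \<lparr>carrier := {f \<in> Bij (faces P).
        \<forall>F\<in>faces P. \<forall>G\<in>faces P. leq P (f F) (f G) \<longleftrightarrow> leq P F G}\<rparr>"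

definition regular_polytope :: "int \<Rightarrow> 'a ranked_poset \<Rightarrow> bool" where
  "regular_polytope d P \<longleftrightarrow>
     polytope d P \<and>
     (\<forall>\<Phi> \<Psi>. flag P \<Phi> \<longrightarrow> flag P \<Psi> \<longrightarrow> (\<exists>g\<in>carrier (aut_group P). g ` \<Phi> = \<Psi>))"

definition flag_face :: "'a ranked_poset \<Rightarrow> 'a set \<Rightarrow> int \<Rightarrow> 'a" where
  "flag_face P \<Phi> i = (THE F. F \<in> \<Phi> \<and> rk P F = i)"

definition adj_flag :: "'a ranked_poset \<Rightarrow> 'a set \<Rightarrow> int \<Rightarrow> 'a set" where
  "adj_flag P \<Phi> i =
     (THE \<Psi>. flag P \<Psi> \<and> \<Psi> \<noteq> \<Phi> \<and> {F \<in> \<Psi>. rk P F \<noteq> i} = {F \<in> \<Phi>. rk P F \<noteq> i})"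

text \<open>An automorphism of a polytope is determined by the image of one flag, so the description
  below is unique; for regular \<open>P\<close> and \<open>0 \<le> i < d\<close> the automorphism exists.\<close>

definition rho :: "'a ranked_poset \<Rightarrow> 'a set \<Rightarrow> int \<Rightarrow> 'a \<Rightarrow> 'a" where
  "rho P \<Phi> i = (THE g. g \<in> carrier (aut_group P) \<and> g ` \<Phi> = adj_flag P \<Phi> i)"


section \<open>The flat amalgamation property\<close>

definition normal_closure :: "('g, 'm) monoid_scheme \<Rightarrow> 'g set \<Rightarrow> 'g set" where
  "normal_closure G S = \<Inter> {N. N \<lhd> G \<and> S \<subseteq> N}"

definition N_plus :: "int \<Rightarrow> 'a ranked_poset \<Rightarrow> 'a set \<Rightarrow> int \<Rightarrow> ('a \<Rightarrow> 'a) set" where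
  "N_plus d P \<Phi> k = normal_closure (aut_group P) (rho P \<Phi> ` {k..d - 1})"

definition N_minus :: "'a ranked_poset \<Rightarrow> 'a set \<Rightarrow> int \<Rightarrow> ('a \<Rightarrow> 'a) set" where
  "N_minus P \<Phi> k = normal_closure (aut_group P) (rho P \<Phi> ` {0..k})"

definition FAP_faces :: "int \<Rightarrow> 'a ranked_poset \<Rightarrow> 'a set \<Rightarrow> int \<Rightarrow> bool" where
  "FAP_faces d P \<Phi> k \<longleftrightarrow>
     N_plus d P \<Phi> k \<inter> generate (aut_group P) (rho P \<Phi> ` {0..k - 1}) = {\<one>\<^bsub>aut_group P\<^esub>}"

definition FAP_cofaces :: "int \<Rightarrow> 'a ranked_poset \<Rightarrow> 'a set \<Rightarrow> int \<Rightarrow> bool" where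
  "FAP_cofaces d P \<Phi> k \<longleftrightarrow>
     N_minus P \<Phi> k \<inter> generate (aut_group P) (rho P \<Phi> ` {k + 1..d - 1}) = {\<one>\<^bsub>aut_group P\<^esub>}"


section \<open>Toroidal polyhedra of type \<open>{4,4}\<close>\<close>

text \<open>A face of the square tessellation is given by its set of vertices; the improper faces are the
  empty set and the set of all vertices, and the order is inclusion.\<close>

definition tess_faces :: "(int \<times> int) set set" where
  "tess_faces =
     {{}, UNIV} \<union>
     (\<Union>v. {{v}, {v, v + (1, 0)}, {v, v + (0, 1)},
           {v, v + (1, 0), v + (0, 1), v + (1, 1)}})"

definition tess_rank :: "(int \<times> int) set \<Rightarrow> int" where
  "tess_rank X =
     (if X = {} then -1 else if X = UNIV then 3
      else if card X = 1 then 0 else if card X = 2 then 1 else 2)"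

definition lattice44 :: "int \<Rightarrow> int \<Rightarrow> (int \<times> int) set" where
  "lattice44 s t = {(a * s - b * t, a * t + b * s) | a b. True}"

definition tess_orbit :: "int \<Rightarrow> int \<Rightarrow> (int \<times> int) set \<Rightarrow> (int \<times> int) set set" where
  "tess_orbit s t X = {(+) v ` X | v. v \<in> lattice44 s t}"

text \<open>All members of an orbit have the same rank, so \<open>the_elem\<close> is applied to a singleton.\<close>

definition torus44 :: "int \<Rightarrow> int \<Rightarrow> (int \<times> int) set set ranked_poset" where
  "torus44 s t =
     \<lparr>faces = tess_orbit s t ` tess_faces,
      leq = (\<lambda>A B. \<exists>X\<in>A. \<exists>Y\<in>B. X \<subseteq> Y),
      rk = (\<lambda>A. the_elem (tess_rank ` A))\<rparr>"

text \<open>For \<open>n \<ge> 5\<close>, the map \<open>{4,4}\<^sub>(\<^sub>s\<^sub>,\<^sub>t\<^sub>)\<close> with \<open>(s, t) = (2\<^sup>e, 0)\<close>, \<open>n = 2 e + 3\<close>, or \<open>s = t = 2\<^sup>e\<close>, \<open>n = 2 e + 4\<close>; its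
  automorphism group has order \<open>2\<^sup>n\<close>.\<close>

definition torus44_order :: "nat \<Rightarrow> (int \<times> int) set set ranked_poset" where
  "torus44_order n =
     (if odd n then torus44 (2 ^ ((n - 3) div 2)) 0
      else torus44 (2 ^ ((n - 4) div 2)) (2 ^ ((n - 4) div 2)))"


section \<open>Type\<close>

text \<open>For regular \<open>P\<close> the sections below are regular 3-polytopes, hence so is every \<open>Q j\<close> with
  \<open>3 \<le> j \<le> d\<close>, and the choice of base flag is immaterial.\<close>

definition has_type :: "int \<Rightarrow> 'a ranked_poset \<Rightarrow> 'a set \<Rightarrow> (nat \<Rightarrow> 'b ranked_poset) \<Rightarrow> bool" where
  "has_type d P \<Phi> Q \<longleftrightarrow>
     (\<forall>j. 3 \<le> j \<and> int j \<le> d \<longrightarrow>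
        isomorphic (section_of P (flag_face P \<Phi> (int j - 4)) (flag_face P \<Phi> (int j))) (Q j))"

end

theory Submission
  imports Defs "HOL-Library.Function_Algebras"
begin


text \<open>For each \<open>j\<close> let \<open>T\<^sub>j\<close> be the group of the map \<open>{4,4}\<^sup>(\<^sup>n\<^sup>)\<close> with \<open>n = n\<^sub>j\<close>, generated by its reflections
  \<open>\<sigma>\<^sub>0\<close>, \<open>\<sigma>\<^sub>1\<close>, \<open>\<sigma>\<^sub>2\<close>. Both \<open>\<langle>\<sigma>\<^sub>0, \<sigma>\<^sub>1\<rangle>\<close> and \<open>\<langle>\<sigma>\<^sub>1, \<sigma>\<^sub>2\<rangle>\<close> are dihedral of order 8, and killing \<open>\<sigma>\<^sub>2\<close>,
  respectively \<open>\<sigma>\<^sub>0\<close>, retracts \<open>T\<^sub>j\<close> onto them, because all translations in the defining lattice are even.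
  The required group is the iterated fibre product of \<open>T\<^sub>3, \<dots>, T\<^sub>d\<close>, in which the retract \<open>\<langle>\<sigma>\<^sub>1, \<sigma>\<^sub>2\<rangle>\<close> of \<open>T\<^sub>j\<close>
  is glued to the retract \<open>\<langle>\<sigma>\<^sub>0, \<sigma>\<^sub>1\<rangle>\<close> of \<open>T\<^sub>j\<^sub>+\<^sub>1\<close>; the generator \<open>\<rho>\<^sub>i\<close> has \<open>j\<close>-th coordinate
  \<open>\<sigma>\<^sub>i\<^sub>-\<^sub>j\<^sub>+\<^sub>3\<close>. A parabolic subgroup of the product consists of the elements all of whose coordinates lie in
  the corresponding parabolic subgroups of the \<open>T\<^sub>j\<close>, so the intersection property, flatness and the FAP
  can all be read off coordinatewise. The polytope is the coset geometry of this string C-group.\<close>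

section \<open>Coset polytopes of string C-groups\<close>

text \<open>Parabolic subgroups are defined here as intersections of maximal ones, so the
  intersection property costs nothing; the burden is to show that these intersections are generated
  by the reflections they contain. This is delicate in a fibre product, because a generator moves up
  to three coordinates at once. The finite groups T_j are never formed: a coordinate is a symmetry
  of the whole plane tessellation, and the lattices enter only through membership conditions and
  through the kernel of the action. Hence the gluing data, two maps onto a dihedral group of order
  8, are the same for all lattices; n >= 5 guarantees that the lattices are even. Each retraction is
  faithful on its retract, so a membership condition in one coordinate passes to the neighbouring
  ones (\<open>cond_up\<close>, \<open>cond_down\<close>). This is why a section of rank 3 sees a
  single T_j although its group elements have further coordinates. In the order, each coordinate
  after the first has a prescribed image in a group of order 8. It contributes 2^(n-3) instead of
  2^n, whence the term -3(d-3).\<close>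

definition add_subgroup :: "'a::group_add set \<Rightarrow> bool" where
  "add_subgroup S \<longleftrightarrow> 0 \<in> S \<and> (\<forall>x\<in>S. \<forall>y\<in>S. x + y \<in> S) \<and> (\<forall>x\<in>S. - x \<in> S)"

text \<open>No rule for inverses is needed because the letters will be involutions, and
  \<open>K\<close> may be confined to the right end because it will be normal.\<close>

inductive_set words :: "'a::group_add set \<Rightarrow> (int \<Rightarrow> 'a) \<Rightarrow> int set \<Rightarrow> 'a set" for K r J where
  base: "k \<in> K \<Longrightarrow> k \<in> words K r J"
| step: "j \<in> J \<Longrightarrow> x \<in> words K r J \<Longrightarrow> r j + x \<in> words K r J"

text \<open>Taking intersections builds in the intersection property of a C-group. That nothing
  beyond the generated subgroup arises is the hypothesis \<open>generated\<close> of the locale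
  below.\<close>

definition parabolic :: "int \<Rightarrow> 'a set \<Rightarrow> (int \<Rightarrow> 'a set) \<Rightarrow> int set \<Rightarrow> 'a set" where
  "parabolic d G M J = {g \<in> G. \<forall>i\<in>{0..<d} - J. g \<in> M i}"

lemma uminus_add_cancel_left: "- (g + h) + (g + h') = - h + (h' :: 'a :: group_add)"
  by (simp add: minus_add add.assoc [symmetric])

text \<open>Groups are written additively, although they are not commutative. The subgroup
  \<open>parabolic d G M {}\<close> need not be trivial: it acts trivially on the coset geometry, whose automorphism
  group is the quotient of \<open>G\<close> by it. The map \<open>face\<close> is an arbitrary injective encoding of the pairs of a
  rank \<open>i\<close> and a left coset of the \<open>i\<close>-th maximal parabolic subgroup; for \<open>i = -1\<close> and \<open>i = d\<close> that
  subgroup is \<open>G\<close>, which gives the two improper faces.\<close>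

locale string_c_group =
  fixes d :: int and G :: "'a::group_add set" and M :: "int \<Rightarrow> 'a set" and r :: "int \<Rightarrow> 'a"
    and face :: "int \<Rightarrow> 'a \<Rightarrow> 'f"
  assumes d_ge: "0 \<le> d"
    and subgroup_G: "add_subgroup G"
    and subgroup_M: "add_subgroup (M i)"
    and r_in_G: "0 \<le> i \<Longrightarrow> i < d \<Longrightarrow> r i \<in> G"
    and r_in_M: "0 \<le> i \<Longrightarrow> i < d \<Longrightarrow> i \<noteq> j \<Longrightarrow> r i \<in> M j"
    and r_notin_M: "0 \<le> i \<Longrightarrow> i < d \<Longrightarrow> r i \<notin> M i"
    and r_invol: "r i + r i = 0"
    and r_commute: "i + 2 \<le> j \<Longrightarrow> r i + r j = r j + r i"
    and kernel_normal: "g \<in> G \<Longrightarrow> k \<in> parabolic d G M {} \<Longrightarrow> g + k - g \<in> parabolic d G M {}"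
    and generated: "J \<subseteq> {0..<d} \<Longrightarrow> parabolic d G M J \<subseteq> words (parabolic d G M {}) r J"
    and face_eq: "g \<in> G \<Longrightarrow> h \<in> G \<Longrightarrow> i \<in> {-1..d} \<Longrightarrow> j \<in> {-1..d} \<Longrightarrow>
      face i g = face j h \<longleftrightarrow> i = j \<and> - g + h \<in> parabolic d G M (- {i})"
begin

section \<open>Parabolic subgroups and their factorisation\<close>

abbreviation H where "H \<equiv> parabolic d G M"

lemma G_closed [simp, intro]:
  "0 \<in> G" "x \<in> G \<Longrightarrow> y \<in> G \<Longrightarrow> x + y \<in> G" "x \<in> G \<Longrightarrow> - x \<in> G" "x \<in> G \<Longrightarrow> y \<in> G \<Longrightarrow> x - y \<in> G"
  using subgroup_G unfolding add_subgroup_def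
  by (auto simp del: add_uminus_conv_diff simp: add_uminus_conv_diff [symmetric])

lemma M_closed: "0 \<in> M i" "x \<in> M i \<Longrightarrow> y \<in> M i \<Longrightarrow> x + y \<in> M i" "x \<in> M i \<Longrightarrow> - x \<in> M i"
  using subgroup_M [of i] unfolding add_subgroup_def by blast+

lemma H_closed [simp, intro]:
  "0 \<in> H J" "x \<in> H J \<Longrightarrow> y \<in> H J \<Longrightarrow> x + y \<in> H J" "x \<in> H J \<Longrightarrow> - x \<in> H J"
  by (auto simp: parabolic_def M_closed)

lemma H_in_G: "x \<in> H J \<Longrightarrow> x \<in> G"
  by (simp add: parabolic_def)

lemma H_mono: "A \<inter> {0..<d} \<subseteq> B \<Longrightarrow> x \<in> H A \<Longrightarrow> x \<in> H B"
  by (auto simp: parabolic_def)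

lemma H_restrict: "H (J \<inter> {0..<d}) = H J"
  by (auto simp: parabolic_def)

lemma H_Inter:
  assumes "x \<in> G" and "\<And>i. i \<in> {0..<d} - J \<Longrightarrow> x \<in> H (- {i})" shows "x \<in> H J"
proof -
  have "x \<in> M i" if "i \<in> {0..<d} - J" for i
    using assms(2) [OF that] that by (simp add: parabolic_def)
  then show ?thesis using assms(1) by (simp add: parabolic_def)
qed

lemma r_in_H:
  assumes "i \<in> J" "0 \<le> i" "i < d" shows "r i \<in> H J"
proof -
  have "r i \<in> M j" if "j \<in> {0..<d} - J" for j
    using r_in_M [of i j] assms that by auto
  then show ?thesis using r_in_G [of i] assms by (simp add: parabolic_def)
qed

lemma r_notin_H: "i \<notin> J \<Longrightarrow> 0 \<le> i \<Longrightarrow> i < d \<Longrightarrow> r i \<notin> H J"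
  using r_notin_M [of i] by (auto simp: parabolic_def)

lemma r_commute': "i + 2 \<le> j \<or> j + 2 \<le> i \<Longrightarrow> r i + r j = r j + r i"
  using r_commute by metis

lemma uminus_r: "- r i = r i"
  using r_invol by (simp add: minus_unique)

lemma H_induct [consumes 1, case_names kernel step]:
  assumes "x \<in> H J" and base: "\<And>k. k \<in> H {} \<Longrightarrow> P k"
    and step: "\<And>j y. j \<in> J \<Longrightarrow> 0 \<le> j \<Longrightarrow> j < d \<Longrightarrow> y \<in> H J \<Longrightarrow> P y \<Longrightarrow> P (r j + y)"
  shows "P x"
proof -
  have "x \<in> words (H {}) r (J \<inter> {0..<d})"
    using assms(1) generated [of "J \<inter> {0..<d}"] by (auto simp: H_restrict)
  then have "x \<in> H J \<and> P x"
  proof induction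
    case (base k)
    then show ?case using assms(2) H_mono [of "{}" J] by auto
  next
    case (step j x)
    then show ?case using assms(3) r_in_H by auto
  qed
  then show ?thesis ..
qed

text \<open>Letters from \<open>A\<close> commute with letters from \<open>B\<close>, so a word can
  be sorted. The kernel is absorbed into the left factor, and a letter from \<open>B\<close> passes
  over that factor by conjugation, which fixes the letters from \<open>A\<close> and preserves the
  normal kernel.\<close>

lemma H_factor:
  assumes "x \<in> H J" and "J \<inter> {0..<d} \<subseteq> A \<union> B" and far: "\<And>a b. a \<in> A \<Longrightarrow> b \<in> B \<Longrightarrow> a + 2 \<le> b \<or> b + 2 \<le> a"
  obtains a b where "a \<in> H A" "b \<in> H B" "x = a + b"
proof -
  have conj: "r j + a - r j \<in> H A" if "a \<in> H A" "j \<in> B" "0 \<le> j" "j < d" for a j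
    using that(1)
  proof (induction rule: H_induct)
    case (kernel k)
    then show ?case using kernel_normal [of "r j" k] r_in_G that H_mono [of "{}" A] by auto
  next
    case (step i y)
    then have "r j + (r i + y) - r j = r i + (r j + y - r j)"
      using r_commute' [of i j] far [of i j] that by (simp add: add.assoc [symmetric] diff_conv_add_uminus del: add_uminus_conv_diff)
    then show ?case using step r_in_H by auto
  qed
  have "\<exists>a\<in>H A. \<exists>b\<in>H B. x = a + b"
    using assms(1)
  proof (induction rule: H_induct)
    case (kernel k)
    then have "k \<in> H A" using H_mono [of "{}" A] by auto
    then show ?case by (intro bexI [of _ k] bexI [of _ 0]) auto
  next
    case (step j y)
    then obtain a b where ab: "a \<in> H A" "b \<in> H B" "y = a + b" by blast
    show ?case
    proof (cases "j \<in> A")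
      case True
      then show ?thesis using ab step r_in_H [of j A]
        by (intro bexI [of _ "r j + a"] bexI [of _ b]) (auto simp: add.assoc)
    next
      case False
      then have "j \<in> B" using step assms(2) by auto
      then show ?thesis using ab step conj [of a j] r_in_H [of j B]
        by (intro bexI [of _ "r j + a - r j"] bexI [of _ "r j + b"]) (auto simp: add.assoc diff_conv_add_uminus simp del: add_uminus_conv_diff)
    qed
  qed
  then show ?thesis using that by blast
qed

lemma H_single:
  assumes "x \<in> H {j}" shows "x \<in> H {} \<or> (0 \<le> j \<and> j < d \<and> - r j + x \<in> H {})"
  using assms
proof (induction rule: H_induct)
  case (kernel k)
  then show ?case by simp
next
  case (step i y)
  then show ?case by (auto simp: add.assoc [symmetric] uminus_r r_invol)
qed

section \<open>Cosets as faces of a ranked poset\<close>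

lemma face_absorb: "x \<in> G \<Longrightarrow> c \<in> H (- {i}) \<Longrightarrow> i \<in> {-1..d} \<Longrightarrow> face i (x + c) = face i x"
  using face_eq [of x "x + c" i i] H_in_G by (auto simp: add.assoc [symmetric])

lemma face_improper: "x \<in> G \<Longrightarrow> y \<in> G \<Longrightarrow> i = -1 \<or> i = d \<Longrightarrow> face i x = face i y"
  using d_ge by (subst face_eq) (auto simp: parabolic_def)

text \<open>A common representative \<open>g\<close> expresses that two cosets meet. With this form
  of the order, transitivity is a theorem that rests on \<open>H_factor\<close>.\<close>

definition P :: "'f ranked_poset" where
  "P = \<lparr>faces = {face i g | i g. i \<in> {-1..d} \<and> g \<in> G},
        leq = (\<lambda>E F. \<exists>i j g. i \<in> {-1..d} \<and> j \<in> {-1..d} \<and> g \<in> G \<and> i \<le> j \<and> E = face i g \<and> F = face j g),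
        rk = (\<lambda>F. THE i. i \<in> {-1..d} \<and> (\<exists>g\<in>G. F = face i g))\<rparr>"

definition Fl :: "'a \<Rightarrow> 'f set" where
  "Fl g = (\<lambda>i. face i g) ` {-1..d}"

lemma faces_P: "F \<in> faces P \<longleftrightarrow> (\<exists>i g. i \<in> {-1..d} \<and> g \<in> G \<and> F = face i g)"
  by (auto simp: P_def)

lemma faceE:
  assumes "F \<in> faces P" obtains i g where "i \<in> {-1..d}" "g \<in> G" "F = face i g"
  using assms unfolding faces_P by blast

lemma face_in_P [simp, intro]: "i \<in> {-1..d} \<Longrightarrow> g \<in> G \<Longrightarrow> face i g \<in> faces P"
  by (auto simp: P_def)

lemma rk_face [simp]:
  assumes "i \<in> {-1..d}" "g \<in> G" shows "rk P (face i g) = i"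
proof -
  have "i' = i" if "i' \<in> {-1..d}" "h \<in> G" "face i g = face i' h" for i' h
    using face_eq [OF assms(2) that(2) assms(1) that(1)] that(3) by simp
  then show ?thesis unfolding P_def ranked_poset.simps using assms by (intro the_equality) blast+
qed

lemma leq_P: "leq P E F \<longleftrightarrow> (\<exists>i j g. i \<in> {-1..d} \<and> j \<in> {-1..d} \<and> g \<in> G \<and> i \<le> j \<and> E = face i g \<and> F = face j g)"
  by (simp add: P_def)

lemma leq_same [intro]: "i \<in> {-1..d} \<Longrightarrow> j \<in> {-1..d} \<Longrightarrow> g \<in> G \<Longrightarrow> i \<le> j \<Longrightarrow> leq P (face i g) (face j g)"
  unfolding leq_P by blast

lemma leq_rk: "leq P E F \<Longrightarrow> rk P E \<le> rk P F"
  by (auto simp: leq_P)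

lemma leq_rk_eq: "leq P E F \<Longrightarrow> rk P E = rk P F \<Longrightarrow> E = F"
  by (auto simp: leq_P)

lemma leq_refl: "F \<in> faces P \<Longrightarrow> leq P F F"
  unfolding faces_P leq_P by blast

lemma rk_range: "F \<in> faces P \<Longrightarrow> rk P F \<in> {-1..d}"
  by (auto simp: P_def [symmetric] faces_P)

lemma rk_cases: "F \<in> faces P \<Longrightarrow> \<exists>g\<in>G. F = face (rk P F) g"
  by (auto simp: faces_P)

text \<open>Elements of a chain share a coset representative: a representative \<open>g\<close> of the faces of rank at most
  \<open>i\<close> and a representative \<open>h\<close> of the \<open>i\<close>-face and the next face differ by an element \<open>a + b\<close> of the \<open>i\<close>-th
  maximal parabolic subgroup, split into its parts above and below \<open>i\<close>, and \<open>g + a\<close> represents all of them.\<close>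

lemma common_rep:
  assumes X: "X \<subseteq> faces P" and comp: "\<And>E F. E \<in> X \<Longrightarrow> F \<in> X \<Longrightarrow> leq P E F \<or> leq P F E"
  obtains g where "g \<in> G" "X \<subseteq> Fl g"
proof -
  \<comment> \<open>The induction starts at -2, below every rank, so that its base case is
    vacuous.\<close>
  have "\<exists>g\<in>G. \<forall>F\<in>X. rk P F \<le> m \<longrightarrow> F = face (rk P F) g" if "m \<ge> -2" for m
    using that
  proof (induction m rule: int_ge_induct)
    case base
    then show ?case using rk_range X by (intro bexI [of _ 0]) force+
  next
    case (step m)
    then obtain g where g: "g \<in> G" "\<And>F. F \<in> X \<Longrightarrow> rk P F \<le> m \<Longrightarrow> F = face (rk P F) g" by blast
    show ?case
    proof (cases "\<exists>F\<in>X. rk P F = m + 1")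
      case False
      then show ?thesis using g by (intro bexI [of _ g]) force+
    next
      case True
      then obtain E where E: "E \<in> X" "rk P E = m + 1" by blast
      then have uniq: "F = E" if "F \<in> X" "rk P F = m + 1" for F
        using comp [of E F] that leq_rk_eq by metis
      show ?thesis
      proof (cases "\<exists>F\<in>X. rk P F \<le> m")
        case False
        obtain h where "h \<in> G" "E = face (rk P E) h" using rk_cases [of E] E X by blast
        then show ?thesis using False E uniq by (intro bexI [of _ h]) (metis zle_add1_eq_le order_le_less)+
      next
        case True
        \<comment> \<open>The chain may skip ranks, so the comparison is made with its highest face
          of rank at most \<open>m\<close>.\<close>
        define R where "R = rk P ` {F \<in> X. rk P F \<le> m}"
        have fin: "finite R" "R \<noteq> {}" using True rk_range X
          by (auto simp: R_def intro!: finite_subset [of _ "{-1..d}"]) 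
        then have "Max R \<in> R" by (rule Max_in)
        then obtain F where F: "F \<in> X" "rk P F = Max R" "rk P F \<le> m" by (force simp: R_def)
        have max: "rk P F' \<le> rk P F" if "F' \<in> X" "rk P F' \<le> m" for F'
          using fin that F by (auto simp: R_def)
        have "leq P F E" using comp [of F E] F E leq_rk [of E F] by auto
        then obtain i j h where h: "i \<in> {-1..d}" "j \<in> {-1..d}" "h \<in> G" "F = face i h" "E = face j h"
          unfolding leq_P by blast
        then have ij: "rk P F = i" "j = m + 1" "i \<le> m" using E F by auto
        then have "face i g = face i h" using g F h by metis
        then have "- g + h \<in> H (- {i})" using face_eq g h by blast
        then obtain a b where ab: "a \<in> H {i<..}" "b \<in> H {..<i}" "- g + h = a + b"
          by (rule H_factor [where A = "{i<..}" and B = "{..<i}"]) auto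
        have eq: "h = (g + a) + b" using ab(3) by (metis add.assoc add_minus_cancel)
        have ga: "g + a \<in> G" using g ab H_in_G by blast
        have "face j h = face j (g + a)" unfolding eq
          by (rule face_absorb) (use ga ab h ij H_mono [of "{..<i}" "- {j}" b] in auto)
        moreover have "face k (g + a) = face k g" if "k \<le> i" "k \<in> {-1..d}" for k
          by (rule face_absorb) (use that g ab H_mono [of "{i<..}" "- {k}" a] in auto)
        ultimately have "F' = face (rk P F') (g + a)" if F': "F' \<in> X" "rk P F' \<le> m + 1" for F'
        proof (cases "rk P F' \<le> m")
          case True
          then have "F' = face (rk P F') g" using g F' by blast
          moreover have "rk P F' \<in> {-1..d}" using rk_range F' X by blast
          ultimately show ?thesis using max [OF F'(1) True] ij \<open>\<And>k. k \<le> i \<Longrightarrow> k \<in> {-1..d} \<Longrightarrow> face k (g + a) = face k g\<close>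
            by metis
        next
          case False
          then have "F' = E" "rk P F' = m + 1" using uniq [of F'] F' by auto
          then show ?thesis using h(5) ij \<open>face j h = face j (g + a)\<close> by simp
        qed
        then show ?thesis using ga by blast
      qed
    qed
  qed
  from this [of d] obtain g where g: "g \<in> G" "\<And>F. F \<in> X \<Longrightarrow> rk P F \<le> d \<Longrightarrow> F = face (rk P F) g"
    using d_ge by auto
  have "F \<in> Fl g" if "F \<in> X" for F
  proof -
    have "rk P F \<in> {-1..d}" using rk_range [of F] X that by blast
    then show ?thesis unfolding Fl_def by (rule rev_image_eqI) (use g(2) [OF that] \<open>rk P F \<in> {-1..d}\<close> in simp)
  qed
  then have "X \<subseteq> Fl g" by blast
  then show ?thesis using that g by blast
qed

lemma chain_rep:
  assumes "E \<in> faces P" "F \<in> faces P" "leq P E F" "E' \<in> faces P" "leq P E E'" "leq P E' F"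
  obtains g where "g \<in> G" "E = face (rk P E) g" "E' = face (rk P E') g" "F = face (rk P F) g"
proof -
  obtain g where "g \<in> G" "{E, E', F} \<subseteq> Fl g"
    by (rule common_rep [of "{E, E', F}"]) (use assms leq_refl in auto)
  then show ?thesis using that by (fastforce simp: Fl_def)
qed

text \<open>The representatives of the two incidences differ by an element of the maximal parabolic
  of the middle rank. Its factor with indices above that rank leaves the lower face fixed, its other
  factor leaves the upper face fixed.\<close>

lemma leq_trans:
  assumes "leq P E F" "leq P F E'" shows "leq P E E'"
proof -
  obtain i j g where g: "i \<in> {-1..d}" "j \<in> {-1..d}" "g \<in> G" "i \<le> j" "E = face i g" "F = face j g"
    using assms leq_P by blast
  obtain j' k h where h: "j' \<in> {-1..d}" "k \<in> {-1..d}" "h \<in> G" "j' \<le> k" "F = face j' h" "E' = face k h"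
    using assms leq_P by blast
  have eq: "j' = j" "- g + h \<in> H (- {j})" using face_eq [of g h j j'] g h by auto
  from eq(2) obtain a b where ab: "a \<in> H {j<..}" "b \<in> H {..<j}" "- g + h = a + b"
    by (rule H_factor [where A = "{j<..}" and B = "{..<j}"]) auto
  have eqh: "h = (g + a) + b" using ab(3) by (metis add.assoc add_minus_cancel)
  have ga: "g + a \<in> G" using g ab H_in_G by blast
  have "face k h = face k (g + a)" unfolding eqh
    by (rule face_absorb) (use ga ab h eq H_mono [of "{..<j}" "- {k}" b] in auto)
  moreover have "face i (g + a) = face i g"
    by (rule face_absorb) (use g ab H_mono [of "{j<..}" "- {i}" a] in auto)
  ultimately show ?thesis unfolding g h using leq_same [of i k "g + a"] ga g h eq by auto
qed

section \<open>Flags, connectedness and the diamond condition\<close>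

lemma Fl_faces: "g \<in> G \<Longrightarrow> Fl g \<subseteq> faces P"
  by (auto simp: Fl_def)

lemma face_in_Fl:
  assumes "i \<in> {-1..d}" "g \<in> G" "h \<in> G" shows "face i g \<in> Fl h \<longleftrightarrow> face i g = face i h"
proof
  assume "face i g \<in> Fl h"
  then obtain j where j: "j \<in> {-1..d}" "face i g = face j h" by (auto simp: Fl_def)
  then have "i = j" using face_eq [OF assms(2,3,1) j(1)] by simp
  then show "face i g = face i h" using j by simp
qed (use assms in \<open>simp add: Fl_def\<close>)

lemma Fl_eq_iff_faces:
  assumes "g \<in> G" "h \<in> G" shows "Fl g = Fl h \<longleftrightarrow> (\<forall>i\<in>{-1..d}. face i g = face i h)"
proof
  assume eq: "Fl g = Fl h"
  have "face i g = face i h" if "i \<in> {-1..d}" for i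
  proof -
    have "face i g \<in> Fl g" unfolding Fl_def by (rule imageI) (rule that)
    then show ?thesis using face_in_Fl [OF that assms] eq by simp
  qed
  then show "\<forall>i\<in>{-1..d}. face i g = face i h" ..
next
  assume "\<forall>i\<in>{-1..d}. face i g = face i h"
  then show "Fl g = Fl h" unfolding Fl_def by (intro image_cong) auto
qed

lemma Fl_eq: assumes "g \<in> G" "h \<in> G" shows "Fl g = Fl h \<longleftrightarrow> - g + h \<in> H {}"
proof -
  have "Fl g = Fl h \<longleftrightarrow> (\<forall>i\<in>{-1..d}. - g + h \<in> H (- {i}))"
    using assms by (simp add: Fl_eq_iff_faces face_eq)
  also have "\<dots> \<longleftrightarrow> - g + h \<in> H {}"
  proof
    assume *: "\<forall>i\<in>{-1..d}. - g + h \<in> H (- {i})"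
    show "- g + h \<in> H {}" by (rule H_Inter) (use assms * in auto)
  next
    assume *: "- g + h \<in> H {}"
    show "\<forall>i\<in>{-1..d}. - g + h \<in> H (- {i})"
      by (intro ballI H_mono [OF _ *]) auto
  qed
  finally show ?thesis .
qed

lemma Fl_chain:
  assumes "g \<in> G" shows "pred_on.chain (faces P) (leq P) (Fl g)"
proof -
  have "leq P E F \<or> leq P F E" if "E \<in> Fl g" "F \<in> Fl g" for E F
  proof -
    obtain i k where ik: "i \<in> {-1..d}" "k \<in> {-1..d}" "E = face i g" "F = face k g"
      using \<open>E \<in> Fl g\<close> \<open>F \<in> Fl g\<close> unfolding Fl_def by blast
    show ?thesis
      unfolding ik(3,4) using leq_same [OF ik(1,2) assms] leq_same [OF ik(2,1) assms] by linarith
  qed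
  then show ?thesis using Fl_faces [OF assms] unfolding pred_on.chain_def by blast
qed

lemma Fl_subset_eq: assumes "g \<in> G" "h \<in> G" "Fl g \<subseteq> Fl h" shows "Fl g = Fl h"
  unfolding Fl_eq_iff_faces [OF assms(1,2)]
proof
  fix i assume i: "i \<in> {-1..d}"
  have "face i g \<in> Fl g" unfolding Fl_def by (rule imageI) (rule i)
  then show "face i g = face i h" using face_in_Fl [OF i assms(1,2)] assms(3) by blast
qed

lemma chain_subset_Fl:
  assumes "pred_on.chain (faces P) (leq P) X" obtains g where "g \<in> G" "X \<subseteq> Fl g"
proof (rule common_rep [of X])
  show "X \<subseteq> faces P" using assms by (auto simp: pred_on.chain_def)
  show "leq P E F \<or> leq P F E" if "E \<in> X" "F \<in> X" for E F
  proof -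
    have "E \<in> faces P" using that assms by (auto simp: pred_on.chain_def)
    then have "leq P E E" by (rule leq_refl)
    then show ?thesis using that assms by (auto simp: pred_on.chain_def)
  qed
qed (use that in blast)

text \<open>By \<open>common_rep\<close> every chain lies in some \<open>Fl g\<close>, and one
  \<open>Fl g\<close> inside another forces equality because each has exactly one face of every
  rank.\<close>

lemma flag_iff: "flag P \<Phi> \<longleftrightarrow> (\<exists>g\<in>G. \<Phi> = Fl g)"
proof
  assume f: "flag P \<Phi>"
  then have "pred_on.chain (faces P) (leq P) \<Phi>" by (simp add: flag_def pred_on.maxchain_def)
  then obtain g where "g \<in> G" "\<Phi> \<subseteq> Fl g" by (rule chain_subset_Fl)
  then show "\<exists>g\<in>G. \<Phi> = Fl g" using f Fl_chain by (auto simp: flag_def pred_on.maxchain_def)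
next
  assume "\<exists>g\<in>G. \<Phi> = Fl g"
  then obtain g where g: "g \<in> G" "\<Phi> = Fl g" by blast
  have False if X: "pred_on.chain (faces P) (leq P) X" "Fl g \<subset> X" for X
  proof -
    obtain h where "h \<in> G" "X \<subseteq> Fl h" using X(1) by (rule chain_subset_Fl)
    then show False using Fl_subset_eq [of g h] g X by auto
  qed
  then show "flag P \<Phi>" using g Fl_chain by (auto simp: flag_def pred_on.maxchain_def)
qed

lemma Fl_mult_r:
  assumes "g \<in> G" "0 \<le> j" "j < d"
  shows "i \<in> {-1..d} \<Longrightarrow> i \<noteq> j \<Longrightarrow> face i (g + r j) = face i g" "face j (g + r j) \<noteq> face j g"
proof -
  show "i \<in> {-1..d} \<Longrightarrow> i \<noteq> j \<Longrightarrow> face i (g + r j) = face i g"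
    using assms r_in_H [of j "- {i}"] by (intro face_absorb) auto
  show "face j (g + r j) \<noteq> face j g"
    using face_eq [of g "g + r j" j j] assms r_notin_H [of j "- {j}"] r_in_G by (auto simp: add.assoc [symmetric])
qed

lemma Fl_adjacent:
  assumes g: "g \<in> G" and j: "0 \<le> j" "j < d"
  shows "adjacent_flags P (Fl g) (Fl (g + r j))"
proof -
  have G: "g + r j \<in> G" using g j r_in_G by auto
  have diff: "Fl x - Fl y = {face j x}"
    if xy: "x \<in> G" "y \<in> G" "face j x \<noteq> face j y" and eq: "\<And>i. i \<in> {-1..d} \<Longrightarrow> i \<noteq> j \<Longrightarrow> face i x = face i y" for x y
  proof -
    have *: "face i x \<in> Fl y \<longleftrightarrow> i \<noteq> j" if i: "i \<in> {-1..d}" for i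
      using face_in_Fl [OF i xy(1,2)] xy(3) eq [OF i] by blast
    have "j \<in> {-1..d}" using j by simp
    then show ?thesis using * unfolding Fl_def [of x] by blast
  qed
  have ne: "face j g \<noteq> face j (g + r j)" using Fl_mult_r(2) [OF g j] by simp
  have "Fl g - Fl (g + r j) = {face j g}"
    by (rule diff [OF g G ne]) (rule Fl_mult_r(1) [OF g j, symmetric])
  moreover have "Fl (g + r j) - Fl g = {face j (g + r j)}"
    by (rule diff [OF G g ne [symmetric]]) (rule Fl_mult_r(1) [OF g j])
  moreover have "flag P (Fl g)" "flag P (Fl (g + r j))" unfolding flag_iff using g G by blast+
  ultimately show ?thesis unfolding adjacent_flags_def by simp
qed

lemma bij_rk_Fl: assumes "g \<in> G" shows "bij_betw (rk P) (Fl g) {-1..d}"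
  unfolding Fl_def bij_betw_def inj_on_def using assms by (auto simp: image_image)

text \<open>If two flags share exactly the faces with ranks in \<open>J\<close>, the intersection
  property puts \<open>- g + h\<close> into \<open>H (- J)\<close>. A word for this element, read
  letter by letter, is a path of adjacent flags that never changes a face with rank in
  \<open>J\<close>.\<close>

lemma P_connected: "strongly_flag_connected P"
  unfolding strongly_flag_connected_def
proof (intro allI impI)
  fix \<Phi> \<Psi> assume "flag P \<Phi>" "flag P \<Psi>"
  then obtain g h where g: "g \<in> G" "h \<in> G" and eq: "\<Phi> = Fl g" "\<Psi> = Fl h" unfolding flag_iff by blast
  define J where "J = {i \<in> {-1..d}. face i g = face i h}"
  have int: "Fl g \<inter> Fl h = (\<lambda>i. face i g) ` J"
  proof -
    have "face i g \<in> Fl h \<longleftrightarrow> i \<in> J" if "i \<in> {-1..d}" for i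
      using face_in_Fl [OF that g] that by (simp add: J_def)
    moreover have "J \<subseteq> {-1..d}" by (auto simp: J_def)
    ultimately show ?thesis unfolding Fl_def [of g] by blast
  qed
  define S where "S = (\<lambda>i. face i g) ` J"
  define R where "R = (\<lambda>A B. adjacent_flags P A B \<and> S \<subseteq> A \<and> S \<subseteq> B)"
  have sub: "S \<subseteq> Fl x" if "\<forall>i\<in>J. face i x = face i g" for x
  proof -
    have "S = (\<lambda>i. face i x) ` J" unfolding S_def by (rule image_cong) (use that in auto)
    then show ?thesis by (auto simp: Fl_def J_def)
  qed
  \<comment> \<open>Removing the first letter of the word moves the starting flag, hence the
    quantifier over \<open>x\<close>.\<close>
  have path: "\<forall>x\<in>G. (\<forall>i\<in>J. face i x = face i g) \<longrightarrow> R\<^sup>*\<^sup>* (Fl x) (Fl (x + z))" if "z \<in> H (- J)" for z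
    using that
  proof (induction rule: H_induct)
    case (kernel k)
    have "Fl (x + k) = Fl x" if "x \<in> G" for x
      using Fl_eq [of x "x + k"] that kernel H_in_G by (simp add: add.assoc [symmetric])
    then show ?case by (intro ballI impI) (simp add: rtranclp.rtrancl_refl)
  next
    case (step j y)
    show ?case
    proof (intro ballI impI)
      fix x assume x: "x \<in> G" "\<forall>i\<in>J. face i x = face i g"
      have x': "x + r j \<in> G" using x(1) step(2,3) r_in_G by simp
      have fx': "\<forall>i\<in>J. face i (x + r j) = face i g"
      proof
        fix i assume i: "i \<in> J"
        then have "i \<in> {-1..d}" "i \<noteq> j" using step(1) unfolding J_def by blast+
        then show "face i (x + r j) = face i g"
          using Fl_mult_r(1) [OF x(1) step(2,3), of i] x(2) i by simp
      qed
      have "R (Fl x) (Fl (x + r j))"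
        unfolding R_def using Fl_adjacent [OF x(1) step(2,3)] sub [OF x(2)] sub [OF fx'] by blast
      moreover have "R\<^sup>*\<^sup>* (Fl (x + r j)) (Fl (x + r j + y))" using step.IH x' fx' by blast
      ultimately show "R\<^sup>*\<^sup>* (Fl x) (Fl (x + (r j + y)))"
        by (simp add: converse_rtranclp_into_rtranclp add.assoc)
    qed
  qed
  have "- g + h \<in> H (- J)"
  proof (rule H_Inter)
    fix i assume "i \<in> {0..<d} - - J"
    then have "i \<in> {-1..d}" "face i g = face i h" by (auto simp: J_def)
    then show "- g + h \<in> H (- {i})" using face_eq [OF g, of i i] by simp
  qed (use g in simp)
  then have "R\<^sup>*\<^sup>* (Fl g) (Fl (g + (- g + h)))" using path g(1) by blast
  then show "(\<lambda>A B. adjacent_flags P A B \<and> \<Phi> \<inter> \<Psi> \<subseteq> A \<and> \<Phi> \<inter> \<Psi> \<subseteq> B)\<^sup>*\<^sup>* \<Phi> \<Psi>"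
    unfolding eq int R_def S_def by (simp add: add.assoc [symmetric])
qed

text \<open>The faces between the two given ones correspond to \<open>H (- {i, i + 2})\<close>
  modulo its part with indices below \<open>i\<close> or above \<open>i + 2\<close>. What remains is
  \<open>H {i + 1}\<close>, which has two elements modulo the kernel.\<close>

lemma P_diamond: "diamond_condition P"
  unfolding diamond_condition_def
proof (intro ballI impI)
  fix E F assume EF: "E \<in> faces P" "F \<in> faces P" "leq P E F \<and> rk P F = rk P E + 2"
  then obtain i j g where g: "g \<in> G" "E = face i g" "F = face j g" "i \<in> {-1..d}" "j \<in> {-1..d}"
    unfolding leq_P by blast
  then have j: "j = i + 2" using EF by auto
  have i: "0 \<le> i + 1" "i + 1 < d" using g j by auto
  have gr: "g + r (i + 1) \<in> G" using g r_in_G i by auto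
  have "X = face (i + 1) g \<or> X = face (i + 1) (g + r (i + 1))"
    if X: "X \<in> faces P" "rk P X = i + 1" "leq P E X" "leq P X F" for X
  proof -
    obtain h where h: "h \<in> G" "E = face (rk P E) h" "X = face (rk P X) h" "F = face (rk P F) h"
      using chain_rep [of E F X] EF X by metis
    then have "face i g = face i h" "face j g = face j h" using g by auto
    then have "- g + h \<in> H (- {i})" "- g + h \<in> H (- {j})" using face_eq g h by auto
    then have "- g + h \<in> H (- {i, i + 2})" unfolding j by (auto simp: parabolic_def)
    then obtain a b where ab: "a \<in> H {i + 1}" "b \<in> H ({..<i} \<union> {i+2<..})" "- g + h = a + b"
      by (rule H_factor [where A = "{i + 1}" and B = "{..<i} \<union> {i+2<..}"]) auto
    have eqh: "h = (g + a) + b" using ab(3) by (metis add.assoc add_minus_cancel)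
    have "face (i + 1) h = face (i + 1) (g + a)" unfolding eqh
      by (rule face_absorb) (use g h i ab H_in_G H_mono [of "{..<i} \<union> {i+2<..}" "- {i + 1}" b] in auto)
    moreover have "face (i + 1) (g + a) = face (i + 1) g \<or> face (i + 1) (g + a) = face (i + 1) (g + r (i + 1))"
    proof (cases "a \<in> H {}")
      case True
      then show ?thesis using face_absorb [of g a "i + 1"] H_mono [of "{}" "- {i + 1}" a] g i by auto
    next
      case False
      then have "- r (i + 1) + a \<in> H {}" using H_single ab by blast
      then show ?thesis
        using face_absorb [of "g + r (i + 1)" "- r (i + 1) + a" "i + 1"] H_mono [of "{}" "- {i + 1}" "- r (i + 1) + a"] gr i
        by (auto simp: add.assoc)
    qed
    ultimately show ?thesis using h X by auto
  qed
  moreover have "leq P E (face (i + 1) g)" "leq P (face (i + 1) g) F"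
    unfolding g using g j by auto
  moreover have "leq P E (face (i + 1) (g + r (i + 1)))" "leq P (face (i + 1) (g + r (i + 1))) F"
    unfolding g using leq_same [of i "i + 1" "g + r (i + 1)"] leq_same [of "i + 1" j "g + r (i + 1)"] 
      Fl_mult_r(1) [OF g(1) i, of i] Fl_mult_r(1) [OF g(1) i, of j] g(4,5) gr j by auto
  ultimately have "{X \<in> faces P. rk P X = rk P E + 1 \<and> leq P E X \<and> leq P X F} = {face (i + 1) g, face (i + 1) (g + r (i + 1))}"
    using g gr i by auto
  then show "card {X \<in> faces P. rk P X = rk P E + 1 \<and> leq P E X \<and> leq P X F} = 2"
    using Fl_mult_r(2) [OF g(1) i] by auto
qed

lemma polytope_P: "polytope d P"
  unfolding polytope_def
proof (intro conjI)
  show "- 1 \<le> d" using d_ge by simp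
  show "reflp_on (faces P) (leq P)" by (rule reflp_onI) (rule leq_refl)
  show "antisymp_on (faces P) (leq P)"
    by (metis antisymp_onI leq_rk leq_rk_eq order_antisym)
  show "transp_on (faces P) (leq P)" by (auto intro: transp_onI leq_trans)
  show "rk P ` faces P \<subseteq> {- 1..d}" using rk_range by blast
  show "\<forall>F\<in>faces P. \<forall>G\<in>faces P. leq P F G \<and> F \<noteq> G \<longrightarrow> rk P F < rk P G"
    by (metis leq_rk leq_rk_eq order_less_le)
  have "leq P (face (-1) 0) F" "leq P F (face d 0)" if F: "F \<in> faces P" for F
  proof -
    obtain i g where g: "i \<in> {-1..d}" "g \<in> G" "F = face i g" using F by (rule faceE)
    then show "leq P (face (-1) 0) F" "leq P F (face d 0)"
      using leq_same [of "-1" i g] leq_same [of i d g] face_improper [of g 0] by auto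
  qed
  moreover have "rk P (face (-1) 0) = -1" "rk P (face d 0) = d" "face (-1) 0 \<in> faces P" "face d 0 \<in> faces P"
    using d_ge by auto
  ultimately show "\<exists>F\<in>faces P. rk P F = - 1 \<and> (\<forall>G\<in>faces P. leq P F G)"
    "\<exists>F\<in>faces P. rk P F = d \<and> (\<forall>G\<in>faces P. leq P G F)"
    by blast+
  show "\<forall>\<Phi>. flag P \<Phi> \<longrightarrow> bij_betw (rk P) \<Phi> {- 1..d}"
    unfolding flag_iff using bij_rk_Fl by blast
qed (rule P_connected P_diamond)+

section \<open>The automorphism group as the group of left translations\<close>

definition L :: "'a \<Rightarrow> 'f \<Rightarrow> 'f" where
  "L g = (\<lambda>F\<in>faces P. THE F'. \<exists>i\<in>{-1..d}. \<exists>h\<in>G. F = face i h \<and> F' = face i (g + h))"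

lemma L_outside: "F \<notin> faces P \<Longrightarrow> L g F = undefined"
  by (simp add: L_def)

lemma L_face [simp]: assumes "g \<in> G" "i \<in> {-1..d}" "h \<in> G" shows "L g (face i h) = face i (g + h)"
proof -
  have "F' = face i (g + h)" if F': "\<exists>i'\<in>{-1..d}. \<exists>h'\<in>G. face i h = face i' h' \<and> F' = face i' (g + h')" for F'
  proof -
    obtain i' h' where h': "i' \<in> {-1..d}" "h' \<in> G" "face i h = face i' h'" "F' = face i' (g + h')"
      using F' by blast
    have *: "i = i'" "- h + h' \<in> H (- {i})" using face_eq [OF assms(3) h'(2) assms(2) h'(1)] h'(3) by auto
    then have "face i (g + h) = face i (g + h')"
      using face_eq [of "g + h" "g + h'" i i] assms h' by (simp add: uminus_add_cancel_left)
    then show ?thesis using h' * by simp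
  qed
  then have "(THE F'. \<exists>i'\<in>{-1..d}. \<exists>h'\<in>G. face i h = face i' h' \<and> F' = face i' (g + h')) = face i (g + h)"
    using assms by (intro the_equality) blast+
  then show ?thesis using assms unfolding L_def by simp
qed

lemma L_faces: assumes "g \<in> G" "F \<in> faces P" shows "L g F \<in> faces P"
  using assms(2) by (rule faceE) (use assms(1) in auto)

lemma L_add_apply: assumes "g \<in> G" "h \<in> G" "F \<in> faces P" shows "L (g + h) F = L g (L h F)"
  using assms(3) by (rule faceE) (use assms(1,2) in \<open>simp add: add.assoc\<close>)

lemma L_add: assumes "g \<in> G" "h \<in> G" shows "L (g + h) = compose (faces P) (L g) (L h)"
proof
  fix F show "L (g + h) F = compose (faces P) (L g) (L h) F"
    by (cases "F \<in> faces P") (simp_all add: compose_def L_outside L_add_apply assms)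
qed

lemma L_0_apply: assumes "F \<in> faces P" shows "L 0 F = F"
  using assms by (rule faceE) simp

lemma L_0: "L 0 = (\<lambda>F\<in>faces P. F)"
proof
  fix F show "L 0 F = (\<lambda>F\<in>faces P. F) F"
    by (cases "F \<in> faces P") (simp_all add: L_outside L_0_apply)
qed

lemma L_uminus_apply: assumes "g \<in> G" "F \<in> faces P" shows "L (- g) (L g F) = F" "L g (L (- g) F) = F"
  using L_add_apply [of "- g" g F] L_add_apply [of g "- g" F] assms by (simp_all add: L_0_apply)

lemma L_leq: assumes "g \<in> G" "E \<in> faces P" "F \<in> faces P" shows "leq P (L g E) (L g F) \<longleftrightarrow> leq P E F"
proof -
  have *: "leq P (L g E) (L g F)" if g: "g \<in> G" and "leq P E F" for g E F
  proof -
    obtain i j h where h: "i \<in> {-1..d}" "j \<in> {-1..d}" "h \<in> G" "i \<le> j" "E = face i h" "F = face j h"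
      using \<open>leq P E F\<close> unfolding leq_P by blast
    have "leq P (face i (g + h)) (face j (g + h))" by (rule leq_same) (use h g in auto)
    then show ?thesis using h g by simp
  qed
  show ?thesis using * [of g E F] * [of "- g" "L g E" "L g F"] assms by (auto simp: L_uminus_apply)
qed

lemma L_Bij: assumes "g \<in> G" shows "L g \<in> Bij (faces P)"
proof -
  have "bij_betw (L g) (faces P) (faces P)"
    by (rule bij_betw_byWitness [where f' = "L (- g)"]) (use assms L_faces in \<open>auto simp: L_uminus_apply\<close>)
  then show ?thesis by (simp add: Bij_def L_def extensional_def)
qed

lemma L_in_aut: "g \<in> G \<Longrightarrow> L g \<in> carrier (aut_group P)"
  by (auto simp: aut_group_def L_Bij L_leq)

lemma L_image_Fl: "g \<in> G \<Longrightarrow> h \<in> G \<Longrightarrow> L g ` Fl h = Fl (g + h)"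
  by (auto simp: Fl_def image_image)

text \<open>Automorphisms are only required to preserve the order. The chain of all
  \<open>face k g\<close> is mapped to a strictly increasing one whose ranks still lie between -1
  and \<open>d\<close>, so each rank is pinned from below and from above.\<close>

lemma aut_rk:
  assumes f: "f \<in> carrier (aut_group P)" and F: "F \<in> faces P" shows "rk P (f F) = rk P F"
proof -
  have fP: "bij_betw f (faces P) (faces P)" and leq: "\<And>E F. E \<in> faces P \<Longrightarrow> F \<in> faces P \<Longrightarrow> leq P (f E) (f F) \<longleftrightarrow> leq P E F"
    using f by (auto simp: aut_group_def Bij_def)
  obtain i g where g: "i \<in> {-1..d}" "g \<in> G" "F = face i g" using F by (rule faceE)
  have fin: "f (face k g) \<in> faces P" if "k \<in> {-1..d}" for k
    using fP that g by (auto simp: bij_betw_def)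
  have strict: "rk P (f (face k g)) < rk P (f (face (k + 1) g))" if "-1 \<le> k" "k + 1 \<le> d" for k
  proof -
    have "face k g \<noteq> face (k + 1) g" using face_eq [of g g k "k + 1"] that g by auto
    then have "f (face k g) \<noteq> f (face (k + 1) g)"
      using fP that g by (auto simp: bij_betw_def inj_on_def)
    moreover have "leq P (f (face k g)) (f (face (k + 1) g))"
      using leq that g by auto
    ultimately show ?thesis using leq_rk leq_rk_eq by (metis order_less_le)
  qed
  have "i \<le> d \<longrightarrow> i \<le> rk P (f (face i g))"
    using g(1)[unfolded atLeastAtMost_iff, THEN conjunct1]
  proof (induction i rule: int_ge_induct)
    case base
    then show ?case using rk_range [OF fin [of "-1"]] d_ge by auto
  next
    case (step k)
    then show ?case using strict [of k] by auto
  qed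
  moreover have "-1 \<le> i \<longrightarrow> rk P (f (face i g)) \<le> i"
    using g(1)[unfolded atLeastAtMost_iff, THEN conjunct2]
  proof (induction i rule: int_le_induct)
    case base
    then show ?case using rk_range [OF fin [of d]] d_ge by auto
  next
    case (step k)
    then show ?case using strict [of "k - 1"] by auto
  qed
  ultimately show ?thesis using g by auto
qed

lemma adjacent_cases:
  assumes "x \<in> G" "y \<in> G" "0 \<le> j" "j < d" "\<And>i. i \<in> {-1..d} \<Longrightarrow> i \<noteq> j \<Longrightarrow> face i x = face i y"
  shows "Fl x = Fl y \<or> Fl x = Fl (y + r j)"
proof -
  have "- y + x \<in> H {j}"
  proof (rule H_Inter)
    fix i assume i: "i \<in> {0..<d} - {j}"
    then have "i \<in> {-1..d}" by simp
    then show "- y + x \<in> H (- {i})" using face_eq [of y x i i] assms(1,2) assms(5) [of i] i by simp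
  qed (use assms in simp)
  from H_single [OF this] show ?thesis
  proof
    assume "- y + x \<in> H {}"
    then show ?thesis using Fl_eq [of y x] assms by auto
  next
    assume "0 \<le> j \<and> j < d \<and> - r j + (- y + x) \<in> H {}"
    moreover have "- (y + r j) + x = - r j + (- y + x)"
      by (simp add: minus_add add.assoc [symmetric])
    ultimately have "- (y + r j) + x \<in> H {}" by simp
    then show ?thesis using Fl_eq [of "y + r j" x] assms r_in_G by auto
  qed
qed

lemma aut_image_Fl:
  assumes f: "f \<in> carrier (aut_group P)" and g: "g \<in> G"
  obtains g' where "g' \<in> G" "\<And>i. i \<in> {-1..d} \<Longrightarrow> f (face i g) = face i g'"
proof -
  have fP: "bij_betw f (faces P) (faces P)" and leq: "\<And>E F. E \<in> faces P \<Longrightarrow> F \<in> faces P \<Longrightarrow> leq P (f E) (f F) \<longleftrightarrow> leq P E F"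
    using f by (auto simp: aut_group_def Bij_def)
  have fin: "f F \<in> faces P" if "F \<in> faces P" for F
    using fP that by (auto simp: bij_betw_def)
  have sub: "f ` Fl g \<subseteq> faces P" using fin Fl_faces g by auto
  have comp: "leq P E F \<or> leq P F E" if EF: "E \<in> f ` Fl g" "F \<in> f ` Fl g" for E F
  proof -
    obtain i k where ik: "i \<in> {-1..d}" "k \<in> {-1..d}" "E = f (face i g)" "F = f (face k g)"
      using EF unfolding Fl_def by blast
    have "leq P (face i g) (face k g) \<or> leq P (face k g) (face i g)"
      using leq_same [OF ik(1,2) g] leq_same [OF ik(2,1) g] by linarith
    then show ?thesis unfolding ik(3,4) using leq ik(1,2) g by simp
  qed
  obtain g' where g': "g' \<in> G" "f ` Fl g \<subseteq> Fl g'"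
    using common_rep [OF sub comp] by blast
  have "f (face i g) = face i g'" if i: "i \<in> {-1..d}" for i
  proof -
    have "f (face i g) \<in> Fl g'" using g' i unfolding Fl_def by blast
    then obtain k where k: "k \<in> {-1..d}" "f (face i g) = face k g'" unfolding Fl_def by blast
    then have "k = i" using aut_rk [OF f, of "face i g"] g g'(1) i by simp
    then show ?thesis using k by simp
  qed
  then show ?thesis using that g' by blast
qed

text \<open>If an automorphism agrees with a left translation on one flag, it does so on every
  adjacent flag, since \<open>adjacent_cases\<close> leaves only one alternative there. Words in the
  generators reach all flags.\<close>

lemma aut_eq_L:
  assumes f: "f \<in> carrier (aut_group P)" obtains g where "g \<in> G" "f = L g"
proof -
  obtain g where g: "g \<in> G" "\<And>i. i \<in> {-1..d} \<Longrightarrow> f (face i 0) = face i g"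
    using aut_image_Fl [OF f, of 0] by auto
  have fP: "bij_betw f (faces P) (faces P)" and ext: "f \<in> extensional (faces P)"
    using f by (auto simp: aut_group_def Bij_def)
  have G: "x \<in> G \<Longrightarrow> x \<in> H UNIV" for x by (simp add: parabolic_def)
  have "\<forall>y\<in>G. \<forall>z\<in>G. (\<forall>i\<in>{-1..d}. f (face i y) = face i z) \<longrightarrow> (\<forall>i\<in>{-1..d}. f (face i (y + x)) = face i (z + x))"
    if "x \<in> H UNIV" for x
    using that
  proof (induction rule: H_induct)
    case (kernel k)
    then show ?case using face_absorb [of _ k] H_mono [of "{}" "- {_}" k] by auto
  next
    case (step j x)
    show ?case
    proof (intro ballI impI)
      fix y z i assume yz: "y \<in> G" "z \<in> G" and fyz: "\<forall>i\<in>{-1..d}. f (face i y) = face i z" and i: "i \<in> {-1..d}"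
      have rG: "y + r j \<in> G" "z + r j \<in> G" using yz r_in_G step by auto
      obtain z' where z': "z' \<in> G" "\<And>i. i \<in> {-1..d} \<Longrightarrow> f (face i (y + r j)) = face i z'"
        using aut_image_Fl [OF f rG(1)] by blast
      have "face i z' = face i z" if "i \<in> {-1..d}" "i \<noteq> j" for i
        using z'(2) [of i] fyz Fl_mult_r(1) [of y j i] yz step(2,3) that by simp
      then have "Fl z' = Fl z \<or> Fl z' = Fl (z + r j)"
        using adjacent_cases [of z' z j] step yz z' by auto
      moreover have "Fl z' \<noteq> Fl z"
      proof
        assume "Fl z' = Fl z"
        then have "f (face j (y + r j)) = f (face j y)"
          using Fl_eq_iff_faces [of z' z] z' yz fyz step by auto
        then have "face j (y + r j) = face j y"
          using fP rG yz step by (auto simp: bij_betw_def inj_on_def)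
        then show False using Fl_mult_r(2) [of y j] yz step by auto
      qed
      ultimately have "\<forall>i\<in>{-1..d}. f (face i (y + r j)) = face i (z + r j)"
        using Fl_eq_iff_faces [of z' "z + r j"] z' rG by auto
      then have "f (face i (y + r j + x)) = face i (z + r j + x)"
        using step.IH rG i by blast
      then show "f (face i (y + (r j + x))) = face i (z + (r j + x))" by (simp add: add.assoc)
    qed
  qed
  note * = this [OF G]
  have "f (face i x) = L g (face i x)" if "i \<in> {-1..d}" "x \<in> G" for i x
    using * [of x, THEN bspec [of _ _ 0], THEN bspec [of _ _ g]] g that by auto
  then have "f F = L g F" if "F \<in> faces P" for F using that by (elim faceE) simp
  then have "f = L g" using ext by (intro extensionalityI [of _ "faces P"]) (auto simp: L_def)
  then show ?thesis using that g by blast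
qed

lemma carrier_aut: "carrier (aut_group P) = L ` G"
  using aut_eq_L L_in_aut by blast

text \<open>Comparing base flags gives one direction. Normality of the kernel carries agreement on
  the base flag to all other cosets for the converse.\<close>

lemma L_eq: assumes "g \<in> G" "h \<in> G" shows "L g = L h \<longleftrightarrow> - g + h \<in> H {}"
proof
  assume "L g = L h"
  then have "Fl g = Fl h" using L_image_Fl [of g 0] L_image_Fl [of h 0] assms by simp
  then show "- g + h \<in> H {}" using Fl_eq assms by blast
next
  assume "- g + h \<in> H {}"
  have eq: "face i (g + x) = face i (h + x)" if x: "i \<in> {-1..d}" "x \<in> G" for i x
  proof -
    have "- (g + x) + (h + x) = - x + (- g + h) - - x"
      by (simp add: minus_add add.assoc [symmetric])
    also have "\<dots> \<in> H {}"
      using kernel_normal [of "- x" "- g + h"] x \<open>- g + h \<in> H {}\<close> by blast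
    finally have "- (g + x) + (h + x) \<in> H (- {i})" by (rule H_mono [rotated]) simp
    then show ?thesis using face_eq [of "g + x" "h + x" i i] assms x by simp
  qed
  show "L g = L h"
  proof
    fix F show "L g F = L h F"
    proof (cases "F \<in> faces P")
      case True
      then show ?thesis by (rule faceE) (simp add: assms eq)
    qed (simp add: L_outside)
  qed
qed

lemma regular_P: "regular_polytope d P"
  unfolding regular_polytope_def
proof (intro conjI allI impI)
  fix \<Phi> \<Psi> assume "flag P \<Phi>" "flag P \<Psi>"
  then obtain g h where "g \<in> G" "h \<in> G" "\<Phi> = Fl g" "\<Psi> = Fl h" unfolding flag_iff by blast
  then show "\<exists>f\<in>carrier (aut_group P). f ` \<Phi> = \<Psi>"
    by (intro bexI [of _ "L (h - g)"]) (auto simp: L_image_Fl L_in_aut)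
qed (rule polytope_P)

text \<open>The group \<open>G\<close> of the application is infinite, so the quotient by the kernel
  is counted by a transversal \<open>R\<close>.\<close>

lemma order_aut:
  assumes "R \<subseteq> G" "\<And>g. g \<in> G \<Longrightarrow> \<exists>!x. x \<in> R \<and> - x + g \<in> H {}"
  shows "Coset.order (aut_group P) = card R"
proof -
  have "f \<in> L ` R" if f: "f \<in> L ` G" for f
  proof -
    obtain g where g: "g \<in> G" "f = L g" using f by blast
    obtain x where x: "x \<in> R" "- x + g \<in> H {}" using assms(2) [OF g(1)] by blast
    then have "L x = f" using L_eq [of x g] g assms(1) by blast
    then show ?thesis using x(1) by blast
  qed
  then have "L ` G = L ` R" using assms(1) by blast
  moreover have "inj_on L R"
  proof
    fix x y assume xy: "x \<in> R" "y \<in> R" "L x = L y"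
    then have G: "x \<in> G" "y \<in> G" using assms(1) by blast+
    have "- x + y \<in> H {}" using L_eq [OF G] xy(3) by simp
    moreover have "- y + y \<in> H {}" by simp
    ultimately show "x = y" using assms(2) [OF G(2)] xy(1,2) by blast
  qed
  ultimately show ?thesis by (simp add: Coset.order_def carrier_aut card_image)
qed

lemma mult_aut: "f \<in> carrier (aut_group P) \<Longrightarrow> h \<in> carrier (aut_group P) \<Longrightarrow> f \<otimes>\<^bsub>aut_group P\<^esub> h = compose (faces P) f h"
  by (auto simp: aut_group_def BijGroup_def)

lemma L_mult: "g \<in> G \<Longrightarrow> h \<in> G \<Longrightarrow> L g \<otimes>\<^bsub>aut_group P\<^esub> L h = L (g + h)"
  by (simp add: mult_aut L_in_aut L_add)

lemma one_aut: "\<one>\<^bsub>aut_group P\<^esub> = L 0"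
  by (simp add: aut_group_def BijGroup_def L_0)

lemma group_aut: "Group.group (aut_group P)"
proof (rule groupI)
  show "\<exists>y\<in>carrier (aut_group P). y \<otimes>\<^bsub>aut_group P\<^esub> x = \<one>\<^bsub>aut_group P\<^esub>" if x: "x \<in> carrier (aut_group P)" for x
  proof -
    obtain g where "g \<in> G" "x = L g" using x unfolding carrier_aut by blast
    then show ?thesis by (intro bexI [of _ "L (- g)"]) (auto simp: L_mult one_aut L_in_aut)
  qed
qed (auto simp: carrier_aut L_mult one_aut add.assoc)

lemma L_inv: "g \<in> G \<Longrightarrow> inv\<^bsub>aut_group P\<^esub> (L g) = L (- g)"
  by (rule group.inv_equality [OF group_aut]) (auto simp: L_mult one_aut L_in_aut)

section \<open>Distinguished generators, amalgamation criterion and sections\<close>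

lemma flag_Fl0: "flag P (Fl 0)"
  using flag_iff by auto

lemma flag_face_Fl0: "i \<in> {-1..d} \<Longrightarrow> flag_face P (Fl 0) i = face i 0"
  unfolding flag_face_def by (rule the_equality) (auto simp: Fl_def)

lemma adj_flag_Fl0: assumes i: "0 \<le> i" "i < d" shows "adj_flag P (Fl 0) i = Fl (r i)"
  unfolding adj_flag_def
proof (rule the_equality)
  have r: "r i \<in> G" using r_in_G i by auto
  have eq: "{F \<in> Fl g. rk P F \<noteq> i} = (\<lambda>k. face k g) ` ({-1..d} - {i})" if "g \<in> G" for g
    using that by (auto simp: Fl_def)
  have "face k (r i) = face k 0" if "k \<in> {-1..d} - {i}" for k
    using Fl_mult_r(1) [of 0 i k] i that by auto
  then have "{F \<in> Fl (r i). rk P F \<noteq> i} = {F \<in> Fl 0. rk P F \<noteq> i}"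
    unfolding eq [OF r] eq [OF G_closed(1)] by (intro image_cong) auto
  moreover have "Fl (r i) \<noteq> Fl 0"
    using Fl_mult_r(2) [of 0 i] i Fl_eq_iff_faces [of "r i" 0] r by auto
  ultimately show "flag P (Fl (r i)) \<and> Fl (r i) \<noteq> Fl 0 \<and> {F \<in> Fl (r i). rk P F \<noteq> i} = {F \<in> Fl 0. rk P F \<noteq> i}"
    using flag_iff r by auto
  fix \<Psi> assume \<Psi>: "flag P \<Psi> \<and> \<Psi> \<noteq> Fl 0 \<and> {F \<in> \<Psi>. rk P F \<noteq> i} = {F \<in> Fl 0. rk P F \<noteq> i}"
  then obtain g where g: "g \<in> G" "\<Psi> = Fl g" unfolding flag_iff by blast
  have "face k g = face k 0" if k: "k \<in> {-1..d}" "k \<noteq> i" for k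
  proof -
    have "face k g \<in> {F \<in> Fl 0. rk P F \<noteq> i}" using \<Psi> g k by (auto simp: Fl_def)
    then show ?thesis using face_in_Fl [of k g 0] k g by auto
  qed
  then show "\<Psi> = Fl (r i)" using adjacent_cases [of g 0 i] i g \<Psi> by auto
qed

lemma rho_Fl0: assumes i: "0 \<le> i" "i < d" shows "rho P (Fl 0) i = L (r i)"
  unfolding rho_def adj_flag_Fl0 [OF i]
proof (rule the_equality)
  have r: "r i \<in> G" using r_in_G i by auto
  show "L (r i) \<in> carrier (aut_group P) \<and> L (r i) ` Fl 0 = Fl (r i)"
    using r by (auto simp: L_in_aut L_image_Fl)
  fix f assume f: "f \<in> carrier (aut_group P) \<and> f ` Fl 0 = Fl (r i)"
  then obtain g where "g \<in> G" "f = L g" using aut_eq_L [of f] by blast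
  then show "f = L (r i)" using f Fl_eq [of g "r i"] L_eq [of g "r i"] r by (simp add: L_image_Fl)
qed

text \<open>Criterion for both versions of the FAP. Upper bounds suffice: any normal subgroup
  \<open>N\<close> that contains the kernel and the relevant generators may replace the normal
  closure, and \<open>H J\<close> may replace the generated subgroup.\<close>

lemma normal_closure_inter_generate:
  assumes J: "J \<subseteq> {0..<d}" "J' \<subseteq> {0..<d}"
    and N: "add_subgroup N" "N \<subseteq> G" "\<And>g x. g \<in> G \<Longrightarrow> x \<in> N \<Longrightarrow> g + x - g \<in> N" "H {} \<subseteq> N"
      "\<And>j. j \<in> J' \<Longrightarrow> r j \<in> N" and int: "N \<inter> H J \<subseteq> H {}"
  shows "normal_closure (aut_group P) (rho P (Fl 0) ` J') \<inter> generate (aut_group P) (rho P (Fl 0) ` J) = {\<one>\<^bsub>aut_group P\<^esub>}"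
proof
  interpret A: group "aut_group P" by (rule group_aut)
  have sub: "subgroup (L ` S) (aut_group P)" if "add_subgroup S" "S \<subseteq> G" for S
    using that by (intro A.subgroupI) (auto simp: add_subgroup_def L_in_aut subset_iff L_inv L_mult)
  have "L ` N \<lhd> aut_group P"
    unfolding A.normal_inv_iff
    using sub [of N] N by (auto simp: carrier_aut L_inv L_mult subset_iff)
  then have nc: "normal_closure (aut_group P) (rho P (Fl 0) ` J') \<subseteq> L ` N"
  proof -
    have "rho P (Fl 0) j \<in> L ` N" if "j \<in> J'" for j
      using N(5) [OF that] rho_Fl0 [of j] J(2) that by (auto simp: subset_iff)
    then show ?thesis using \<open>L ` N \<lhd> aut_group P\<close> unfolding normal_closure_def by blast
  qed
  have "add_subgroup (H J)" "H J \<subseteq> G" by (auto simp: add_subgroup_def H_in_G)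
  then have "subgroup (L ` H J) (aut_group P)" using sub by blast
  moreover have "rho P (Fl 0) j \<in> L ` H J" if "j \<in> J" for j
    using r_in_H [OF that] rho_Fl0 [of j] J(1) that by (auto simp: subset_iff)
  then have "rho P (Fl 0) ` J \<subseteq> L ` H J" by blast
  ultimately have gen: "generate (aut_group P) (rho P (Fl 0) ` J) \<subseteq> L ` H J"
    by (rule A.generate_subgroup_incl [rotated])
  show "normal_closure (aut_group P) (rho P (Fl 0) ` J') \<inter> generate (aut_group P) (rho P (Fl 0) ` J) \<subseteq> {\<one>\<^bsub>aut_group P\<^esub>}"
  proof
    fix f assume "f \<in> normal_closure (aut_group P) (rho P (Fl 0) ` J') \<inter> generate (aut_group P) (rho P (Fl 0) ` J)"
    then obtain x y where xy: "x \<in> N" "y \<in> H J" "f = L x" "L x = L y" using nc gen by blast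
    then have G: "x \<in> G" "y \<in> G" using N H_in_G by auto
    then have "- x + y \<in> H {}" using L_eq xy by blast
    \<comment> \<open>\<open>x\<close> and \<open>y\<close> induce the same automorphism, so they
      differ by the kernel, which lies in \<open>N\<close>; thus \<open>y\<close> itself is in
      \<open>N\<close>.\<close>
    then have "x + (- x + y) \<in> N" using N(1,4) xy(1) unfolding add_subgroup_def by blast
    then have "y \<in> H {}" using int xy(2) by (auto simp: add.assoc [symmetric])
    then show "f \<in> {\<one>\<^bsub>aut_group P\<^esub>}" using L_eq [of 0 y] G xy by (simp add: one_aut)
  qed
  show "{\<one>\<^bsub>aut_group P\<^esub>} \<subseteq> normal_closure (aut_group P) (rho P (Fl 0) ` J') \<inter> generate (aut_group P) (rho P (Fl 0) ` J)"
    using generate.one by (auto simp: normal_closure_def normal_def intro: subgroup.one_closed)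
qed

text \<open>Adding the two end faces to the chain forces a common representative into
  \<open>H (- {p, q})\<close>. Its factor with indices outside the open interval acts trivially on
  the faces of the section and is dropped.\<close>

lemma section_rep:
  assumes pq: "p \<in> {-1..d}" "q \<in> {-1..d}" "p \<le> q"
    and X: "X \<subseteq> faces P" "\<And>E. E \<in> X \<Longrightarrow> leq P (face p 0) E \<and> leq P E (face q 0)"
    and comp: "\<And>E F. E \<in> X \<Longrightarrow> F \<in> X \<Longrightarrow> leq P E F \<or> leq P F E"
  obtains g where "g \<in> H {p<..<q}" "\<And>F. F \<in> X \<Longrightarrow> F = face (rk P F) g"
proof -
  have "leq P (face p 0) (face q 0)" using leq_same [OF pq(1,2) G_closed(1) pq(3)] .
  moreover have "face p 0 \<in> faces P" "face q 0 \<in> faces P" using pq by auto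
  ultimately have "leq P E F \<or> leq P F E" if "E \<in> insert (face p 0) (insert (face q 0) X)"
    "F \<in> insert (face p 0) (insert (face q 0) X)" for E F
    using that X(2) comp [of E F] leq_refl [of "face p 0"] leq_refl [of "face q 0"] by blast
  moreover have "insert (face p 0) (insert (face q 0) X) \<subseteq> faces P" using X(1) pq by auto
  ultimately obtain g where g: "g \<in> G" "insert (face p 0) (insert (face q 0) X) \<subseteq> Fl g"
    using common_rep [of "insert (face p 0) (insert (face q 0) X)"] by blast
  then have "face p g = face p 0" "face q g = face q 0" using face_in_Fl [of _ 0 g] pq by auto
  then have "g \<in> H (- {p})" "g \<in> H (- {q})"
    using face_eq [of 0 g p p] face_eq [of 0 g q q] g pq by simp_all
  then have "g \<in> H (- {p, q})" by (auto simp: parabolic_def)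
  then obtain a b where ab: "a \<in> H {p<..<q}" "b \<in> H ({..<p} \<union> {q<..})" "g = a + b"
    by (rule H_factor [where A = "{p<..<q}" and B = "{..<p} \<union> {q<..}"]) (use pq in auto)
  have "F = face (rk P F) a" if F: "F \<in> X" for F
  proof -
    have "leq P (face p 0) F" "leq P F (face q 0)" "F \<in> faces P" using X F by auto
    then have k: "p \<le> rk P F" "rk P F \<le> q" using leq_rk [of "face p 0" F] leq_rk [of F "face q 0"] pq by auto
    have "F = face (rk P F) g" using g F by (auto simp: Fl_def)
    also have "\<dots> = face (rk P F) a" unfolding ab(3)
      by (rule face_absorb) (use ab H_in_G H_mono [of "{..<p} \<union> {q<..}" "- {rk P F}" b] k pq in auto)
    finally show ?thesis .
  qed
  then show ?thesis using that ab by blast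
qed

end


section \<open>Symmetries of the square tessellation\<close>

text \<open>\<open>Sq x y s a b\<close> swaps the coordinates if \<open>s\<close>, then negates the first one if \<open>a\<close> and the second one
  if \<open>b\<close>, and finally translates by \<open>(x, y)\<close>.\<close>

datatype sq = Sq int int bool bool bool

definition flip :: "bool \<Rightarrow> int \<Rightarrow> int" where
  "flip b x = (if b then - x else x)"

instantiation sq :: group_add
begin

definition "0 = Sq 0 0 False False False"

fun plus_sq :: "sq \<Rightarrow> sq \<Rightarrow> sq" where
  "Sq x y s a b + Sq x' y' s' a' b' =
     (if s then Sq (x + flip a y') (y + flip b x') (\<not> s') (a \<noteq> b') (b \<noteq> a')
      else Sq (x + flip a x') (y + flip b y') s' (a \<noteq> a') (b \<noteq> b'))"

fun uminus_sq :: "sq \<Rightarrow> sq" where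
  "- Sq x y s a b =
     (if s then Sq (- flip b y) (- flip a x) True b a else Sq (- flip a x) (- flip b y) False a b)"

definition "g - h = g + (- h :: sq)"

instance
proof
  fix g h k :: sq
  show "g + h + k = g + (h + k)"
    by (cases g; cases h; cases k) (simp add: flip_def)
  show "0 + g = g" "g + 0 = g" "- g + g = 0"
    by (cases g; simp add: zero_sq_def flip_def)+
  show "g + - h = g - h" by (simp add: minus_sq_def)
qed

end

fun act :: "sq \<Rightarrow> int \<times> int \<Rightarrow> int \<times> int" where
  "act (Sq x y s a b) (p, q) = (if s then (x + flip a q, y + flip b p) else (x + flip a p, y + flip b q))"

lemma act_add: "act (g + h) v = act g (act h v)"
  by (cases g; cases h; cases v) (simp add: flip_def)

lemma act_zero [simp]: "act 0 v = v"
  by (cases v) (simp add: zero_sq_def flip_def)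

text \<open>The base flag consists of the origin, the edge to \<open>(1, 0)\<close> and the unit square. The value 0 for
  all other indices lets the generators of the fibre product be written without case distinctions.\<close>

definition gen44 :: "int \<Rightarrow> sq" where
  "gen44 k = (if k = 0 then Sq 1 0 False True False else if k = 1 then Sq 0 0 True False False
     else if k = 2 then Sq 0 0 False False True else 0)"

lemma gen44_simps [simp]:
  "gen44 0 = Sq 1 0 False True False" "gen44 1 = Sq 0 0 True False False"
  "gen44 2 = Sq 0 0 False False True" "k < 0 \<Longrightarrow> gen44 k = 0" "k > 2 \<Longrightarrow> gen44 k = 0"
  by (auto simp: gen44_def)

lemma gen44_invol: "gen44 k + gen44 k = 0"
  by (auto simp: gen44_def flip_def zero_sq_def)

lemma gen44_commute: "i + 2 \<le> j \<Longrightarrow> gen44 i + gen44 j = gen44 j + gen44 i"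
  by (auto simp: gen44_def flip_def)

lemma even_flip [simp]: "even (flip b x) = even x"
  by (simp add: flip_def)

text \<open>The class of a vertex \<open>(x, y)\<close> modulo \<open>2\<int>\<^sup>2\<close>, together with the swap bit, describes the action on the
  unit square and yields the retraction that kills \<open>gen44 2\<close>. Likewise \<open>face_class\<close>, the action on the lower left
  corners of the squares modulo \<open>2\<int>\<^sup>2\<close>, kills \<open>gen44 0\<close>. The outer automorphism \<open>d4_twist\<close> is needed to match
  \<open>gen44 1\<close> and \<open>gen44 2\<close> in the second quotient with \<open>gen44 0\<close> and \<open>gen44 1\<close> in the first.\<close>

type_synonym d4 = "bool \<times> bool \<times> bool"

text \<open>The dihedral group of order 8, realised as two sign bits extended by the swap of the two
  bits.\<close>

fun d4_mult :: "d4 \<Rightarrow> d4 \<Rightarrow> d4" where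
  "d4_mult (p, q, s) (p', q', s') =
     (if s then (p \<noteq> q', q \<noteq> p', \<not> s') else (p \<noteq> p', q \<noteq> q', s'))"

fun vertex_class :: "sq \<Rightarrow> d4" where
  "vertex_class (Sq x y s a b) = (odd x, odd y, s)"

fun face_class :: "sq \<Rightarrow> d4" where
  "face_class (Sq x y s a b) = (odd x \<noteq> a, odd y \<noteq> b, s)"

text \<open>The formula is forced by two values: (False, False, True) goes to (True, False, False),
  and (False, True, False) goes to (False, False, True).\<close>

fun d4_twist :: "d4 \<Rightarrow> d4" where
  "d4_twist (p, q, s) = (if p = q then (p \<noteq> s, p, False) else (p, p \<noteq> s, True))"

lemma vertex_class_add: "vertex_class (g + h) = d4_mult (vertex_class g) (vertex_class h)"
  by (cases g; cases h) auto

lemma face_class_add: "face_class (g + h) = d4_mult (face_class g) (face_class h)"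
  by (cases g; cases h) auto

lemma d4_twist_mult: "d4_twist (d4_mult u v) = d4_mult (d4_twist u) (d4_twist v)"
proof -
  obtain p q s p' q' s' where "u = (p, q, s)" "v = (p', q', s')" by (metis prod_cases3)
  then show ?thesis by (cases p; cases q; cases s; cases p'; cases q'; cases s') simp_all
qed

text \<open>The gluing condition of the fibre product, with \<open>g\<close> in coordinate j and
  \<open>h\<close> in coordinate j + 1.\<close>

definition linked :: "sq \<Rightarrow> sq \<Rightarrow> bool" where
  "linked g h \<longleftrightarrow> d4_twist (face_class g) = vertex_class h"

lemma linked_add: "linked g g' \<Longrightarrow> linked h h' \<Longrightarrow> linked (g + h) (g' + h')"
  by (simp add: linked_def vertex_class_add face_class_add d4_twist_mult)

lemma linked_uminus: assumes "linked g g'" shows "linked (- g) (- g')"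
proof -
  have inv: "v = w" if "d4_mult u v = d4_mult u w" for u v w
    using that by (cases u; cases v; cases w) (auto split: if_splits)
  have "linked (g + - g) (g' + - g')" by (simp add: linked_def zero_sq_def)
  then have "d4_mult (vertex_class g') (d4_twist (face_class (- g))) = d4_mult (vertex_class g') (vertex_class (- g'))"
    using assms by (simp only: linked_def vertex_class_add face_class_add d4_twist_mult)
  then show ?thesis unfolding linked_def by (rule inv)
qed

text \<open>For k = i - j + 2 these are coordinates j and j + 1 of the i-th generator. The cases k =
  -1 and k = 2 say that \<open>gen44 0\<close> and \<open>gen44 2\<close> are killed by
  \<open>face_class\<close> and \<open>vertex_class\<close>, respectively.\<close>

lemma linked_gen44: "linked (gen44 (k + 1)) (gen44 k)"
  by (auto simp: gen44_def zero_sq_def linked_def)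

text \<open>One sign change and the swap generate the point group of the tessellation, so the
  translations in \<open>L\<close> form a normal subgroup. Evenness makes both dihedral classes well
  defined modulo \<open>L\<close>.\<close>

locale even_lattice =
  fixes L :: "(int \<times> int) set"
  assumes zero: "(0, 0) \<in> L"
    and add: "(x, y) \<in> L \<Longrightarrow> (x', y') \<in> L \<Longrightarrow> (x + x', y + y') \<in> L"
    and neg_fst: "(x, y) \<in> L \<Longrightarrow> (- x, y) \<in> L"
    and swap: "(x, y) \<in> L \<Longrightarrow> (y, x) \<in> L"
    and even_fst: "(x, y) \<in> L \<Longrightarrow> even x"
begin

lemma neg_snd: "(x, y) \<in> L \<Longrightarrow> (x, - y) \<in> L"
  using swap neg_fst by blast

lemma even_snd: "(x, y) \<in> L \<Longrightarrow> even y"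
  using swap even_fst by blast

lemma flip_fst_iff: "(flip a x, y) \<in> L \<longleftrightarrow> (x, y) \<in> L"
  using neg_fst [of x y] neg_fst [of "- x" y] by (auto simp: flip_def)

lemma flip_snd_iff: "(x, flip a y) \<in> L \<longleftrightarrow> (x, y) \<in> L"
  using neg_snd [of x y] neg_snd [of x "- y"] by (auto simp: flip_def)

lemma swap_iff: "(x, y) \<in> L \<longleftrightarrow> (y, x) \<in> L"
  using swap by blast

end

text \<open>Membership, modulo the translations in \<open>L\<close>, in the subgroup generated by the two reflections other than
  \<open>gen44 k\<close>.\<close>

definition cond44 :: "(int \<times> int) set \<Rightarrow> int \<Rightarrow> sq \<Rightarrow> bool" where
  "cond44 L k g = (case g of Sq x y s a b \<Rightarrow>
     (k = 0 \<longrightarrow> (x, y) \<in> L) \<and>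
     (k = 1 \<longrightarrow> \<not> s \<and> (x - of_bool a, y) \<in> L) \<and>
     (k = 2 \<longrightarrow> (x - of_bool a, y - of_bool b) \<in> L))"

definition trans44 :: "(int \<times> int) set \<Rightarrow> sq set" where
  "trans44 L = {Sq x y False False False | x y. (x, y) \<in> L}"

section \<open>Membership conditions modulo a lattice, and generation by reflections\<close>

context even_lattice
begin

lemma cond_zero: "cond44 L k 0"
  using zero by (simp add: cond44_def zero_sq_def)

lemma cond_add:
  assumes "cond44 L k g" "cond44 L k h" shows "cond44 L k (g + h)"
proof -
  obtain x y s a b where g: "g = Sq x y s a b" by (cases g)
  obtain x' y' s' a' b' where h: "h = Sq x' y' s' a' b'" by (cases h)
  \<comment> \<open>\<open>x - of_bool a\<close> is the translation part with respect to the centre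
    of the unit interval as origin, hence it composes like the plain translation part.\<close>
  have *: "x + flip a x' - of_bool (a \<noteq> a') = (x - of_bool a) + flip a (x' - of_bool a')" for x a x' a'
    by (auto simp: flip_def)
  have fl: "(x' , y') \<in> L \<Longrightarrow> (flip a x', flip b y') \<in> L" "(x' , y') \<in> L \<Longrightarrow> (flip a y', flip b x') \<in> L" for x' y' a b
    using flip_fst_iff flip_snd_iff swap_iff by blast+
  consider "k = 0" | "k = 1" | "k = 2" | "k \<notin> {0,1,2}" by blast
  then show ?thesis
  proof cases
    case 1
    then have "(x, y) \<in> L" "(x', y') \<in> L" using assms g h by (auto simp: cond44_def)
    then show ?thesis using 1 fl add by (simp add: g h cond44_def)
  next
    case 2
    then have "\<not> s" "\<not> s'" "(x - of_bool a, y) \<in> L" "(x' - of_bool a', y') \<in> L" using assms g h by (auto simp: cond44_def)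
    then have "(x + flip a x' - of_bool (a \<noteq> a'), y + flip b y') \<in> L" unfolding * by (intro add fl)
    then show ?thesis using 2 \<open>\<not> s\<close> \<open>\<not> s'\<close> by (simp add: g h cond44_def)
  next
    case 3
    then have L: "(x - of_bool a, y - of_bool b) \<in> L" "(x' - of_bool a', y' - of_bool b') \<in> L" using assms g h by (auto simp: cond44_def)
    have "(x + flip a x' - of_bool (a \<noteq> a'), y + flip b y' - of_bool (b \<noteq> b')) \<in> L"
      unfolding * using L by (intro add fl)
    moreover have "(x + flip a y' - of_bool (a \<noteq> b'), y + flip b x' - of_bool (b \<noteq> a')) \<in> L"
      unfolding * using L by (intro add fl)
    ultimately show ?thesis using 3 by (simp add: g h cond44_def)
  qed (simp add: g h cond44_def)
qed

lemma cond_uminus: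
  assumes "cond44 L k g" shows "cond44 L k (- g)"
proof -
  obtain x y s a b where g: "g = Sq x y s a b" by (cases g)
  have *: "- flip a x - of_bool a = flip (\<not> a) (x - of_bool a)" and **: "- flip a x = flip (\<not> a) x" for a x
    by (auto simp: flip_def)
  have fl: "(x', y') \<in> L \<Longrightarrow> (flip a x', flip b y') \<in> L" "(x', y') \<in> L \<Longrightarrow> (flip b y', flip a x') \<in> L" for x' y' a b
    using flip_fst_iff flip_snd_iff swap_iff by blast+
  consider "k = 0" | "k = 1" | "k = 2" | "k \<notin> {0,1,2}" by blast
  then show ?thesis
  proof cases
    case 1
    then show ?thesis using assms fl by (simp add: g cond44_def **)
  next
    case 2
    then have "\<not> s" "(x - of_bool a, y) \<in> L" using assms by (auto simp: g cond44_def)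
    moreover from this(2) have "(- flip a x - of_bool a, - flip b y) \<in> L" unfolding * unfolding ** by (rule fl)
    ultimately show ?thesis using 2 by (simp add: g cond44_def)
  next
    case 3
    then have L: "(x - of_bool a, y - of_bool b) \<in> L" using assms by (auto simp: g cond44_def)
    have "(- flip a x - of_bool a, - flip b y - of_bool b) \<in> L" unfolding * using L by (rule fl)
    moreover have "(- flip b y - of_bool b, - flip a x - of_bool a) \<in> L" unfolding * using L by (rule fl)
    ultimately show ?thesis using 3 by (simp add: g cond44_def)
  qed (simp add: g cond44_def)
qed

lemma cond_gen44: "i \<noteq> k \<Longrightarrow> cond44 L k (gen44 i)"
  using zero by (auto simp: gen44_def cond44_def zero_sq_def)

lemma not_cond_gen44: assumes "k \<in> {0, 1, 2}" shows "\<not> cond44 L k (gen44 k)"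
  using assms even_fst [of 1 0] even_snd [of 0 "-1"] by (auto simp: gen44_def cond44_def)

text \<open>The conditions for 0 and 2 put both \<open>x\<close> and \<open>x - of_bool a\<close>
  among even numbers, which excludes \<open>a\<close>, and likewise \<open>b\<close>; the condition
  for 1 excludes the swap.\<close>

lemma trans_iff_cond: "g \<in> trans44 L \<longleftrightarrow> cond44 L 0 g \<and> cond44 L 1 g \<and> cond44 L 2 g"
proof -
  obtain x y s a b where g: "g = Sq x y s a b" by (cases g)
  have "\<not> a \<and> \<not> b" if L: "(x, y) \<in> L" "(x - of_bool a, y - of_bool b) \<in> L"
    using even_fst [OF L(1)] even_snd [OF L(1)] even_fst [OF L(2)] even_snd [OF L(2)] by (cases a; cases b) simp_all
  then show ?thesis by (cases a; cases b) (auto simp: g cond44_def trans44_def)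
qed

lemma trans_zero: "0 \<in> trans44 L"
  and trans_add: "g \<in> trans44 L \<Longrightarrow> h \<in> trans44 L \<Longrightarrow> g + h \<in> trans44 L"
  and trans_uminus: "g \<in> trans44 L \<Longrightarrow> - g \<in> trans44 L"
  unfolding trans_iff_cond using cond_zero cond_add cond_uminus by blast+

lemma trans_normal: assumes "t \<in> trans44 L" shows "g + t - g \<in> trans44 L"
proof -
  obtain x y where t: "t = Sq x y False False False" "(x, y) \<in> L" using assms by (auto simp: trans44_def)
  obtain x' y' s a b where g: "g = Sq x' y' s a b" by (cases g)
  have "g + t - g = (if s then Sq (flip a y) (flip b x) False False False else Sq (flip a x) (flip b y) False False False)"
    by (simp add: t g minus_sq_def flip_def)
  moreover have "(flip a y, flip b x) \<in> L" "(flip a x, flip b y) \<in> L"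
    using t(2) swap by (simp_all add: flip_fst_iff flip_snd_iff)
  ultimately show ?thesis by (simp add: trans44_def)
qed

lemma linked_trans_right: "t \<in> trans44 L \<Longrightarrow> linked 0 t"
  by (auto simp: trans44_def zero_sq_def linked_def dest: even_fst even_snd)

lemma linked_trans_left: "t \<in> trans44 L \<Longrightarrow> linked t 0"
  by (auto simp: trans44_def zero_sq_def linked_def dest: even_fst even_snd)

text \<open>Index \<open>k + 1\<close> in one coordinate and \<open>k\<close> in the next belong to
  the same generator of the fibre product. By its condition for 2, \<open>h\<close> lies modulo
  \<open>L\<close> in the dihedral group of \<open>gen44 0\<close> and \<open>gen44 1\<close>, on
  which \<open>vertex_class\<close> is faithful; so it is enough to test its class, which
  \<open>g\<close> controls.\<close>

lemma cond_up:
  assumes "linked g h" "cond44 L' (k + 1) g" "even_lattice L'" "cond44 L 2 h" "k = 0 \<or> k = 1"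
  shows "cond44 L k h"
proof -
  interpret L': even_lattice L' by fact
  obtain x y s a b where g: "g = Sq x y s a b" by (cases g)
  obtain x' y' s' a' b' where h: "h = Sq x' y' s' a' b'" by (cases h)
  have L: "(x' - of_bool a', y' - of_bool b') \<in> L" using assms h by (simp add: cond44_def)
  have ev: "even (x' - of_bool a')" "even (y' - of_bool b')" using even_fst [OF L] even_snd [OF L] .
  show ?thesis
  proof (cases "k = 0")
    case True
    then have g': "\<not> s" "(x - of_bool a, y) \<in> L'" using assms by (simp_all add: g cond44_def)
    then have "even (x - of_bool a)" "even y" using L'.even_fst L'.even_snd by blast+
    then have "even x'" "even y'" using assms(1) g'(1) by (cases a; cases b; auto simp: g h linked_def)+
    then have "\<not> a'" "\<not> b'" using ev by (cases a'; cases b'; simp)+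
    then show ?thesis using True L by (simp add: h cond44_def)
  next
    case False
    then have g': "k = 1" "(x - of_bool a, y - of_bool b) \<in> L'" using assms by (simp_all add: g cond44_def)
    then have "even (x - of_bool a)" "even (y - of_bool b)" using L'.even_fst L'.even_snd by blast+
    then have "\<not> s'" "even y'" using assms(1) by (cases a; cases b; auto simp: g h linked_def)+
    then have "\<not> b'" using ev by (cases b'; simp)+
    then show ?thesis using g'(1) L \<open>\<not> s'\<close> by (simp add: h cond44_def)
  qed
qed

text \<open>The mirror image of \<open>cond_up\<close>: the condition for 0 puts \<open>g\<close>
  into the dihedral group of \<open>gen44 1\<close> and \<open>gen44 2\<close>, on which
  \<open>face_class\<close> is faithful.\<close>

lemma cond_down:
  assumes "linked g h" "cond44 L' k h" "even_lattice L'" "cond44 L 0 g" "k = 0 \<or> k = 1"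
  shows "cond44 L (k + 1) g"
proof -
  interpret L': even_lattice L' by fact
  obtain x y s a b where g: "g = Sq x y s a b" by (cases g)
  obtain x' y' s' a' b' where h: "h = Sq x' y' s' a' b'" by (cases h)
  have L: "(x, y) \<in> L" using assms g by (simp add: cond44_def)
  have ev: "even x" "even y" using even_fst [OF L] even_snd [OF L] .
  show ?thesis
  proof (cases "k = 0")
    case True
    then have "(x', y') \<in> L'" using assms by (simp add: h cond44_def)
    then have "even x'" "even y'" using L'.even_fst L'.even_snd by blast+
    then have "\<not> s" "\<not> a" using assms(1) ev by (cases a; cases b; cases s; simp add: g h linked_def)+
    then show ?thesis using True L by (simp add: g cond44_def)
  next
    case False
    then have h': "k = 1" "\<not> s'" "(x' - of_bool a', y') \<in> L'" using assms by (simp_all add: h cond44_def)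
    then have "even y'" using L'.even_snd by blast
    then have "\<not> a" "\<not> b" using assms(1) h'(2) ev by (cases a; cases b; simp add: g h linked_def)+
    then show ?thesis using h'(1) L by (simp add: g cond44_def)
  qed
qed

text \<open>The kernel of a retraction meets the retract only in lattice translations; this and
  \<open>trans_up\<close> are the source of all trivial intersections in the FAP.\<close>

lemma trans_down:
  assumes "linked g 0" "cond44 L 0 g" shows "g \<in> trans44 L"
proof -
  have "cond44 L (0 + 1) g" "cond44 L (1 + 1) g"
    by (rule cond_down [OF assms(1) cond_zero even_lattice_axioms assms(2)]; simp)+
  then show ?thesis using assms(2) by (simp add: trans_iff_cond)
qed

lemma trans_up:
  assumes "linked 0 g" "cond44 L 2 g" shows "g \<in> trans44 L"
proof -
  have "cond44 L 0 g" "cond44 L 1 g"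
    by (rule cond_up [OF assms(1) cond_zero even_lattice_axioms assms(2)]; simp)+
  then show ?thesis using assms(2) by (simp add: trans_iff_cond)
qed

text \<open>The kernel of \<open>vertex_class\<close> is generated by conjugates of \<open>gen44 2\<close>, even within parabolic subgroups.
  \<open>Y\<close> is only assumed to be closed under these operations, because it will be a set of coordinates.\<close>

lemma kernel_generated:
  assumes add: "\<And>g h. g \<in> Y \<Longrightarrow> h \<in> Y \<Longrightarrow> g + h \<in> Y" and trans: "trans44 L \<subseteq> Y"
    and conj: "\<And>k g. k \<in> S \<Longrightarrow> k \<in> {0, 1} \<Longrightarrow> g \<in> Y \<Longrightarrow> gen44 k + g + gen44 k \<in> Y"
    and two: "2 \<in> S \<Longrightarrow> gen44 2 \<in> Y"
    and w: "\<And>k. k \<in> {0, 1, 2} - S \<Longrightarrow> cond44 L k w"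
    and ker: "vertex_class w = (False, False, False)"
  shows "w \<in> Y"
proof (cases "2 \<in> S")
  case False
  \<comment> \<open>Without index 2 in \<open>S\<close>, the element lies in the retract on which
    \<open>vertex_class\<close> is faithful.\<close>
  have "linked 0 w" using ker by (simp add: linked_def zero_sq_def)
  then have "w \<in> trans44 L" using w False by (auto intro: trans_up)
  then show ?thesis using trans by blast
next
  case 2: True
  obtain x y a b where g: "w = Sq x y False a b" and ev: "even x" "even y"
    using ker by (cases w) auto
  have T: "Sq x y False False False \<in> Y" if "(x, y) \<in> L" for x y
    using trans that by (auto simp: trans44_def)
  have zero: "Sq 0 0 False False False \<in> Y" by (rule T) (rule zero)
  have B: "Sq 0 0 False False True \<in> Y" using two 2 by simp
  show ?thesis
  proof (cases "1 \<in> S")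
    case False
    then have L: "(x - of_bool a, y) \<in> L" using w [of 1] by (simp add: g cond44_def)
    then have "\<not> a" using even_fst [OF L] ev by (cases a) simp_all
    then have "Sq x y False False False \<in> Y" using L T by simp
    then show ?thesis using add [OF _ B, of "Sq x y False False False"] \<open>\<not> a\<close> by (cases b) (simp_all add: g flip_def)
  next
    case 1: True
    have A: "Sq 0 0 False True False \<in> Y" using conj [of 1, OF 1 _ B] by (simp add: flip_def)
    have D: "Sq 0 0 False a b \<in> Y" for a b
      using add [OF A B] A B zero by (cases a; cases b) (simp_all add: flip_def)
    have "Sq x y False False False \<in> Y"
    proof (cases "0 \<in> S")
      case False
      then have "(x, y) \<in> L" using w [of 0] by (simp add: g cond44_def)
      then show ?thesis by (rule T)
    next
      case 0: True
      have "gen44 0 + Sq 0 0 False True False + gen44 0 \<in> Y" by (rule conj [OF 0 _ A]) simp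
      \<comment> \<open>This is the reflection in the line x = 1. Composed with the reflection in x
        = 0 it gives the translations by 2 in either direction.\<close>
      then have R: "Sq 2 0 False True False \<in> Y" by (simp add: flip_def)
      have plus: "Sq 2 0 False False False \<in> Y" using add [OF R A] by (simp add: flip_def)
      have minus: "Sq (- 2) 0 False False False \<in> Y" using add [OF A R] by (simp add: flip_def)
      have X: "Sq (2 * m) 0 False False False \<in> Y" for m
      proof (induction m rule: int_induct [of _ 0])
        case base
        then show ?case using zero by simp
      next
        case (step1 i)
        then show ?case using add [OF plus step1(2)] by (simp add: flip_def algebra_simps)
      next
        case (step2 i)
        then show ?case using add [OF minus step2(2)] by (simp add: flip_def algebra_simps)
      qed
      have "gen44 1 + Sq (2 * m) 0 False False False + gen44 1 \<in> Y" for m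
        by (rule conj [OF 1 _ X]) simp
      then have X': "Sq 0 (2 * m) False False False \<in> Y" for m by (simp add: flip_def)
      obtain m m' where "x = 2 * m" "y = 2 * m'" using ev by (auto elim!: evenE)
      then show ?thesis using add [OF X [of m] X' [of m']] by (simp add: flip_def)
    qed
    then show ?thesis using add [OF _ D, of "Sq x y False False False" a b] by (simp add: g flip_def)
  qed
qed

text \<open>A word in \<open>gen44 0\<close> and \<open>gen44 1\<close>, using only letters allowed
  by \<open>S\<close>, attains the class of \<open>w\<close>. The remaining quotient has trivial
  class and is covered by \<open>kernel_generated\<close>.\<close>

lemma generated44:
  assumes add: "\<And>g h. g \<in> Y \<Longrightarrow> h \<in> Y \<Longrightarrow> g + h \<in> Y" and trans: "trans44 L \<subseteq> Y"
    and gens: "\<And>k. k \<in> S \<Longrightarrow> k \<in> {0, 1, 2} \<Longrightarrow> gen44 k \<in> Y"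
    and w: "\<And>k. k \<in> {0, 1, 2} - S \<Longrightarrow> cond44 L k w"
  shows "w \<in> Y"
proof -
  obtain x y s a b where g: "w = Sq x y s a b" by (cases w)
  have zero: "0 \<in> Y" using trans trans_zero by blast
  define e where "e k c = (if c then gen44 k else 0)" for k c
  have eY: "e k c \<in> Y" if "c \<Longrightarrow> k \<in> S" "k \<in> {0, 1, 2}" for k c
    using that gens zero by (auto simp: e_def)
  have ec: "cond44 L i (e k c)" if "i \<noteq> k" for i k c
    using that cond_gen44 cond_zero by (simp add: e_def)
  have "\<exists>u\<in>Y. vertex_class u = vertex_class w \<and> (\<forall>k\<in>{0, 1, 2} - S. cond44 L k u)"
  proof (cases "1 \<in> S")
    case False
    then have L: "\<not> s" "(x - of_bool a, y) \<in> L" using w [of 1] by (simp_all add: g cond44_def)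
    then have ev: "odd x = a" "even y" using even_fst [OF L(2)] even_snd [OF L(2)] by (cases a; simp)+
    have 0: "0 \<in> S" if a
    proof (rule ccontr)
      assume "0 \<notin> S"
      then have "(x, y) \<in> L" using w [of 0] by (simp add: g cond44_def)
      then show False using even_fst [of x y] ev that by simp
    qed
    have "e 0 a \<in> Y" using eY 0 by simp
    moreover have "vertex_class (e 0 a) = vertex_class w"
      using ev L(1) by (auto simp: e_def g zero_sq_def)
    moreover have "\<forall>k\<in>{0, 1, 2} - S. cond44 L k (e 0 a)"
      using ec [of _ 0 a] 0 cond_zero by (auto simp: e_def cond_gen44)
    ultimately show ?thesis by blast
  next
    case 1: True
    show ?thesis
    proof (cases "0 \<in> S")
      case False
      then have L: "(x, y) \<in> L" using w [of 0] by (simp_all add: g cond44_def)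
      have "e 1 s \<in> Y" using eY 1 by simp
      moreover have "vertex_class (e 1 s) = vertex_class w"
        using even_fst [OF L] even_snd [OF L] by (auto simp: e_def g zero_sq_def)
      moreover have "\<forall>k\<in>{0, 1, 2} - S. cond44 L k (e 1 s)"
        using ec [of _ 1 s] 1 by auto
      ultimately show ?thesis by blast
    next
      case 0: True
      \<comment> \<open>Modulo 2, \<open>gen44 0\<close> shifts the first coordinate, its conjugate
        by \<open>gen44 1\<close> shifts the second, and \<open>gen44 1\<close> swaps them.\<close>
      define u where "u = e 0 (odd x) + (e 1 (odd y) + e 0 (odd y) + e 1 (odd y)) + e 1 s"
      have "u \<in> Y" unfolding u_def using eY 0 1 by (intro add) auto
      moreover have "vertex_class u = vertex_class w"
        unfolding u_def by (cases "odd x"; cases "odd y"; cases s; simp add: e_def g zero_sq_def flip_def)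
      moreover have "\<forall>k\<in>{0, 1, 2} - S. cond44 L k u"
        unfolding u_def using 0 1 by (auto intro!: cond_add ec)
      ultimately show ?thesis by blast
    qed
  qed
  then obtain u where u: "u \<in> Y" "vertex_class u = vertex_class w" "\<forall>k\<in>{0, 1, 2} - S. cond44 L k u" by blast
  have "- u + w \<in> Y"
  proof (rule kernel_generated [OF add trans])
    show "gen44 k + g + gen44 k \<in> Y" if "k \<in> S" "k \<in> {0, 1}" "g \<in> Y" for k g
      using that gens add by blast
    show "cond44 L k (- u + w)" if "k \<in> {0, 1, 2} - S" for k
      using that u w cond_add cond_uminus by blast
    have "d4_mult (vertex_class u) (vertex_class (- u + w)) = vertex_class u"
      unfolding vertex_class_add [symmetric] using u(2) by (simp add: add.assoc [symmetric])
    then show "vertex_class (- u + w) = (False, False, False)"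
      by (cases "vertex_class u"; cases "vertex_class (- u + w)") (auto split: if_splits)
    show "gen44 2 \<in> Y" if "2 \<in> S" using gens [OF that] by blast
  qed (use w in auto)
  then have "u + (- u + w) \<in> Y" using u add by blast
  then show ?thesis by (simp add: add.assoc [symmetric])
qed

text \<open>The unit square has one corner in each class modulo 2, so its eight symmetries realise
  all classes. This is the source of flatness.\<close>

lemma vertex_class_rep:
  obtains u where "cond44 L 2 u" "vertex_class u = vertex_class w"
proof -
  obtain x y s a b where g: "w = Sq x y s a b" by (cases w)
  have "cond44 L 2 (Sq (of_bool (odd x)) (of_bool (odd y)) s (odd x) (odd y))"
    using zero by (simp add: cond44_def)
  then show ?thesis using that by (force simp: g)
qed

end

lemma even_lattice_trivial: "even_lattice {(0, 0)}"
  by unfold_locales auto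

section \<open>Faces of the tessellation and their orbits\<close>

definition base_face :: "int \<Rightarrow> (int \<times> int) set" where
  "base_face k = (if k < 0 then {} else if k = 0 then {(0, 0)} else if k = 1 then {(0, 0), (1, 0)}
     else if k = 2 then {(0, 0), (1, 0), (0, 1), (1, 1)} else UNIV)"

lemma base_face_simps [simp]:
  "base_face (-1) = {}" "base_face 0 = {(0, 0)}" "base_face 1 = {(0, 0), (1, 0)}"
  "base_face 2 = {(0, 0), (1, 0), (0, 1), (1, 1)}" "base_face 3 = UNIV"
  by (simp_all add: base_face_def)

lemma rank_cases: assumes "k \<in> {-1..3::int}" obtains "k = -1" | "k = 0" | "k = 1" | "k = 2" | "k = 3"
  using assms by fastforce

lemma base_face_mono: "i \<le> k \<Longrightarrow> base_face i \<subseteq> base_face k"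
  by (auto simp: base_face_def)

lemma bij_act: "bij (act g)"
  by (rule o_bij [of "act (- g)"]) (auto simp: act_add [symmetric])

lemma act_image_add: "act (g + h) ` X = act g ` (act h ` X)"
  by (simp add: act_add image_image)

lemma act_image_eq_iff: "act g ` X = act h ` Y \<longleftrightarrow> X = act (- g + h) ` Y"
proof -
  have "inj (act g)" using bij_act bij_is_inj by blast
  then have "act g ` X = act g ` (act (- g + h) ` Y) \<longleftrightarrow> X = act (- g + h) ` Y"
    by (rule inj_image_eq_iff)
  then show ?thesis by (simp add: act_image_add [symmetric] add.assoc [symmetric])
qed

lemma act_image_subset_iff: "act g ` X \<subseteq> act h ` Y \<longleftrightarrow> act (- h + g) ` X \<subseteq> Y"
proof -
  have "inj (act h)" using bij_act bij_is_inj by blast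
  then have "act h ` (act (- h + g) ` X) \<subseteq> act h ` Y \<longleftrightarrow> act (- h + g) ` X \<subseteq> Y"
    by (rule inj_image_subset_iff)
  then show ?thesis by (simp add: act_image_add [symmetric] add.assoc [symmetric])
qed

lemma act_edge: "act (Sq x y s a b) ` base_face 1 =
    (let v = if s then (x, y - of_bool b) else (x - of_bool a, y) in {v, v + (if s then (0, 1) else (1, 0))})"
  by (cases s; cases a; cases b) (auto simp: flip_def)

lemma act_square: "act (Sq x y s a b) ` base_face 2 =
    (let v = (x - of_bool a, y - of_bool b) in {v, v + (1, 0), v + (0, 1), v + (1, 1)})"
  by (cases s; cases a; cases b) (simp_all add: flip_def insert_commute)

text \<open>This is the geometric origin of \<open>cond44\<close>: the subtracted bits turn the
  image of the origin into the lower left corner of the image face, as in \<open>act_edge\<close>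
  and \<open>act_square\<close>, and an edge keeps its direction exactly when there is no
  swap.\<close>

lemma stabilizer:
  assumes "k \<in> {-1..3}" shows "act g ` base_face k = base_face k \<longleftrightarrow> cond44 {(0, 0)} k g"
proof -
  obtain x y s a b where g: "g = Sq x y s a b" by (cases g)
  from assms show ?thesis
  proof (cases rule: rank_cases)
    case 3
    show ?thesis unfolding 3 g act_edge by (auto simp: cond44_def doubleton_eq_iff)
  next
    case 4
    have "{(p, q), (p + 1, q), (p, q + 1), (p + 1, q + 1)} = {(0, 0), (1, 0), (0, 1), (1, 1)} \<longleftrightarrow> p = 0 \<and> q = 0" (is "?A = ?B \<longleftrightarrow> _")
      for p q :: int
    proof
      assume "?A = ?B"
      then have "(p, q) \<in> ?B" "(p + 1, q + 1) \<in> ?B" by blast+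
      then show "p = 0 \<and> q = 0" by auto
    qed auto
    from this [of "x - of_bool a" "y - of_bool b"] show ?thesis
      unfolding 4 g act_square by (simp add: cond44_def)
  next
    case 5
    then show ?thesis using bij_act [of g] by (simp add: bij_is_surj cond44_def split: sq.split)
  qed (simp_all add: g cond44_def flip_def)
qed

lemma tess_faces_eq: "tess_faces = {act g ` base_face k | g k. k \<in> {-1..3}}" (is "_ = ?R")
proof
  have t: "act (Sq x y False False False) = (\<lambda>v. (x, y) + v)" for x y
    by (auto simp: flip_def)
  have t': "act (Sq x y True False False) = (\<lambda>v. (x + snd v, y + fst v))" for x y
    by (auto simp: flip_def)
  have *: "X \<in> ?R" if "X = act g ` base_face k" "k \<in> {-1..3}" for X g k
    using that by blast
  have "{} \<in> ?R" by (rule * [of _ 0 "-1"]) simp_all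
  moreover have "UNIV \<in> ?R" by (rule * [of _ 0 3]) simp_all
  moreover have "{v} \<in> ?R" for v
    by (rule * [of _ "Sq (fst v) (snd v) False False False" 0]) (cases v; simp add: flip_def)+
  moreover have "{v, v + (1, 0)} \<in> ?R" for v
    by (rule * [of _ "Sq (fst v) (snd v) False False False" 1]) (cases v; simp add: flip_def)+
  moreover have "{v, v + (0, 1)} \<in> ?R" for v
    by (rule * [of _ "Sq (fst v) (snd v) True False False" 1]) (cases v; simp add: flip_def)+
  moreover have "{v, v + (1, 0), v + (0, 1), v + (1, 1)} \<in> ?R" for v
    by (rule * [of _ "Sq (fst v) (snd v) False False False" 2]) (cases v; simp add: flip_def)+
  ultimately show "tess_faces \<subseteq> ?R"
    unfolding tess_faces_def by (intro Un_least UN_least insert_subsetI empty_subsetI)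
  have "act (Sq x y s a b) ` base_face k \<in> tess_faces" if "k \<in> {-1..3}" for x y s a b k
    using that
  proof (cases rule: rank_cases)
    case 1
    then show ?thesis by (simp add: tess_faces_def)
  next
    case 2
    have "act (Sq x y s a b) ` base_face 0 = {(x, y)}" by (simp add: flip_def)
    then show ?thesis unfolding 2 tess_faces_def by blast
  next
    case 3
    have e: "{v, v + (0, 1)} \<in> tess_faces" "{v, v + (1, 0)} \<in> tess_faces" for v
      unfolding tess_faces_def by blast+
    show ?thesis unfolding 3 act_edge Let_def by (cases s) (simp_all only: if_True if_False e)
  next
    case 4
    show ?thesis unfolding 4 act_square Let_def tess_faces_def by blast
  next
    case 5
    then show ?thesis using bij_act by (simp add: tess_faces_def bij_is_surj)
  qed
  then have "act g ` base_face k \<in> tess_faces" if "k \<in> {-1..3}" for g k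
    using that by (cases g) blast
  then show "?R \<subseteq> tess_faces" by blast
qed

text \<open>The stabilizer of a base face is transitive on the faces of each rank inside it. This
  turns inclusion of vertex sets into the existence of a common representative, the incidence of
  coset geometries.\<close>

lemma incidence_base:
  assumes sub: "act g ` base_face k \<subseteq> base_face m" and k: "k \<in> {-1..3}" and m: "m \<in> {-1..3}"
  shows "k \<le> m \<and> (\<exists>w. act w ` base_face k = act g ` base_face k \<and> act w ` base_face m = base_face m)"
proof -
  obtain x y s a b where g: "g = Sq x y s a b" by (cases g)
  have inj: "inj (act g)" using bij_act bij_is_inj by blast
  have fin: "finite (base_face k)" if "finite (base_face m)"
    using that finite_subset [OF sub] finite_imageD inj_on_subset [OF inj] by blast
  have card: "card (base_face k) \<le> card (base_face m)" if "finite (base_face m)"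
    using card_mono [OF that sub] card_image [OF inj_on_subset [OF inj subset_UNIV]] by simp
  have "infinite (UNIV :: (int \<times> int) set)" by (simp add: finite_prod)
  then have km: "k \<le> m"
    using k m fin card by (elim rank_cases) simp_all
  have trivial: ?thesis if "act g ` base_face k = base_face k"
    using km that by (intro conjI exI [of _ 0]) simp_all
  have same: "act g ` base_face k = base_face k" if "k = m" "finite (base_face m)"
    unfolding that(1)
    by (rule card_subset_eq [OF that(2)]) (use sub card_image [OF inj_on_subset [OF inj subset_UNIV]] that(1) in simp_all)
  from m show ?thesis
  proof (cases rule: rank_cases)
    case 1
    then show ?thesis using km k by (intro conjI exI [of _ g]) auto
  next
    case 2
    with km k have "k = -1 \<or> k = 0" by auto
    then show ?thesis using sub 2 trivial by auto
  next
    case 3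
    with km k have "k = -1 \<or> k = 0 \<or> k = 1" by auto
    then show ?thesis
    proof (elim disjE)
      assume [simp]: "k = 0"
      have "(x, y) = (0, 0) \<or> (x, y) = (1, 0)" using sub 3 by (simp add: g flip_def split: if_splits)
      then show ?thesis using km 3
        by (intro conjI exI [of _ "if x = 0 then 0 else gen44 0"]) (auto simp: g flip_def)
    next
      assume [simp]: "k = 1"
      show ?thesis by (rule trivial, rule same) (simp_all add: 3)
    qed (use trivial in simp)
  next
    case 4
    \<comment> \<open>Same image of the origin and same swap bit as \<open>g\<close>, but with the
      signs chosen so that the unit square is mapped to itself.\<close>
    let ?w = "Sq x y s (x = 1) (y = 1)"
    show ?thesis
    proof (cases "k = -1")
      case True
      then show ?thesis using trivial by simp
    next
      case False
      then have "(0, 0) \<in> base_face k" using k by (auto simp: base_face_def)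
      then have "act g (0, 0) \<in> base_face m" using sub by blast
      then have xy: "x = 0 \<or> x = 1" "y = 0 \<or> y = 1" using 4 by (auto simp: g flip_def split: if_splits)
      have wm: "act ?w ` base_face m = base_face m"
        unfolding 4 base_face_simps using xy by (elim disjE; cases s; simp add: flip_def; auto)
      have "k = 0 \<or> k = 1 \<or> k = 2" using False k km 4 by auto
      then have "act ?w ` base_face k = act g ` base_face k"
      proof (elim disjE)
        assume "k = 0"
        then show ?thesis by (simp add: g flip_def)
      next
        assume k1: "k = 1"
        have "act g (1, 0) \<in> base_face m" using sub k1 by (auto simp del: act.simps)
        then have "act g (1, 0) \<in> {(0, 0), (1, 0), (0, 1), (1, 1)}" using 4 by simp
        then have "act ?w (1, 0) = act g (1, 0)"
          using xy by (cases s; cases a; cases b; elim disjE; simp add: g flip_def)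
        moreover have "act ?w (0, 0) = act g (0, 0)" by (simp add: g flip_def)
        ultimately show ?thesis unfolding k1 by (simp del: act.simps)
      next
        assume k2: "k = 2"
        have "act g ` base_face k = base_face k" by (rule same) (simp_all add: 4 k2)
        then show ?thesis using wm unfolding 4 k2 by (simp only:)
      qed
      then show ?thesis using wm km by blast
    qed
  next
    case 5
    then show ?thesis using km bij_act by (intro conjI exI [of _ g]) (auto simp: bij_is_surj)
  qed
qed

lemma incidence:
  assumes "act g ` base_face k \<subseteq> act h ` base_face m" "k \<in> {-1..3}" "m \<in> {-1..3}"
  shows "k \<le> m \<and> (\<exists>w. act w ` base_face k = act g ` base_face k \<and> act w ` base_face m = act h ` base_face m)"
proof -
  have "act (- h + g) ` base_face k \<subseteq> base_face m" using assms(1) by (simp add: act_image_subset_iff)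
  from incidence_base [OF this assms(2,3)] obtain w where
    w: "k \<le> m" "act w ` base_face k = act (- h + g) ` base_face k" "act w ` base_face m = base_face m" by blast
  have "act (h + w) ` base_face k = act g ` base_face k" "act (h + w) ` base_face m = act h ` base_face m"
    unfolding act_image_add [of h w] w(2,3) by (simp_all add: act_image_add [symmetric] add.assoc [symmetric])
  then show ?thesis using w(1) by blast
qed

section \<open>Orbits of faces under a lattice\<close>

definition orbit :: "(int \<times> int) set \<Rightarrow> (int \<times> int) set \<Rightarrow> (int \<times> int) set set" where
  "orbit L X = {(+) v ` X | v. v \<in> L}"

lemma orbit_act: "orbit L (act g ` X) = {act (t + g) ` X | t. t \<in> trans44 L}"
proof -
  have "(+) (x, y) ` act g ` X = act (Sq x y False False False + g) ` X" for x y
  proof -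
    have "act (Sq x y False False False) = (+) (x, y)" by (auto simp: flip_def)
    then show ?thesis by (simp add: act_image_add)
  qed
  then show ?thesis unfolding orbit_def trans44_def by (auto simp: image_image)
qed

context even_lattice
begin

text \<open>The witness is the lattice translation that moves the displaced base face back to its
  place.\<close>

lemma cond_iff_trivial: "cond44 L k z \<longleftrightarrow> (\<exists>t\<in>trans44 L. cond44 {(0, 0)} k (t + z))"
proof
  assume z: "cond44 L k z"
  obtain x y s a b where g: "z = Sq x y s a b" by (cases z)
  consider "k = 0" | "k = 1" | "k = 2" | "k \<notin> {0,1,2}" by blast
  then show "\<exists>t\<in>trans44 L. cond44 {(0, 0)} k (t + z)"
  proof cases
    case 1
    have "(- x, - y) \<in> L" using z 1 neg_fst neg_snd by (simp add: g cond44_def)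
    then show ?thesis using 1 by (intro bexI [of _ "Sq (- x) (- y) False False False"]) (auto simp: g cond44_def trans44_def flip_def)
  next
    case 2
    then have "(- (x - of_bool a), - y) \<in> L" "\<not> s" using z neg_fst [of "x - of_bool a" y] neg_snd by (auto simp: g cond44_def)
    then show ?thesis using 2 by (intro bexI [of _ "Sq (- (x - of_bool a)) (- y) False False False"]) (auto simp: g cond44_def trans44_def flip_def)
  next
    case 3
    then have "(x - of_bool a, y - of_bool b) \<in> L" using z by (simp add: g cond44_def)
    then have "(- (x - of_bool a), - (y - of_bool b)) \<in> L" using neg_fst neg_snd by blast
    then show ?thesis using 3 by (intro bexI [of _ "Sq (- (x - of_bool a)) (- (y - of_bool b)) False False False"]) (auto simp: g cond44_def trans44_def flip_def)
  next
    case 4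
    then show ?thesis using trans_zero by (intro bexI [of _ 0]) (auto simp: g cond44_def)
  qed
next
  assume "\<exists>t\<in>trans44 L. cond44 {(0, 0)} k (t + z)"
  then obtain t where t: "t \<in> trans44 L" "cond44 {(0, 0)} k (t + z)" by blast
  have "cond44 L k (t + z)" using t(2) zero by (auto simp: cond44_def split: sq.splits)
  moreover have "cond44 L k (- t)"
  proof (rule cond_uminus)
    have "cond44 L 0 t" "cond44 L 1 t" "cond44 L 2 t" using t(1) trans_iff_cond by auto
    then show "cond44 L k t" by (cases "k \<in> {0, 1, 2}") (auto simp: cond44_def split: sq.splits)
  qed
  ultimately have "cond44 L k (- t + (t + z))" by (rule cond_add [rotated])
  then show "cond44 L k z" by (simp add: add.assoc [symmetric])
qed

text \<open>Equal orbits mean equal faces after one lattice translation. Normality lets that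
  translation pass to the front of \<open>- g + h\<close>, where \<open>cond_iff_trivial\<close>
  absorbs it.\<close>

lemma orbit_eq_iff:
  assumes "k \<in> {-1..3}"
  shows "orbit L (act g ` base_face k) = orbit L (act h ` base_face k) \<longleftrightarrow> cond44 L k (- g + h)"
proof -
  have "orbit L (act g ` base_face k) = orbit L (act h ` base_face k) \<longleftrightarrow>
    (\<exists>t\<in>trans44 L. act (t + h) ` base_face k = act g ` base_face k)" (is "?E \<longleftrightarrow> ?R")
  proof
    assume ?E
    moreover have "act (0 + g) ` base_face k \<in> orbit L (act g ` base_face k)"
      unfolding orbit_act using trans_zero by blast
    ultimately have "act (0 + g) ` base_face k \<in> orbit L (act h ` base_face k)" by simp
    then obtain t where "t \<in> trans44 L" "act (0 + g) ` base_face k = act (t + h) ` base_face k"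
      unfolding orbit_act by blast
    then show ?R by (intro bexI [of _ t]) simp_all
  next
    assume ?R
    then obtain t where t: "t \<in> trans44 L" "act (t + h) ` base_face k = act g ` base_face k" by blast
    have 1: "act (u + g) ` base_face k = act (u + t + h) ` base_face k" for u
      unfolding act_image_add [of u g] t(2) [symmetric] by (simp add: act_image_add [symmetric] add.assoc)
    have 2: "act (u + h) ` base_face k = act (u + - t + g) ` base_face k" for u
      unfolding act_image_add [of "u + - t" g] t(2) [symmetric] act_image_add [symmetric]
      by (simp add: add.assoc [symmetric])
    show ?E
    proof
      show "orbit L (act g ` base_face k) \<subseteq> orbit L (act h ` base_face k)"
      proof
        fix X assume "X \<in> orbit L (act g ` base_face k)"
        then obtain u where "u \<in> trans44 L" "X = act (u + g) ` base_face k" unfolding orbit_act by blast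
        then show "X \<in> orbit L (act h ` base_face k)"
          unfolding orbit_act using 1 [of u] trans_add [of u t] t(1) by blast
      qed
      show "orbit L (act h ` base_face k) \<subseteq> orbit L (act g ` base_face k)"
      proof
        fix X assume "X \<in> orbit L (act h ` base_face k)"
        then obtain u where "u \<in> trans44 L" "X = act (u + h) ` base_face k" unfolding orbit_act by blast
        then show "X \<in> orbit L (act g ` base_face k)"
          unfolding orbit_act using 2 [of u] trans_add [of u "- t"] trans_uminus t(1) by blast
      qed
    qed
  qed
  also have "\<dots> \<longleftrightarrow> (\<exists>t\<in>trans44 L. cond44 {(0, 0)} k (- g + t + h))"
  proof -
    have "act (t + h) ` base_face k = act g ` base_face k \<longleftrightarrow> act (- g + t + h) ` base_face k = base_face k" for t
      using act_image_eq_iff [of g "base_face k" "t + h" "base_face k"] unfolding add.assoc by argo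
    then show ?thesis unfolding stabilizer [OF assms] by simp
  qed
  also have "\<dots> \<longleftrightarrow> (\<exists>t\<in>trans44 L. cond44 {(0, 0)} k (t + (- g + h)))"
  proof
    assume "\<exists>t\<in>trans44 L. cond44 {(0, 0)} k (- g + t + h)"
    then obtain t where t: "t \<in> trans44 L" "cond44 {(0, 0)} k (- g + t + h)" by blast
    have eq: "- g + t + h = (- g + t - - g) + (- g + h)" by (simp add: add.assoc [symmetric])
    show "\<exists>t\<in>trans44 L. cond44 {(0, 0)} k (t + (- g + h))"
      using t(2) [unfolded eq] trans_normal [OF t(1)] by blast
  next
    assume "\<exists>t\<in>trans44 L. cond44 {(0, 0)} k (t + (- g + h))"
    then obtain t where t: "t \<in> trans44 L" "cond44 {(0, 0)} k (t + (- g + h))" by blast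
    have eq: "t + (- g + h) = - g + (g + t - g) + h" by (simp add: add.assoc [symmetric] add_diff_eq)
    show "\<exists>t\<in>trans44 L. cond44 {(0, 0)} k (- g + t + h)"
      using t(2) [unfolded eq] trans_normal [OF t(1)] by blast
  qed
  also have "\<dots> \<longleftrightarrow> cond44 L k (- g + h)" using cond_iff_trivial by blast
  finally show ?thesis .
qed

end


section \<open>The iterated fibre product\<close>

lemma d4_mult_unit [simp]: "d4_mult u (False, False, False) = u"
  by (cases u) simp

lemma vertex_class_zero [simp]: "vertex_class 0 = (False, False, False)"
  and face_class_zero [simp]: "face_class 0 = (False, False, False)"
  by (simp_all add: zero_sq_def)

lemma linked_zero [simp]: "linked 0 0"
  by (simp add: linked_def)

lemma linked_conj_right: assumes "linked 0 x" shows "linked 0 (g + x - g)"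
proof -
  have "vertex_class x = (False, False, False)" using assms by (simp add: linked_def)
  then have "vertex_class (g + x - g) = vertex_class (g + - g)"
    unfolding diff_conv_add_uminus vertex_class_add by simp
  then show ?thesis by (simp add: linked_def)
qed

lemma linked_conj_left: assumes "linked x 0" shows "linked (g + x - g) 0"
proof -
  have "d4_twist (face_class x) = (False, False, False)" using assms by (simp add: linked_def)
  then have "d4_twist (face_class (g + x - g)) = d4_twist (face_class (g + - g))"
    unfolding diff_conv_add_uminus face_class_add d4_twist_mult by simp
  then show ?thesis by (simp add: linked_def)
qed

lemma uminus_gen44: "- gen44 k = gen44 k"
  using gen44_invol by (rule minus_unique)

locale tower =
  fixes d :: nat and Lat :: "nat \<Rightarrow> (int \<times> int) set"
  assumes d_ge_3: "3 \<le> d" and lattice: "even_lattice (Lat j)"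
begin

text \<open>Fixing the value 0 outside the range makes an element determined by its relevant
  coordinates, so that the pointwise group structure on functions can be used.\<close>

definition G :: "(nat \<Rightarrow> sq) set" where
  "G = {a. (\<forall>j. j \<notin> {3..d} \<longrightarrow> a j = 0) \<and> (\<forall>j\<in>{3..<d}. linked (a j) (a (Suc j)))}"

text \<open>When \<open>i - int j + 3\<close> is not 0, 1 or 2, \<open>cond44\<close> is vacuous, so
  at most three coordinates are constrained.\<close>

definition M :: "int \<Rightarrow> (nat \<Rightarrow> sq) set" where
  "M i = {a. \<forall>j\<in>{3..d}. cond44 (Lat j) (i - int j + 3) (a j)}"

definition r :: "int \<Rightarrow> nat \<Rightarrow> sq" where
  "r i = (\<lambda>j. if j \<in> {3..d} then gen44 (i - int j + 3) else 0)"

abbreviation "H \<equiv> parabolic (int d) G M"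

lemma G_linked: "a \<in> G \<Longrightarrow> j \<in> {3..<d} \<Longrightarrow> linked (a j) (a (Suc j))"
  by (simp add: G_def)

lemma subgroup_G: "add_subgroup G"
  unfolding add_subgroup_def G_def by (auto intro: linked_add linked_uminus)

lemma subgroup_M: "add_subgroup (M i)"
  unfolding add_subgroup_def M_def
  using even_lattice.cond_zero [OF lattice] even_lattice.cond_add [OF lattice] even_lattice.cond_uminus [OF lattice]
  by auto

lemma H_cond: "a \<in> H J \<longleftrightarrow> a \<in> G \<and> (\<forall>j\<in>{3..d}. \<forall>k\<in>{0, 1, 2}. k + int j - 3 \<notin> J \<longrightarrow> cond44 (Lat j) k (a j))"
proof
  assume a: "a \<in> H J"
  have "cond44 (Lat j) k (a j)" if "j \<in> {3..d}" "k \<in> {0, 1, 2}" "k + int j - 3 \<notin> J" for j k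
  proof -
    have "k + int j - 3 \<in> {0..<int d} - J" using that by auto
    then have "a \<in> M (k + int j - 3)" using a by (simp add: parabolic_def)
    then have "cond44 (Lat j) (k + int j - 3 - int j + 3) (a j)" using that(1) unfolding M_def by blast
    then show ?thesis by simp
  qed
  then show "a \<in> G \<and> (\<forall>j\<in>{3..d}. \<forall>k\<in>{0, 1, 2}. k + int j - 3 \<notin> J \<longrightarrow> cond44 (Lat j) k (a j))"
    using a by (simp add: parabolic_def)
next
  assume *: "a \<in> G \<and> (\<forall>j\<in>{3..d}. \<forall>k\<in>{0, 1, 2}. k + int j - 3 \<notin> J \<longrightarrow> cond44 (Lat j) k (a j))"
  have "cond44 (Lat j) (i - int j + 3) (a j)" if "i \<in> {0..<int d} - J" "j \<in> {3..d}" for i j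
  proof (cases "i - int j + 3 \<in> {0, 1, 2}")
    case True
    then show ?thesis using *[THEN conjunct2, THEN bspec, OF that(2), THEN bspec, OF True] that(1) by simp
  next
    case False
    then show ?thesis by (auto simp: cond44_def split: sq.split)
  qed
  then show "a \<in> H J" using * by (simp add: parabolic_def M_def)
qed

lemma kernel_iff: "a \<in> H {} \<longleftrightarrow> a \<in> G \<and> (\<forall>j\<in>{3..d}. a j \<in> trans44 (Lat j))"
  unfolding H_cond using even_lattice.trans_iff_cond [OF lattice] by simp

lemma H_in_G: "a \<in> H J \<Longrightarrow> a \<in> G"
  by (simp add: parabolic_def)

lemma r_in_G: "r i \<in> G"
proof -
  have "linked (r i j) (r i (Suc j))" if "j \<in> {3..<d}" for j
    using linked_gen44 [of "i - int j + 2"] that by (simp add: r_def algebra_simps)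
  then show ?thesis by (auto simp: G_def r_def)
qed

lemma r_in_M: "i \<noteq> j \<Longrightarrow> r i \<in> M j"
  unfolding M_def r_def by (auto intro!: even_lattice.cond_gen44 [OF lattice])

lemma r_notin_M: assumes "0 \<le> i" "i < int d" shows "r i \<notin> M i"
proof -
  \<comment> \<open>A coordinate on which \<open>r i\<close> acts as a reflection: its local index
    is 2 if i >= 2, and i in coordinate 3 otherwise.\<close>
  define j where "j = max 3 (nat i + 1)"
  have j: "j \<in> {3..d}" "i - int j + 3 \<in> {0, 1, 2}" using assms d_ge_3 by (auto simp: j_def max_def)
  then have "\<not> cond44 (Lat j) (i - int j + 3) (r i j)"
    using even_lattice.not_cond_gen44 [OF lattice j(2)] by (simp add: r_def)
  then show ?thesis using j(1) unfolding M_def by blast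
qed

lemma r_invol: "r i + r i = 0"
  by (auto simp: r_def gen44_invol fun_eq_iff)

lemma r_commute: "i + 2 \<le> j \<Longrightarrow> r i + r j = r j + r i"
  by (auto simp: r_def fun_eq_iff intro!: gen44_commute)

lemma kernel_normal: "g \<in> G \<Longrightarrow> k \<in> H {} \<Longrightarrow> g + k - g \<in> H {}"
proof -
  assume g: "g \<in> G" and k: "k \<in> H {}"
  then have "g + k + - g \<in> G" using subgroup_G H_in_G [OF k] unfolding add_subgroup_def by blast
  then show "g + k - g \<in> H {}"
    using k even_lattice.trans_normal [OF lattice] unfolding kernel_iff by simp
qed

text \<open>A kernel element standing before a letter is moved to its right as a conjugate, so
  kernel elements collect at the end of the word.\<close>

lemma words_add: assumes "x \<in> words (H {}) r J" "y \<in> words (H {}) r J" shows "x + y \<in> words (H {}) r J"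
proof -
  have K: "\<forall>k\<in>H {}. k + y \<in> words (H {}) r J"
    using assms(2)
  proof induction
    case (base k')
    have "k + k' \<in> H {}" if "k \<in> H {}" for k
      using that base subgroup_G even_lattice.trans_add [OF lattice] unfolding kernel_iff add_subgroup_def by simp
    then show ?case using words.base by blast
  next
    case (step j z)
    show ?case
    proof
      fix k assume k: "k \<in> H {}"
      have "- r j = r j" using r_invol by (rule minus_unique)
      then have eq: "k + (r j + z) = r j + ((r j + k - r j) + z)"
        by (simp add: add.assoc [symmetric] diff_conv_add_uminus r_invol del: add_uminus_conv_diff)
      show "k + (r j + z) \<in> words (H {}) r J"
        unfolding eq using step(3) kernel_normal [OF r_in_G k] by (intro words.step step(1)) blast
    qed
  qed
  from assms(1) show ?thesis
  proof induction
    case (base k)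
    then show ?case using K by blast
  next
    case (step j x)
    then show ?case unfolding add.assoc by (intro words.step)
  qed
qed

lemma words_r: "j \<in> J \<Longrightarrow> r j \<in> words (H {}) r J"
  using words.step [of j J 0 "H {}" r] words.base [of 0 "H {}" r J] subgroup_G even_lattice.trans_zero [OF lattice]
  by (simp add: kernel_iff add_subgroup_def)

lemma H_closed: "0 \<in> H J" "x \<in> H J \<Longrightarrow> y \<in> H J \<Longrightarrow> x + y \<in> H J" "x \<in> H J \<Longrightarrow> - x \<in> H J"
  using subgroup_G subgroup_M unfolding parabolic_def add_subgroup_def by simp_all

lemma words_subset: assumes "J \<subseteq> {0..<int d}" shows "words (H {}) r J \<subseteq> H J"
proof
  fix x assume "x \<in> words (H {}) r J"
  then show "x \<in> H J"
  proof induction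
    case (base k)
    then show ?case by (simp add: parabolic_def)
  next
    case (step j x)
    have "r j \<in> M i" if "i \<notin> J" for i using r_in_M [of j i] that step(1) by auto
    then have "r j \<in> H J" using r_in_G by (simp add: parabolic_def)
    then show ?case using step H_closed by blast
  qed
qed

text \<open>An even translation has trivial class on both sides, so linking does not tie it to its
  neighbours; the kernel is the full product of the lattices.\<close>

lemma single_trans:
  assumes "t \<in> trans44 (Lat m)" "m \<in> {3..d}" shows "(\<lambda>l. if l = m then t else 0) \<in> H {}"
proof -
  have "(\<lambda>l. if l = m then t else 0) \<in> G"
    unfolding G_def using assms(2) even_lattice.linked_trans_left [OF lattice assms(1)]
      even_lattice.linked_trans_right [OF lattice assms(1)] by auto
  then show ?thesis
    unfolding kernel_iff using assms(1) even_lattice.trans_zero [OF lattice] by auto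
qed

text \<open>Coordinates are cleared from left to right: once all coordinates before \<open>m\<close> are trivial, the \<open>m\<close>-th one
  lies in the kernel of \<open>vertex_class\<close>, hence is a product of conjugates of \<open>gen44 2\<close>, and the
  corresponding conjugates of \<open>r (m - 1)\<close> do not affect the coordinates before \<open>m\<close>.\<close>

lemma generated: assumes J: "J \<subseteq> {0..<int d}" shows "H J \<subseteq> words (H {}) r J"
proof -
  define Q where "Q m \<longleftrightarrow> (\<forall>x\<in>H J. (\<forall>l\<in>{3..<m}. x l \<in> trans44 (Lat l)) \<longrightarrow> x \<in> words (H {}) r J)" for m
  have "Q 3"
  proof (rule inc_induct [of 3 "Suc d" Q])
    show "3 \<le> Suc d" using d_ge_3 by simp
    have "x \<in> H {}" if "x \<in> H J" "\<forall>l\<in>{3..<Suc d}. x l \<in> trans44 (Lat l)" for x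
      using that H_in_G [of x J] unfolding kernel_iff by auto
    then show "Q (Suc d)" unfolding Q_def using words.base by blast
    fix m assume m: "3 \<le> m" "m < Suc d" and IH: "Q (Suc m)"
    interpret even_lattice "Lat m" by (rule lattice)
    have mm: "m \<in> {3..d}" using m by simp
    show "Q m"
      unfolding Q_def
    proof (intro ballI impI)
      fix x assume x: "x \<in> H J" "\<forall>l\<in>{3..<m}. x l \<in> trans44 (Lat l)"
      \<comment> \<open>The \<open>m\<close>-th coordinates of the elements of \<open>Z\<close> form
        the set to which the generation lemmas for a single coordinate are applied.\<close>
      define Z where "Z = {y \<in> words (H {}) r J. \<forall>l\<in>{3..<m}. y l \<in> trans44 (Lat l)}"
      define S where "S = {k. k + int m - 3 \<in> J}"
      have Z_add: "y + z \<in> Z" if "y \<in> Z" "z \<in> Z" for y z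
        using that words_add even_lattice.trans_add [OF lattice] by (auto simp: Z_def)
      have Y_add: "g + h \<in> (\<lambda>y. y m) ` Z" if gh: "g \<in> (\<lambda>y. y m) ` Z" "h \<in> (\<lambda>y. y m) ` Z" for g h
      proof -
        obtain y z where "y \<in> Z" "z \<in> Z" "g = y m" "h = z m" using gh by blast
        then show ?thesis using Z_add by (intro image_eqI [of _ _ "y + z"]) auto
      qed
      have Y_trans: "trans44 (Lat m) \<subseteq> (\<lambda>y. y m) ` Z"
      proof
        fix t assume t: "t \<in> trans44 (Lat m)"
        have "(\<lambda>l. if l = m then t else 0) \<in> Z"
          using words.base [OF single_trans [OF t mm]] even_lattice.trans_zero [OF lattice] by (auto simp: Z_def)
        then show "t \<in> (\<lambda>y. y m) ` Z" by (rule rev_image_eqI) simp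
      qed
      have w: "cond44 (Lat m) k (x m)" if "k \<in> {0, 1, 2} - S" for k
        using x(1) that mm unfolding H_cond S_def by blast
      have rm: "r (k + int m - 3) m = gen44 k" for k
        using mm by (simp add: r_def)
      have "x m \<in> (\<lambda>y. y m) ` Z"
      proof (cases "m = 3")
        case True
        \<comment> \<open>There is no earlier coordinate to disturb, so all three reflections are
          available, whatever they do further right.\<close>
        have gens: "gen44 k \<in> (\<lambda>y. y m) ` Z" if k: "k \<in> S" for k
        proof -
          have "r (k + int m - 3) \<in> Z" using k words_r True by (auto simp: Z_def S_def)
          then show ?thesis by (rule rev_image_eqI) (simp add: rm)
        qed
        show ?thesis by (rule generated44 [OF Y_add Y_trans gens w])
      next
        case False
        then have m1: "m - 1 \<in> {3..<d}" "m - 1 \<in> {3..<m}" "Suc (m - 1) = m" using m by auto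
        then have "linked (x (m - 1)) (x m)" using G_linked [OF H_in_G [OF x(1)] m1(1)] by simp
        moreover have "linked (x (m - 1)) 0"
          using even_lattice.linked_trans_left [OF lattice] x(2) m1(2) by blast
        ultimately have ker: "vertex_class (x m) = (False, False, False)"
          by (simp add: linked_def)
        have conj: "gen44 k + g + gen44 k \<in> (\<lambda>y. y m) ` Z" if k: "k \<in> S" and g: "g \<in> (\<lambda>y. y m) ` Z" for k g
        proof -
          obtain y where y: "y \<in> Z" "g = y m" using g by blast
          let ?r = "r (k + int m - 3)"
          have "?r l + y l + ?r l \<in> trans44 (Lat l)" if "l \<in> {3..<m}" for l
          proof -
            have "- ?r l = ?r l" using uminus_gen44 by (simp add: r_def)
            then have "?r l + y l + ?r l = ?r l + y l - ?r l" by (metis diff_conv_add_uminus)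
            then show ?thesis using even_lattice.trans_normal [OF lattice] y that by (simp add: Z_def)
          qed
          then have "?r + y + ?r \<in> Z"
            using y k words_r [of "k + int m - 3" J] words_add by (auto simp: Z_def S_def)
          then show ?thesis by (rule rev_image_eqI) (simp add: rm y)
        qed
        have two: "gen44 2 \<in> (\<lambda>y. y m) ` Z" if "2 \<in> S"
        proof -
          have "r (2 + int m - 3) l \<in> trans44 (Lat l)" if "l \<in> {3..<m}" for l
            using that even_lattice.trans_zero [OF lattice] by (simp add: r_def)
          then have "r (2 + int m - 3) \<in> Z" using \<open>2 \<in> S\<close> words_r by (auto simp: Z_def S_def)
          then show ?thesis by (rule rev_image_eqI) (rule rm [symmetric])
        qed
        show ?thesis by (rule kernel_generated [OF Y_add Y_trans conj two w ker])
      qed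
      then obtain y where y: "y \<in> Z" "y m = x m" by force
      then have "y \<in> H J" using words_subset [OF J] by (auto simp: Z_def)
      then have "- y + x \<in> H J" using x(1) H_closed by blast
      moreover have "(- y + x) l \<in> trans44 (Lat l)" if "l \<in> {3..<Suc m}" for l
      proof (cases "l = m")
        case True
        then show ?thesis using y even_lattice.trans_zero [OF lattice] by simp
      next
        case False
        then have "l \<in> {3..<m}" using that by simp
        then show ?thesis
          using y(1) x(2) even_lattice.trans_add [OF lattice] even_lattice.trans_uminus [OF lattice] by (simp add: Z_def)
      qed
      ultimately have "- y + x \<in> words (H {}) r J" using IH unfolding Q_def by blast
      then have "y + (- y + x) \<in> words (H {}) r J" using y(1) words_add unfolding Z_def by blast
      then show "x \<in> words (H {}) r J" by (simp add: add.assoc [symmetric])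
    qed
  qed
  then show ?thesis by (auto simp: Q_def)
qed

lemma H_condD: "a \<in> H J \<Longrightarrow> j \<in> {3..d} \<Longrightarrow> k \<in> {0, 1, 2} \<Longrightarrow> k + int j - 3 \<notin> J \<Longrightarrow> cond44 (Lat j) k (a j)"
  unfolding H_cond by blast

text \<open>Triviality descends from the last coordinate: a trivial successor kills the
  \<open>face_class\<close> of a coordinate, which is faithful there by the condition for 0.\<close>

lemma kernel_down:
  assumes a: "a \<in> G" and cond: "\<And>j. j \<in> {3..d} \<Longrightarrow> cond44 (Lat j) 0 (a j)" and top: "a d \<in> trans44 (Lat d)"
  shows "a \<in> H {}"
proof -
  have "a m \<in> trans44 (Lat m)" if "m \<in> {3..d}" for m
  proof (rule inc_induct [of m d "\<lambda>j. a j \<in> trans44 (Lat j)"])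
    show "m \<le> d" using that by simp
    show "a d \<in> trans44 (Lat d)" by (rule top)
    fix j assume j: "m \<le> j" "j < d" and IH: "a (Suc j) \<in> trans44 (Lat (Suc j))"
    have "linked (a j) (a (Suc j))" by (rule G_linked [OF a]) (use j that in simp)
    moreover have "linked 0 (a (Suc j))" by (rule even_lattice.linked_trans_right [OF lattice IH])
    ultimately have "linked (a j) 0" by (simp add: linked_def)
    then show "a j \<in> trans44 (Lat j)"
      by (rule even_lattice.trans_down [OF lattice]) (use cond j that in simp)
  qed
  then show ?thesis using a by (simp add: kernel_iff)
qed

end

locale tower_faces = tower +
  fixes face :: "int \<Rightarrow> (nat \<Rightarrow> sq) \<Rightarrow> 'f"
  assumes face_eq: "g \<in> G \<Longrightarrow> h \<in> G \<Longrightarrow> i \<in> {-1..int d} \<Longrightarrow> j \<in> {-1..int d} \<Longrightarrow>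
      face i g = face j h \<longleftrightarrow> i = j \<and> - g + h \<in> H (- {i})"

sublocale tower_faces \<subseteq> C: string_c_group "int d" G M r face
  by unfold_locales
    (use subgroup_G subgroup_M r_in_G r_in_M r_notin_M r_invol r_commute kernel_normal generated face_eq in simp_all)


context tower_faces
begin

section \<open>Amalgamation property, flatness and type\<close>

text \<open>The last generator is trivial before coordinate d and has trivial
  \<open>vertex_class\<close> there; \<open>?N\<close> collects all such elements. In the facet
  subgroup the last coordinate lies in the retract, so it is trivial by
  \<open>trans_up\<close>.\<close>

lemma fap_facets: "FAP_faces (int d) C.P (C.Fl 0) (int d - 1)"
  unfolding FAP_faces_def N_plus_def
proof (rule C.normal_closure_inter_generate)
  interpret even_lattice "Lat d" by (rule lattice)
  let ?N = "{a \<in> G. (\<forall>j\<in>{3..<d}. a j \<in> trans44 (Lat j)) \<and> linked 0 (a d)}"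
  have dd: "d \<in> {3..d}" using d_ge_3 by simp
  show "{0..int d - 1 - 1} \<subseteq> {0..<int d}" "{int d - 1..int d - 1} \<subseteq> {0..<int d}" using d_ge_3 by auto
  show "add_subgroup ?N"
    using subgroup_G linked_add [of 0 _ 0] linked_uminus [of 0] even_lattice.trans_zero [OF lattice]
      even_lattice.trans_add [OF lattice] even_lattice.trans_uminus [OF lattice]
    unfolding add_subgroup_def by simp
  show "?N \<subseteq> G" by blast
  show "g + x - g \<in> ?N" if "g \<in> G" "x \<in> ?N" for g x
  proof -
    have "g + x - g \<in> G" using that by (intro C.G_closed) auto
    moreover have "\<forall>j\<in>{3..<d}. (g + x - g) j \<in> trans44 (Lat j)"
      using that even_lattice.trans_normal [OF lattice] by simp
    moreover have "linked 0 ((g + x - g) d)" using that linked_conj_right by simp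
    ultimately show ?thesis by blast
  qed
  show "H {} \<subseteq> ?N" using linked_trans_right dd by (auto simp: kernel_iff)
  show "r j \<in> ?N" if "j \<in> {int d - 1..int d - 1}" for j
  proof -
    have j: "j = int d - 1" using that by simp
    have "linked 0 (r j d)" using linked_gen44 [of 2] dd by (simp add: r_def j)
    moreover have "r j i \<in> trans44 (Lat i)" if "i \<in> {3..<d}" for i
      using that even_lattice.trans_zero [OF lattice] by (simp add: r_def j)
    ultimately show ?thesis using r_in_G by blast
  qed
  show "?N \<inter> H {0..int d - 1 - 1} \<subseteq> H {}"
  proof
    fix a assume a: "a \<in> ?N \<inter> H {0..int d - 1 - 1}"
    then have "cond44 (Lat d) 2 (a d)" using dd by (intro H_condD [of a "{0..int d - 1 - 1}"]) auto
    then have "a d \<in> trans44 (Lat d)" using a by (auto intro: trans_up)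
    moreover have "j = d \<or> j \<in> {3..<d}" if "j \<in> {3..d}" for j using that by auto
    ultimately show "a \<in> H {}" using a unfolding kernel_iff by blast
  qed
qed

text \<open>Here \<open>?N\<close> is the kernel of \<open>face_class\<close> in the last
  coordinate, where the generators up to d - 3 act as \<open>gen44 0\<close> or trivially. The
  complementary parabolic satisfies the condition for 0 in every coordinate, so triviality
  propagates down.\<close>

lemma fap_coface_3: "FAP_cofaces (int d) C.P (C.Fl 0) (int d - 3)"
  unfolding FAP_cofaces_def N_minus_def
proof (rule C.normal_closure_inter_generate)
  interpret even_lattice "Lat d" by (rule lattice)
  let ?N = "{a \<in> G. linked (a d) 0}"
  have dd: "d \<in> {3..d}" using d_ge_3 by simp
  show "{int d - 3 + 1..int d - 1} \<subseteq> {0..<int d}" "{0..int d - 3} \<subseteq> {0..<int d}" using d_ge_3 by auto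
  show "add_subgroup ?N"
    using subgroup_G linked_add [of _ 0 _ 0] linked_uminus [of _ 0] unfolding add_subgroup_def by simp
  show "?N \<subseteq> G" by blast
  show "g + x - g \<in> ?N" if "g \<in> G" "x \<in> ?N" for g x
  proof -
    have "g + x - g \<in> G" using that by (intro C.G_closed) auto
    moreover have "linked ((g + x - g) d) 0" using that linked_conj_left by simp
    ultimately show ?thesis by blast
  qed
  show "H {} \<subseteq> ?N" using linked_trans_left dd by (auto simp: kernel_iff)
  show "r j \<in> ?N" if "j \<in> {0..int d - 3}" for j
  proof -
    have "gen44 (j - int d + 2) = 0" using that by simp
    moreover have "gen44 (j - int d + 2 + 1) = r j d" using dd by (simp add: r_def algebra_simps)
    ultimately have "linked (r j d) 0" using linked_gen44 [of "j - int d + 2"] by argo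
    then show ?thesis using r_in_G by blast
  qed
  show "?N \<inter> H {int d - 3 + 1..int d - 1} \<subseteq> H {}"
  proof
    fix a assume a: "a \<in> ?N \<inter> H {int d - 3 + 1..int d - 1}"
    then have "cond44 (Lat j) 0 (a j)" if "j \<in> {3..d}" for j
      using that by (intro H_condD [of a "{int d - 3 + 1..int d - 1}"]) auto
    moreover from this have "a d \<in> trans44 (Lat d)" using a dd by (auto intro: trans_down)
    ultimately show "a \<in> H {}" using a by (intro kernel_down) auto
  qed
qed

text \<open>The generators up to d - 4 do not touch the last coordinate at all, so \<open>?N\<close>
  may ask for its triviality. This supplies the condition for 0 there; the parabolic supplies it in
  the other coordinates.\<close>

lemma fap_coface_4: "FAP_cofaces (int d) C.P (C.Fl 0) (int d - 4)"
  unfolding FAP_cofaces_def N_minus_def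
proof (rule C.normal_closure_inter_generate)
  interpret even_lattice "Lat d" by (rule lattice)
  let ?N = "{a \<in> G. a d \<in> trans44 (Lat d)}"
  have dd: "d \<in> {3..d}" using d_ge_3 by simp
  show "{int d - 4 + 1..int d - 1} \<subseteq> {0..<int d}" "{0..int d - 4} \<subseteq> {0..<int d}" using d_ge_3 by auto
  show "add_subgroup ?N"
    using subgroup_G trans_zero trans_add trans_uminus unfolding add_subgroup_def by simp
  show "?N \<subseteq> G" by blast
  show "g + x - g \<in> ?N" if "g \<in> G" "x \<in> ?N" for g x
  proof -
    have "g + x - g \<in> G" using that by (intro C.G_closed) auto
    moreover have "(g + x - g) d \<in> trans44 (Lat d)" using that trans_normal by simp
    ultimately show ?thesis by blast
  qed
  show "H {} \<subseteq> ?N" using dd by (auto simp: kernel_iff)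
  show "r j \<in> ?N" if "j \<in> {0..int d - 4}" for j
  proof -
    have "r j d = 0" using that dd by (simp add: r_def)
    then show ?thesis using r_in_G trans_zero by simp
  qed
  show "?N \<inter> H {int d - 4 + 1..int d - 1} \<subseteq> H {}"
  proof
    fix a assume a: "a \<in> ?N \<inter> H {int d - 4 + 1..int d - 1}"
    have "cond44 (Lat j) 0 (a j)" if j: "j \<in> {3..d}" for j
    proof (cases "j = d")
      case True
      then show ?thesis using a trans_iff_cond by simp
    next
      case False
      then show ?thesis using a j by (intro H_condD [of a "{int d - 4 + 1..int d - 1}"]) auto
    qed
    then show "a \<in> H {}" using a by (intro kernel_down) auto
  qed
qed

text \<open>Replacing the last coordinate of \<open>z\<close> by a symmetry of the unit square of
  the same class gives an element \<open>b\<close> of the facet stabilizer. The quotient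
  \<open>- b + z\<close> lives in the last coordinate alone, which faces of rank at most d - 4 do
  not see.\<close>

lemma facet_incident:
  assumes i: "0 \<le> i" "i \<le> int d - 4" and g: "g \<in> G" "h \<in> G"
  shows "leq C.P (face i g) (face (int d - 1) h)"
proof -
  interpret even_lattice "Lat d" by (rule lattice)
  have dd: "d \<in> {3..d}" using d_ge_3 by simp
  define z where "z = - h + g"
  have z: "z \<in> G" using g by (simp add: z_def)
  obtain u where u: "cond44 (Lat d) 2 u" "vertex_class u = vertex_class (z d)"
    by (rule vertex_class_rep)
  define b where "b = z(d := u)"
  have bG: "b \<in> G"
    using z d_ge_3 u(2) unfolding b_def G_def linked_def by auto
  have b: "b \<in> H (- {int d - 1})"
    unfolding H_cond using bG u(1) by (auto simp: b_def)
  have bz: "- b + z \<in> G" using bG z by simp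
  have "(- b + z) j = 0" if "j \<noteq> d" for j
    using that by (simp add: b_def)
  then have bzi: "- b + z \<in> H (- {i})"
    unfolding H_cond using bz i even_lattice.cond_zero [OF lattice] by force
  have x: "h + b \<in> G" using g bG by simp
  have "face (int d - 1) (h + b) = face (int d - 1) h"
    by (rule C.face_absorb) (use g b d_ge_3 in auto)
  moreover have "face i ((h + b) + (- b + z)) = face i (h + b)"
    by (rule C.face_absorb) (use x bzi i in auto)
  moreover have "(h + b) + (- b + z) = g"
    by (simp add: z_def add.assoc)
  moreover have "leq C.P (face i (h + b)) (face (int d - 1) (h + b))"
    by (rule C.leq_same) (use x i in auto)
  ultimately show ?thesis by simp
qed

lemma kl_flat_P: assumes "0 \<le> i" "i \<le> int d - 4" shows "kl_flat (int d) C.P i (int d - 1)"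
  unfolding kl_flat_def
proof (intro conjI ballI impI)
  fix E F assume EF: "E \<in> faces C.P" "F \<in> faces C.P" "rk C.P E = i \<and> rk C.P F = int d - 1"
  then obtain g h where "g \<in> G" "h \<in> G" "E = face i g" "F = face (int d - 1) h"
    using C.rk_cases by metis
  then show "incident C.P E F" using facet_incident assms by (simp add: incident_def)
qed (use assms in auto)

text \<open>The section belonging to j depends on coordinate j only: in the other coordinates the
  generators outside the section impose the conditions for 2 or for 0 under which
  \<open>cond_up\<close> and \<open>cond_down\<close> carry the condition along.\<close>

lemma section_face_eq:
  assumes j: "j \<in> {3..d}" and i: "i \<in> {int j - 4..int j}"
    and x: "x \<in> H {int j - 4<..<int j}" and y: "y \<in> H {int j - 4<..<int j}"
  shows "face i x = face i y \<longleftrightarrow> cond44 (Lat j) (i - int j + 3) (- x j + y j)"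
proof -
  let ?B = "H {int j - 4<..<int j}"
  define z where "z = - x + y"
  have z: "z \<in> ?B" using x y H_closed by (simp add: z_def)
  have G: "x \<in> G" "y \<in> G" "z \<in> G" using x y z H_in_G by blast+
  have "face i x = face i y \<longleftrightarrow> z \<in> H (- {i})"
    using face_eq [OF G(1,2), of i i] i j by (simp add: z_def)
  also have "\<dots> \<longleftrightarrow> cond44 (Lat j) (i - int j + 3) (z j)"
  proof (cases "i \<in> {int j - 4<..<int j}")
    case False
    then have "z \<in> H (- {i})" using z unfolding H_cond by auto
    moreover have "cond44 (Lat j) (i - int j + 3) (z j)"
      using i False by (auto simp: cond44_def split: sq.split)
    ultimately show ?thesis by simp
  next
    case True
    show ?thesis
    proof
      assume "z \<in> H (- {i})"
      then show "cond44 (Lat j) (i - int j + 3) (z j)"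
        by (rule H_condD) (use True j in auto)
    next
      assume c: "cond44 (Lat j) (i - int j + 3) (z j)"
      have zc: "cond44 (Lat l) k (z l)" if "l \<in> {3..d}" "k \<in> {0, 1, 2}" "k + int l - 3 \<notin> {int j - 4<..<int j}" for l k
        using z that unfolding H_cond by blast
      have triv: "cond44 (Lat l) k w" if "k < 0 \<or> k > 2" for l k w
        using that by (auto simp: cond44_def split: sq.split)
      \<comment> \<open>In coordinate l + 1 with l >= j, index 2 belongs to generator l, which is
        outside the section.\<close>
      have up: "cond44 (Lat l) (i - int l + 3) (z l)" if "j \<le> l" "l \<le> d" for l
        using that
      proof (induction l rule: dec_induct)
        case base
        show ?case by (rule c)
      next
        case (step l)
        show ?case
        proof (cases "i - int (Suc l) + 3 < 0")
          case False
          have "cond44 (Lat l) ((i - int (Suc l) + 3) + 1) (z l)" using step by (simp add: algebra_simps)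
          moreover have "linked (z l) (z (Suc l))" by (rule G_linked [OF G(3)]) (use step j in auto)
          moreover have "cond44 (Lat (Suc l)) 2 (z (Suc l))" by (rule zc) (use step j in auto)
          moreover have "i - int (Suc l) + 3 = 0 \<or> i - int (Suc l) + 3 = 1" using False True step by auto
          ultimately show ?thesis using even_lattice.cond_up [OF lattice _ _ lattice] by blast
        qed (simp add: triv)
      qed
      have down: "3 \<le> l \<longrightarrow> cond44 (Lat l) (i - int l + 3) (z l)" if "l \<le> j" for l
        using that
      proof (induction l rule: inc_induct)
        case base
        show ?case using c by blast
      next
        case (step l)
        show ?case
        proof
          assume l: "3 \<le> l"
          show "cond44 (Lat l) (i - int l + 3) (z l)"
          proof (cases "i - int (Suc l) + 3 < 0 \<or> i - int (Suc l) + 3 > 1")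
            case False
            have "cond44 (Lat (Suc l)) (i - int (Suc l) + 3) (z (Suc l))" using step l by simp
            moreover have "linked (z l) (z (Suc l))" by (rule G_linked [OF G(3)]) (use step j l in auto)
            moreover have "cond44 (Lat l) 0 (z l)" by (rule zc) (use step j l in auto)
            ultimately have "cond44 (Lat l) (i - int (Suc l) + 3 + 1) (z l)"
              using even_lattice.cond_down [OF lattice _ _ lattice] False by force
            then show ?thesis by (simp add: algebra_simps)
          next
            case 2: True
            then have "i - int l + 3 > 2" using True step by auto
            then show ?thesis by (simp add: triv)
          qed
        qed
      qed
      have "cond44 (Lat l) k (z l)" if l: "l \<in> {3..d}" "k \<in> {0, 1, 2}" "k + int l - 3 \<notin> - {i}" for l k
      proof -
        have "k = i - int l + 3" using l by simp
        then show ?thesis using up [of l] down [of l] l by (cases "l \<le> j") auto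
      qed
      then show "z \<in> H (- {i})" unfolding H_cond using G by blast
    qed
  qed
  finally show ?thesis by (simp add: z_def)
qed

text \<open>A word in the three reflections lifts letter by letter. The trivial lattice is used so
  that coordinate j becomes exactly \<open>w\<close>, not only \<open>w\<close> modulo
  \<open>Lat j\<close>.\<close>

lemma lift_coordinate:
  assumes j: "j \<in> {3..d}" obtains x where "x \<in> H {int j - 4<..<int j}" "x j = w"
proof -
  let ?B = "H {int j - 4<..<int j}"
  have "w \<in> (\<lambda>x. x j) ` ?B"
  proof (rule even_lattice.generated44 [OF even_lattice_trivial, where S = "{0, 1, 2}"])
    show "g + h \<in> (\<lambda>x. x j) ` ?B" if gh: "g \<in> (\<lambda>x. x j) ` ?B" "h \<in> (\<lambda>x. x j) ` ?B" for g h
    proof -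
      obtain y z where "y \<in> ?B" "z \<in> ?B" "g = y j" "h = z j" using gh by blast
      then show ?thesis using H_closed(2) by (intro image_eqI [of _ _ "y + z"]) simp_all
    qed
    have "(0 :: nat \<Rightarrow> sq) \<in> ?B" by (rule H_closed)
    then show "trans44 {(0, 0)} \<subseteq> (\<lambda>x. x j) ` ?B"
      by (auto simp: trans44_def zero_sq_def [symmetric] intro!: rev_image_eqI)
    show "gen44 k \<in> (\<lambda>x. x j) ` ?B" if "k \<in> {0, 1, 2}" for k
    proof (rule image_eqI [of _ _ "r (k + int j - 3)"])
      show "gen44 k = r (k + int j - 3) j" using j by (simp add: r_def)
      show "r (k + int j - 3) \<in> ?B" by (rule C.r_in_H) (use that j in auto)
    qed
  qed simp_all
  then show ?thesis using that by force
qed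

text \<open>By \<open>section_face_eq\<close> and \<open>orbit_eq_iff\<close>, equality of faces is
  the same condition on coordinate j on both sides, and incidence is a common representative on both
  sides; lifting symmetries matches the representatives.\<close>

lemma section_isomorphic:
  assumes j: "j \<in> {3..d}" and Lat: "Lat j = lattice44 s t"
  shows "isomorphic (section_of C.P (face (int j - 4) 0) (face (int j) 0)) (torus44 s t)"
proof -
  interpret even_lattice "Lat j" by (rule lattice)
  let ?B = "H {int j - 4<..<int j}" and ?S = "section_of C.P (face (int j - 4) 0) (face (int j) 0)"
  let ?R = "{int j - 4..int j}"
  have sub: "?R \<subseteq> {-1..int d}" using j by auto
  have BG: "x \<in> G" if "x \<in> ?B" for x using that H_in_G by blast
  have ends: "face (int j - 4) x = face (int j - 4) 0" "face (int j) x = face (int j) 0" if "x \<in> ?B" for x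
  proof -
    have "face i (0 + x) = face i 0" if "i = int j - 4 \<or> i = int j" for i
      by (rule C.face_absorb) (use that j C.H_mono [of "{int j - 4<..<int j}" "- {i}" x] \<open>x \<in> ?B\<close> in auto)
    then show "face (int j - 4) x = face (int j - 4) 0" "face (int j) x = face (int j) 0" by simp_all
  qed
  have rep: "\<exists>g\<in>?B. \<forall>F\<in>X. rk C.P F \<in> ?R \<and> F = face (rk C.P F) g"
    if X: "X \<subseteq> faces ?S" "\<And>E F. E \<in> X \<Longrightarrow> F \<in> X \<Longrightarrow> leq C.P E F \<or> leq C.P F E" for X
  proof -
    have X': "X \<subseteq> faces C.P" "\<And>E. E \<in> X \<Longrightarrow> leq C.P (face (int j - 4) 0) E \<and> leq C.P E (face (int j) 0)"
      using X(1) by (auto simp: section_of_def)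
    have "rk C.P F \<in> ?R" if "F \<in> X" for F
      using X'(2) [OF that] C.leq_rk [of "face (int j - 4) 0" F] C.leq_rk [of F "face (int j) 0"] j by auto
    moreover obtain g where "g \<in> ?B" "\<And>F. F \<in> X \<Longrightarrow> F = face (rk C.P F) g"
      by (rule C.section_rep [of "int j - 4" "int j" X]) (use X' X(2) j in auto)
    ultimately show ?thesis by blast
  qed
  have mem: "face i x \<in> faces ?S" if x: "x \<in> ?B" "i \<in> ?R" for i x
  proof -
    have i: "i \<in> {-1..int d}" "int j - 4 \<in> {-1..int d}" "int j \<in> {-1..int d}" "int j - 4 \<le> i" "i \<le> int j"
      using x(2) j by auto
    have "leq C.P (face (int j - 4) x) (face i x)" "leq C.P (face i x) (face (int j) x)"
      using C.leq_same [OF i(2,1) BG [OF x(1)] i(4)] C.leq_same [OF i(1,3) BG [OF x(1)] i(5)] by blast+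
    moreover have "face i x \<in> faces C.P" using i(1) BG [OF x(1)] by (rule C.face_in_P)
    ultimately show ?thesis unfolding section_of_def ends [OF x(1)] by simp
  qed
  have faces_S: "F \<in> faces ?S \<longleftrightarrow> (\<exists>i\<in>?R. \<exists>x\<in>?B. F = face i x)" for F
  proof
    assume F: "F \<in> faces ?S"
    then have "leq C.P F F" by (simp add: section_of_def C.leq_refl)
    then show "\<exists>i\<in>?R. \<exists>x\<in>?B. F = face i x" using rep [of "{F}"] F by auto
  qed (use mem in blast)
  \<comment> \<open>The shift by 3 - j turns the ranks j - 4, ..., j into -1, ..., 3; independence
    of the choice is shown next.\<close>
  define f where "f F = (SOME A. \<exists>i\<in>?R. \<exists>x\<in>?B. F = face i x \<and> A = orbit (Lat j) (act (x j) ` base_face (i - int j + 3)))" for F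
  have f: "f (face i x) = orbit (Lat j) (act (x j) ` base_face (i - int j + 3))" if x: "x \<in> ?B" and i: "i \<in> ?R" for i x
  proof -
    let ?Q = "\<lambda>A. \<exists>i'\<in>?R. \<exists>y\<in>?B. face i x = face i' y \<and> A = orbit (Lat j) (act (y j) ` base_face (i' - int j + 3))"
    have "?Q (f (face i x))" unfolding f_def by (rule someI_ex) (use x i in blast)
    then obtain i' y where y: "i' \<in> ?R" "y \<in> ?B" "face i x = face i' y"
      "f (face i x) = orbit (Lat j) (act (y j) ` base_face (i' - int j + 3))" by blast
    have "i = i'" using face_eq [OF BG [OF x] BG [OF y(2)], of i i'] y(1,3) i sub by blast
    then have "face i x = face i y" using y by simp
    then have "cond44 (Lat j) (i - int j + 3) (- x j + y j)" using section_face_eq [OF j i x y(2)] by simp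
    moreover have "i - int j + 3 \<in> {-1..3}" using i by auto
    ultimately show ?thesis using orbit_eq_iff [of "i - int j + 3" "x j" "y j"] y(4) \<open>i = i'\<close> by simp
  qed
  have rng: "i - int j + 3 \<in> {-1..3}" if "i \<in> ?R" for i using that by auto
  have orbit_Lat: "tess_orbit s t X = orbit (Lat j) X" for X
    by (simp add: tess_orbit_def orbit_def Lat)
  have leq_iff: "leq (torus44 s t) (f E) (f F) \<longleftrightarrow> leq C.P E F" if E: "E \<in> faces ?S" and F: "F \<in> faces ?S" for E F
  proof
    obtain i x where ix: "i \<in> ?R" "x \<in> ?B" "E = face i x" using E faces_S by blast
    obtain k y where ky: "k \<in> ?R" "y \<in> ?B" "F = face k y" using F faces_S by blast
    show "leq C.P E F" if le: "leq (torus44 s t) (f E) (f F)"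
    proof -
      obtain X Y where XY: "X \<in> f E" "Y \<in> f F" "X \<subseteq> Y" using le by (auto simp: torus44_def)
      obtain u where u: "u \<in> trans44 (Lat j)" "X = act (u + x j) ` base_face (i - int j + 3)"
        using XY(1) f [OF ix(2,1)] unfolding ix(3) orbit_act by blast
      obtain v where v: "v \<in> trans44 (Lat j)" "Y = act (v + y j) ` base_face (k - int j + 3)"
        using XY(2) f [OF ky(2,1)] unfolding ky(3) orbit_act by blast
      obtain w where w: "i - int j + 3 \<le> k - int j + 3"
        "act w ` base_face (i - int j + 3) = X" "act w ` base_face (k - int j + 3) = Y"
        using incidence [of "u + x j" "i - int j + 3" "v + y j" "k - int j + 3"] XY(3) u v rng ix(1) ky(1) by blast
      \<comment> \<open>The tessellation provides the common representative \<open>w\<close>; its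
        lift represents both faces of the section.\<close>
      obtain z where z: "z \<in> ?B" "z j = w" by (rule lift_coordinate [OF j])
      have orb: "orbit (Lat j) (act g ` base_face m) = orbit (Lat j) (act h ` base_face m)"
        if "m \<in> {-1..3}" "u \<in> trans44 (Lat j)" "act h ` base_face m = act (u + g) ` base_face m" for m u g h
      proof -
        have "act (- h + (u + g)) ` base_face m = base_face m"
          using that(3) unfolding act_image_eq_iff [of h] by (metis act_image_eq_iff that(3))
        then have "cond44 {(0, 0)} m (- h + (u + g))" using stabilizer [OF that(1)] by blast
        moreover have "- h + (u + g) = (- h + u - - h) + (- h + g)" by (simp add: add.assoc [symmetric])
        ultimately have "cond44 (Lat j) m (- h + g)"
          using cond_iff_trivial [of m "- h + g"] trans_normal [OF that(2), of "- h"] by auto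
        then show ?thesis using orbit_eq_iff [OF that(1), of h g] by simp
      qed
      have "face i x = face i z"
        unfolding section_face_eq [OF j ix(1,2) z(1)] z(2)
        using orbit_eq_iff [OF rng [OF ix(1)], of "x j" w] orb [OF rng [OF ix(1)] u(1)] u(2) w(2) by metis
      moreover have "face k y = face k z"
        unfolding section_face_eq [OF j ky(1,2) z(1)] z(2)
        using orbit_eq_iff [OF rng [OF ky(1)], of "y j" w] orb [OF rng [OF ky(1)] v(1)] v(2) w(3) by metis
      moreover have "leq C.P (face i z) (face k z)"
        by (rule C.leq_same [OF subsetD [OF sub ix(1)] subsetD [OF sub ky(1)] BG [OF z(1)]]) (use w(1) in simp)
      ultimately show ?thesis using ix(3) ky(3) by simp
    qed
    show "leq (torus44 s t) (f E) (f F)" if le: "leq C.P E F"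
    proof -
      have "leq C.P E E" "leq C.P F F" using E F by (auto simp: section_of_def C.leq_refl)
      then obtain z where z: "z \<in> ?B" "\<forall>D\<in>{E, F}. rk C.P D \<in> ?R \<and> D = face (rk C.P D) z"
        using rep [of "{E, F}"] E F le by blast
      have eq: "f E = orbit (Lat j) (act (z j) ` base_face (rk C.P E - int j + 3))"
        "f F = orbit (Lat j) (act (z j) ` base_face (rk C.P F - int j + 3))"
        using f z by (metis insert_iff)+
      have mono: "act (z j) ` base_face (rk C.P E - int j + 3) \<subseteq> act (z j) ` base_face (rk C.P F - int j + 3)"
        using base_face_mono C.leq_rk [OF le] by (intro image_mono) simp
      have refl: "X \<in> orbit (Lat j) X" for X
        unfolding orbit_def using zero by (force intro: exI [of _ 0] simp: zero_prod_def)
      have "\<exists>X\<in>f E. \<exists>Y\<in>f F. X \<subseteq> Y" unfolding eq using mono refl by meson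
      then show ?thesis by (simp add: torus44_def)
    qed
  qed
  have inj: "inj_on f (faces ?S)"
  proof
    fix E F assume EF: "E \<in> faces ?S" "F \<in> faces ?S" "f E = f F"
    have "leq C.P E E" using EF by (simp add: section_of_def C.leq_refl)
    then have "leq C.P E F" "leq C.P F E" using leq_iff EF by metis+
    then show "E = F" using C.leq_rk C.leq_rk_eq by (metis order_antisym)
  qed
  have surj: "f ` faces ?S = faces (torus44 s t)"
  proof
    show "f ` faces ?S \<subseteq> faces (torus44 s t)"
    proof
      fix A assume "A \<in> f ` faces ?S"
      then obtain i x where ix: "i \<in> ?R" "x \<in> ?B" "A = f (face i x)" using faces_S by auto
      then have "A = tess_orbit s t (act (x j) ` base_face (i - int j + 3))" using f by (simp add: orbit_Lat)
      moreover have "act (x j) ` base_face (i - int j + 3) \<in> tess_faces"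
        unfolding tess_faces_eq using rng [OF ix(1)] by blast
      ultimately show "A \<in> faces (torus44 s t)" by (simp add: torus44_def)
    qed
    show "faces (torus44 s t) \<subseteq> f ` faces ?S"
    proof
      fix A assume "A \<in> faces (torus44 s t)"
      then obtain g k where gk: "k \<in> {-1..3}" "A = tess_orbit s t (act g ` base_face k)"
        unfolding torus44_def tess_faces_eq by auto
      obtain x where x: "x \<in> ?B" "x j = g" by (rule lift_coordinate [OF j])
      have i: "k + int j - 3 \<in> ?R" using gk(1) by auto
      then have "f (face (k + int j - 3) x) = A" using f [OF x(1) i] gk(2) x(2) by (simp add: orbit_Lat)
      then show "A \<in> f ` faces ?S" using mem [OF x(1) i] by blast
    qed
  qed
  show ?thesis unfolding isomorphic_def
    using inj surj leq_iff by (intro exI [of _ f]) (simp add: bij_betw_def section_of_def)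
qed

end


section \<open>The order of the group\<close>

lemma lattice44_zero: "lattice44 s 0 = {(x, y). s dvd x \<and> s dvd y}"
  by (auto simp: lattice44_def dvd_def mult.commute)

lemma lattice44_diagonal: "lattice44 s s = {(c * s, e * s) | c e. even (c + e)}"
proof -
  have "\<exists>c e. a * s - b * s = c * s \<and> a * s + b * s = e * s \<and> even (c + e)" for a b
    by (intro exI [of _ "a - b"] exI [of _ "a + b"]) (simp add: algebra_simps)
  moreover have "\<exists>a b. c * s = a * s - b * s \<and> e * s = a * s + b * s" if ce: "even (c + e)" for c e
  proof -
    obtain a where "c + e = 2 * a" using ce by (elim evenE)
    then have "c = a - (e - a)" "e = a + (e - a)" by simp_all
    then show ?thesis by (metis left_diff_distrib distrib_right)
  qed
  ultimately show ?thesis unfolding lattice44_def by auto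
qed

lemma even_lattice_zero: assumes "even s" shows "even_lattice (lattice44 s 0)"
  by unfold_locales (use assms dvd_trans in \<open>auto simp: lattice44_zero\<close>)

lemma even_lattice_diagonal: assumes "even s" shows "even_lattice (lattice44 s s)"
proof
  have mem: "(c * s, e * s) \<in> lattice44 s s" if "even (c + e)" for c e
    using that unfolding lattice44_diagonal by blast
  have memE: "\<exists>c e. x = c * s \<and> y = e * s \<and> even (c + e)" if "(x, y) \<in> lattice44 s s" for x y
    using that unfolding lattice44_diagonal by blast
  show "(0, 0) \<in> lattice44 s s" using mem [of 0 0] by simp
  fix x y assume "(x, y) \<in> lattice44 s s"
  then obtain c e where ce: "x = c * s" "y = e * s" "even (c + e)" using memE by blast
  show "(- x, y) \<in> lattice44 s s" using mem [of "- c" e] ce by simp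
  show "(y, x) \<in> lattice44 s s" using mem [of e c] ce by simp
  show "even x" using ce assms by simp
  fix x' y' assume "(x', y') \<in> lattice44 s s"
  then obtain c' e' where ce': "x' = c' * s" "y' = e' * s" "even (c' + e')" using memE by blast
  have "even (c + c' + (e + e'))" using ce(3) ce'(3) by (cases "even c"; cases "even c'") simp_all
  then show "(x + x', y + y') \<in> lattice44 s s" using mem [of "c + c'" "e + e'"] ce ce' by (simp add: distrib_right)
qed

section \<open>Fundamental domains and transversals\<close>

lemma transversal_zero:
  assumes "s > 0"
  shows "\<exists>!u. u \<in> {0..<s} \<times> {0..<s} \<and> (x - fst u, y - snd u) \<in> lattice44 s 0"
proof (rule ex1I [of _ "(x mod s, y mod s)"])
  show "(x mod s, y mod s) \<in> {0..<s} \<times> {0..<s} \<and> (x - fst (x mod s, y mod s), y - snd (x mod s, y mod s)) \<in> lattice44 s 0"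
    using assms by (auto simp: lattice44_zero)
  fix u assume u: "u \<in> {0..<s} \<times> {0..<s} \<and> (x - fst u, y - snd u) \<in> lattice44 s 0"
  then have "x mod s = fst u mod s" "y mod s = snd u mod s"
    by (auto simp: lattice44_zero mod_eq_dvd_iff)
  then show "u = (x mod s, y mod s)" using u by (cases u) auto
qed

text \<open>Subtract a multiple of (s, s) to reduce the second coordinate modulo s, then a multiple
  of the lattice vector (2s, 0) to reduce the first modulo 2s.\<close>

lemma transversal_diagonal:
  assumes "s > 0"
  shows "\<exists>!u. u \<in> {0..<2 * s} \<times> {0..<s} \<and> (x - fst u, y - snd u) \<in> lattice44 s s"
proof (rule ex1I [of _ "((x - y div s * s) mod (2 * s), y mod s)"])
  define k where "k = (x - y div s * s) div (2 * s)"
  have "x - (x - y div s * s) mod (2 * s) = (y div s + 2 * k) * s"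
    unfolding k_def minus_mult_div_eq_mod [symmetric] by (simp add: algebra_simps)
  moreover have "y - y mod s = y div s * s" by (simp add: minus_mod_eq_div_mult)
  moreover have "even (y div s + 2 * k + y div s)" by simp
  ultimately have "(x - (x - y div s * s) mod (2 * s), y - y mod s) \<in> lattice44 s s"
    unfolding lattice44_diagonal by blast
  then show "((x - y div s * s) mod (2 * s), y mod s) \<in> {0..<2 * s} \<times> {0..<s} \<and>
    (x - fst ((x - y div s * s) mod (2 * s), y mod s), y - snd ((x - y div s * s) mod (2 * s), y mod s)) \<in> lattice44 s s"
    using assms by simp
  fix u assume u: "u \<in> {0..<2 * s} \<times> {0..<s} \<and> (x - fst u, y - snd u) \<in> lattice44 s s"
  obtain u1 u2 where uu: "u = (u1, u2)" by (cases u)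
  obtain c e where ce: "x - u1 = c * s" "y - u2 = e * s" "even (c + e)"
    using u unfolding lattice44_diagonal uu by auto
  have "y = u2 + e * s" using ce(2) by simp
  then have y: "y mod s = u2" "y div s = e" using u uu assms by (auto simp: div_pos_pos_trivial)
  obtain m where "c + e = 2 * m" using ce(3) by (elim evenE)
  then have c: "c = 2 * (m - e) + e" by simp
  have "x - e * s = u1 + (m - e) * (2 * s)" using ce(1) unfolding c by (simp add: algebra_simps)
  then have "(x - e * s) mod (2 * s) = u1" using u uu by simp
  then show "u = ((x - y div s * s) mod (2 * s), y mod s)" using y uu by simp
qed

lemma card_parity: "card {x \<in> {0..<2 * int m}. odd x = b} = m"
proof -
  have "{x \<in> {0..<2 * int m}. odd x = b} = (\<lambda>k. 2 * int k + of_bool b) ` {..<m}"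
  proof
    show "{x \<in> {0..<2 * int m}. odd x = b} \<subseteq> (\<lambda>k. 2 * int k + of_bool b) ` {..<m}"
    proof
      fix x assume x: "x \<in> {x \<in> {0..<2 * int m}. odd x = b}"
      then have "x = 2 * int (nat (x div 2)) + of_bool b" "nat (x div 2) < m"
        by (cases b; auto; presburger)+
      then show "x \<in> (\<lambda>k. 2 * int k + of_bool b) ` {..<m}" by blast
    qed
  qed auto
  moreover have "inj_on (\<lambda>k. 2 * int k + of_bool b) {..<m}" by (auto simp: inj_on_def)
  ultimately show ?thesis by (simp add: card_image)
qed

lemma card_parity_rectangle:
  "card {(x, y). (x, y) \<in> {0..<2 * int m} \<times> {0..<2 * int k} \<and> odd x = b \<and> odd y = c} = m * k"
proof -
  have "{(x, y). (x, y) \<in> {0..<2 * int m} \<times> {0..<2 * int k} \<and> odd x = b \<and> odd y = c} =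
      {x \<in> {0..<2 * int m}. odd x = b} \<times> {y \<in> {0..<2 * int k}. odd y = c}" by auto
  then show ?thesis by (simp only: card_parity card_cartesian_product)
qed

lemma card_rectangle: "card ({0..<2 * int m} \<times> {0..<2 * int k}) = 4 * (m * k)"
  by (simp add: card_cartesian_product nat_mult_distrib)

definition lattice_order :: "nat \<Rightarrow> (int \<times> int) set" where
  "lattice_order n = (if odd n then lattice44 (2 ^ ((n - 3) div 2)) 0
     else lattice44 (2 ^ ((n - 4) div 2)) (2 ^ ((n - 4) div 2)))"

text \<open>The point group has order 8, so 2^(n-3) translation classes remain. Both sides of the
  domain \<open>V\<close> are even, hence each of the four parity classes takes a quarter of
  it.\<close>

lemma lattice_order:
  assumes "5 \<le> n"
  obtains V where "even_lattice (lattice_order n)" "finite V" "card V = 2 ^ (n - 3)"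
    "\<And>x y. \<exists>!u. u \<in> V \<and> (x - fst u, y - snd u) \<in> lattice_order n"
    "\<And>b c. card {(x, y). (x, y) \<in> V \<and> odd x = b \<and> odd y = c} = 2 ^ (n - 5)"
proof (cases "odd n")
  case True
  \<comment> \<open>This \<open>e\<close> is one less than the exponent in
    \<open>lattice_order\<close>, to exhibit the factor 2 that makes the lattice even.\<close>
  then obtain e where n: "n = 2 * e + 5" using assms by (metis add.commute le_Suc_ex odd_add odd_numeral evenE)
  have sq: "(2 :: nat) ^ (2 * e) = 2 ^ e * 2 ^ e" by (simp add: mult_2 power_add)
  have L: "lattice_order n = lattice44 (2 * 2 ^ e) 0" using True by (simp add: lattice_order_def n)
  have s: "2 * int (2 ^ e) = 2 * 2 ^ e" by simp
  have "even_lattice (lattice_order n)" unfolding L by (rule even_lattice_zero) simp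
  moreover have "card ({0..<2 * 2 ^ e :: int} \<times> {0..<2 * 2 ^ e :: int}) = 2 ^ (n - 3)"
    using card_rectangle [of "2 ^ e" "2 ^ e"] unfolding s by (simp add: n power_add sq)
  moreover have "\<exists>!u. u \<in> {0..<2 * 2 ^ e} \<times> {0..<2 * 2 ^ e} \<and> (x - fst u, y - snd u) \<in> lattice_order n" for x y
    unfolding L by (rule transversal_zero) simp
  moreover have "card {(x, y). (x, y) \<in> {0..<2 * 2 ^ e :: int} \<times> {0..<2 * 2 ^ e :: int} \<and> odd x = b \<and> odd y = c} = 2 ^ (n - 5)" for b c
    using card_parity_rectangle [of "2 ^ e" "2 ^ e" b c] unfolding s by (simp add: n power_add sq)
  ultimately show ?thesis using that [of "{0..<2 * 2 ^ e} \<times> {0..<2 * 2 ^ e}"] by simp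
next
  case False
  then have "6 \<le> n" using assms by (cases "n = 5") auto
  then obtain e where n: "n = 2 * e + 6" using False by (metis add.commute le_Suc_ex even_add even_numeral evenE)
  have sq: "(2 :: nat) ^ (2 * e) = 2 ^ e * 2 ^ e" by (simp add: mult_2 power_add)
  have L: "lattice_order n = lattice44 (2 * 2 ^ e) (2 * 2 ^ e)" using False by (simp add: lattice_order_def n)
  have s: "2 * int (2 * 2 ^ e) = 2 * (2 * 2 ^ e)" "2 * int (2 ^ e) = 2 * 2 ^ e" by simp_all
  have "even_lattice (lattice_order n)" unfolding L by (rule even_lattice_diagonal) simp
  moreover have "card ({0..<2 * (2 * 2 ^ e) :: int} \<times> {0..<2 * 2 ^ e :: int}) = 2 ^ (n - 3)"
    using card_rectangle [of "2 * 2 ^ e" "2 ^ e"] unfolding s by (simp add: n power_add sq)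
  moreover have "\<exists>!u. u \<in> {0..<2 * (2 * 2 ^ e)} \<times> {0..<2 * 2 ^ e} \<and> (x - fst u, y - snd u) \<in> lattice_order n" for x y
    unfolding L by (rule transversal_diagonal) simp
  moreover have "card {(x, y). (x, y) \<in> {0..<2 * (2 * 2 ^ e) :: int} \<times> {0..<2 * 2 ^ e :: int} \<and> odd x = b \<and> odd y = c} = 2 ^ (n - 5)" for b c
    using card_parity_rectangle [of "2 * 2 ^ e" "2 ^ e" b c] unfolding s by (simp add: n power_add sq)
  ultimately show ?thesis using that [of "{0..<2 * (2 * 2 ^ e)} \<times> {0..<2 * 2 ^ e}"] by simp
qed

text \<open>Three free bits multiply \<open>V\<close> by 8. Linking prescribes both parities and the
  swap bit and leaves two sign bits free, which gives 2^(n-5) times 4 elements.\<close>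

lemma sq_transversal:
  assumes "5 \<le> n"
  obtains R where "even_lattice (lattice_order n)" "finite R" "card R = 2 ^ n"
    "\<And>w. \<exists>!u. u \<in> R \<and> - u + w \<in> trans44 (lattice_order n)"
    "\<And>g. card {w \<in> R. linked g w} = 2 ^ (n - 3)"
proof -
  obtain V where L: "even_lattice (lattice_order n)" and V: "finite V" "card V = 2 ^ (n - 3)"
    "\<And>x y. \<exists>!u. u \<in> V \<and> (x - fst u, y - snd u) \<in> lattice_order n"
    "\<And>b c. card {(x, y). (x, y) \<in> V \<and> odd x = b \<and> odd y = c} = 2 ^ (n - 5)"
    by (rule lattice_order [OF assms]) blast
  interpret even_lattice "lattice_order n" by (rule L)
  define f where "f = (\<lambda>((x, y), s, a, b). Sq x y s a b)"
  define R where "R = f ` (V \<times> UNIV)"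
  have inj: "inj f" by (auto simp: inj_def f_def)
  have R_iff: "Sq x y s a b \<in> R \<longleftrightarrow> (x, y) \<in> V" for x y s a b
  proof
    assume "(x, y) \<in> V"
    then have "f ((x, y), s, a, b) \<in> R" unfolding R_def by blast
    then show "Sq x y s a b \<in> R" by (simp add: f_def)
  qed (auto simp: R_def f_def)
  have "card R = 2 ^ (n - 3) * 8"
  proof -
    have "card (UNIV :: (bool \<times> bool \<times> bool) set) = 8"
      by (simp add: card_cartesian_product flip: UNIV_Times_UNIV)
    then show ?thesis
      unfolding R_def card_image [OF inj_on_subset [OF inj subset_UNIV]] card_cartesian_product V(2) by simp
  qed
  also have "\<dots> = 2 ^ ((n - 3) + 3)" unfolding power_add by simp
  finally have card: "card R = 2 ^ n" using assms by simp
  have uniq: "\<exists>!u. u \<in> R \<and> - u + w \<in> trans44 (lattice_order n)" for w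
  proof -
    obtain x y s a b where w: "w = Sq x y s a b" by (cases w)
    have eq: "- Sq x' y' s' a' b' + w \<in> trans44 (lattice_order n) \<longleftrightarrow>
      s' = s \<and> a' = a \<and> b' = b \<and> (x - x', y - y') \<in> lattice_order n" for x' y' s' a' b'
    proof -
      have mem: "Sq p q s a b \<in> trans44 (lattice_order n) \<longleftrightarrow> \<not> s \<and> \<not> a \<and> \<not> b \<and> (p, q) \<in> lattice_order n" for p q s a b
        by (auto simp: trans44_def)
      have eq: "- Sq x' y' s' a' b' + w =
        (if s' then Sq (flip b' (y - y')) (flip a' (x - x')) (\<not> s) (b' \<noteq> b) (a' \<noteq> a)
         else Sq (flip a' (x - x')) (flip b' (y - y')) s (a' \<noteq> a) (b' \<noteq> b))"
        by (cases s') (simp_all add: w flip_def)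
      show ?thesis
        unfolding eq by (cases s') (simp_all only: if_True if_False mem flip_fst_iff flip_snd_iff swap_iff [of "y - y'"], blast+)
    qed
    obtain u where u: "u \<in> V" "(x - fst u, y - snd u) \<in> lattice_order n"
      and uu: "\<And>v. v \<in> V \<Longrightarrow> (x - fst v, y - snd v) \<in> lattice_order n \<Longrightarrow> v = u"
      using V(3) [of x y] by blast
    show ?thesis
    proof (rule ex1I [of _ "Sq (fst u) (snd u) s a b"])
      show "Sq (fst u) (snd u) s a b \<in> R \<and> - Sq (fst u) (snd u) s a b + w \<in> trans44 (lattice_order n)"
        unfolding eq using u by (simp add: R_iff)
      fix v assume v: "v \<in> R \<and> - v + w \<in> trans44 (lattice_order n)"
      obtain x' y' s' a' b' where v': "v = Sq x' y' s' a' b'" by (cases v)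
      then have "s' = s" "a' = a" "b' = b" "(x', y') \<in> V" "(x - x', y - y') \<in> lattice_order n"
        using v eq R_iff by blast+
      then show "v = Sq (fst u) (snd u) s a b" using uu [of "(x', y')"] v' by auto
    qed
  qed
  have fib: "card {w \<in> R. linked g w} = 2 ^ (n - 3)" for g
  proof -
    obtain p q s where pqs: "d4_twist (face_class g) = (p, q, s)" by (metis prod_cases3)
    define B where "B = {(x, y). (x, y) \<in> V \<and> odd x = p \<and> odd y = q} \<times> {s} \<times> (UNIV :: (bool \<times> bool) set)"
    have "w \<in> {w \<in> R. linked g w} \<longleftrightarrow> w \<in> f ` B" for w
    proof -
      obtain x y s' a b where w: "w = Sq x y s' a b" by (cases w)
      have "w = f ((x, y), s', a, b)" by (simp add: w f_def)
      then have "w \<in> f ` B \<longleftrightarrow> ((x, y), s', a, b) \<in> B" by (simp only: inj_image_mem_iff [OF inj])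
      then show ?thesis by (auto simp: B_def w R_iff linked_def pqs)
    qed
    then have "card {w \<in> R. linked g w} = card (f ` B)" by (intro arg_cong [of _ _ card]) blast
    also have "\<dots> = 2 ^ (n - 5) * 4"
    proof -
      have "card (UNIV :: (bool \<times> bool) set) = 4"
        by (simp add: card_cartesian_product flip: UNIV_Times_UNIV)
      then show ?thesis
        unfolding card_image [OF inj_on_subset [OF inj subset_UNIV]] B_def card_cartesian_product V(4) by simp
    qed
    also have "\<dots> = 2 ^ ((n - 5) + 2)" unfolding power_add by simp
    also have "(n - 5) + 2 = n - 3" using assms by simp
    finally show ?thesis .
  qed
  have "finite R" using V(1) by (simp add: R_def)
  then show ?thesis using that L card uniq fib by blast
qed

section \<open>Counting the fibre product modulo its kernel\<close>

definition linked_seqs :: "nat \<Rightarrow> (nat \<Rightarrow> sq set) \<Rightarrow> (nat \<Rightarrow> sq) set" where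
  "linked_seqs d R = {a. (\<forall>j. j \<notin> {3..d} \<longrightarrow> a j = 0) \<and> (\<forall>j\<in>{3..<d}. linked (a j) (a (Suc j))) \<and>
     (\<forall>j\<in>{3..d}. a j \<in> R j)}"

lemma linked_seqs_Suc:
  assumes "3 \<le> d"
  shows "bij_betw (\<lambda>(a, w). a(Suc d := w)) (SIGMA a:linked_seqs d R. {w \<in> R (Suc d). linked (a d) w}) (linked_seqs (Suc d) R)"
proof (rule bij_betw_byWitness [where f' = "\<lambda>a. (a(Suc d := 0), a (Suc d))"])
  let ?A = "SIGMA a:linked_seqs d R. {w \<in> R (Suc d). linked (a d) w}"
  have split: "j \<in> {3..Suc d} \<longleftrightarrow> j \<in> {3..d} \<or> j = Suc d" "j \<in> {3..<Suc d} \<longleftrightarrow> j \<in> {3..<d} \<or> j = d" for j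
    using assms by auto
  show "\<forall>p\<in>?A. (\<lambda>a. (a(Suc d := 0), a (Suc d))) ((\<lambda>(a, w). a(Suc d := w)) p) = p"
    using assms by (auto simp: linked_seqs_def fun_eq_iff)
  show "\<forall>a\<in>linked_seqs (Suc d) R. (\<lambda>(a, w). a(Suc d := w)) (a(Suc d := 0), a (Suc d)) = a"
    by simp
  show "(\<lambda>(a, w). a(Suc d := w)) ` ?A \<subseteq> linked_seqs (Suc d) R"
    using assms by (auto simp: linked_seqs_def split)
  show "(\<lambda>a. (a(Suc d := 0), a (Suc d))) ` linked_seqs (Suc d) R \<subseteq> ?A"
    using assms by (auto simp: linked_seqs_def split)
qed

text \<open>The count of linked successors is independent of the predecessor, so each step
  multiplies by a constant. The final inequality keeps the truncated subtraction of naturals exact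
  in the induction.\<close>

lemma card_linked_seqs:
  assumes "3 \<le> d"
    and "\<And>j. j \<in> {3..d} \<Longrightarrow> finite (R j) \<and> card (R j) = 2 ^ n j \<and> 3 \<le> n j \<and> (\<forall>g. card {w \<in> R j. linked g w} = 2 ^ (n j - 3))"
  shows "finite (linked_seqs d R) \<and> card (linked_seqs d R) = 2 ^ ((\<Sum>j = 3..d. n j) - 3 * (d - 3)) \<and> 3 * (d - 3) \<le> (\<Sum>j = 3..d. n j)"
  using assms
proof (induction d rule: dec_induct)
  case base
  have "bij_betw (\<lambda>w. (\<lambda>j. if j = 3 then w else 0)) (R 3) (linked_seqs 3 R)"
    by (rule bij_betw_byWitness [where f' = "\<lambda>a. a 3"]) (auto simp: linked_seqs_def fun_eq_iff)
  then show ?case using base [of 3] bij_betw_finite bij_betw_same_card by fastforce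
next
  case (step d)
  have IH: "finite (linked_seqs d R)" "card (linked_seqs d R) = 2 ^ ((\<Sum>j = 3..d. n j) - 3 * (d - 3))"
    "3 * (d - 3) \<le> (\<Sum>j = 3..d. n j)"
    using step.IH step.prems by auto
  have S: "finite (R (Suc d))" "3 \<le> n (Suc d)" "\<And>g. card {w \<in> R (Suc d). linked g w} = 2 ^ (n (Suc d) - 3)"
    using step.prems [of "Suc d"] step.hyps by auto
  let ?A = "SIGMA a:linked_seqs d R. {w \<in> R (Suc d). linked (a d) w}"
  have "finite ?A" using IH S by (intro finite_SigmaI) auto
  moreover have "card ?A = card (linked_seqs d R) * 2 ^ (n (Suc d) - 3)"
    using IH(1) S by (subst card_SigmaI) auto
  moreover have "((\<Sum>j = 3..d. n j) - 3 * (d - 3)) + (n (Suc d) - 3) = (\<Sum>j = 3..Suc d. n j) - 3 * (Suc d - 3)"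
    using IH(3) S(2) step.hyps by simp
  moreover have "3 * (Suc d - 3) \<le> (\<Sum>j = 3..Suc d. n j)" using IH(3) S(2) step.hyps by simp
  moreover note bij = linked_seqs_Suc [OF step.hyps(1), of R]
  ultimately show ?case
    using bij_betw_finite [OF bij] bij_betw_same_card [OF bij] IH(2) by (simp flip: power_add)
qed

context tower
begin

lemma linked_trans: "t \<in> trans44 (Lat i) \<Longrightarrow> t' \<in> trans44 (Lat j) \<Longrightarrow> linked t t'"
  using linked_add [of t 0 0 t'] even_lattice.linked_trans_left [OF lattice] even_lattice.linked_trans_right [OF lattice] by simp

text \<open>Representatives may be chosen in each coordinate separately: they differ from the given
  ones by even translations, which do not affect linking.\<close>

lemma linked_seqs_transversal:
  assumes R: "\<And>j w. j \<in> {3..d} \<Longrightarrow> \<exists>!u. u \<in> R j \<and> - u + w \<in> trans44 (Lat j)"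
  shows "linked_seqs d R \<subseteq> G" and "g \<in> G \<Longrightarrow> \<exists>!x. x \<in> linked_seqs d R \<and> - x + g \<in> H {}"
proof -
  show sub: "linked_seqs d R \<subseteq> G" by (auto simp: linked_seqs_def G_def)
  assume g: "g \<in> G"
  define u where "u j = (THE u. u \<in> R j \<and> - u + g j \<in> trans44 (Lat j))" for j
  have u: "u j \<in> R j" "- u j + g j \<in> trans44 (Lat j)" if "j \<in> {3..d}" for j
    using theI' [OF R [OF that, of "g j"]] by (simp_all add: u_def)
  define x where "x j = (if j \<in> {3..d} then u j else 0)" for j
  have "linked (x j) (x (Suc j))" if j: "j \<in> {3..<d}" for j
  proof -
    have "linked (- u j + g j) (- u (Suc j) + g (Suc j))"
      by (rule linked_trans [OF u(2) u(2)]) (use j in auto)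
    then have "linked (g j + - (- u j + g j)) (g (Suc j) + - (- u (Suc j) + g (Suc j)))"
      by (rule linked_add [OF G_linked [OF g j] linked_uminus])
    moreover have eq: "g j + - (- u j + g j) = u j" for j
      by (simp only: minus_add minus_minus add.assoc [symmetric] right_minus add_0_left)
    ultimately have "linked (u j) (u (Suc j))" unfolding eq by simp
    then show ?thesis using j by (simp add: x_def)
  qed
  then have x: "x \<in> linked_seqs d R" using u by (auto simp: linked_seqs_def x_def)
  then have "- x + g \<in> G" using sub g subgroup_G by (auto simp: add_subgroup_def)
  then have xk: "- x + g \<in> H {}" using u by (simp add: kernel_iff x_def)
  show "\<exists>!x. x \<in> linked_seqs d R \<and> - x + g \<in> H {}"
  proof (rule ex1I [of _ x])
    fix y assume y: "y \<in> linked_seqs d R \<and> - y + g \<in> H {}"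
    have "y j = x j" for j
    proof (cases "j \<in> {3..d}")
      case True
      then have "y j \<in> R j \<and> - y j + g j \<in> trans44 (Lat j)" "x j \<in> R j \<and> - x j + g j \<in> trans44 (Lat j)"
        using y x xk by (auto simp: linked_seqs_def kernel_iff)
      then show ?thesis using R [OF True, of "g j"] by blast
    next
      case False
      then show ?thesis using y x by (simp add: linked_seqs_def)
    qed
    then show "y = x" by blast
  qed (use x xk in blast)
qed

lemma coset_eq_iff:
  assumes "g \<in> G" "h \<in> G"
  shows "{x \<in> G. - g + x \<in> H J} = {x \<in> G. - h + x \<in> H J} \<longleftrightarrow> - g + h \<in> H J"
proof
  assume "{x \<in> G. - g + x \<in> H J} = {x \<in> G. - h + x \<in> H J}"
  moreover have "h \<in> {x \<in> G. - h + x \<in> H J}" using assms H_closed(1) by simp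
  ultimately show "- g + h \<in> H J" by blast
next
  assume gh: "- g + h \<in> H J"
  have "- g + x \<in> H J \<longleftrightarrow> - h + x \<in> H J" for x
  proof
    have eq: "- (- g + h) + (- g + x) = - h + x" "(- g + h) + (- h + x) = - g + x"
      by (simp_all add: uminus_add_cancel_left add.assoc)
    show "- g + x \<in> H J \<Longrightarrow> - h + x \<in> H J" using H_closed(2) [OF H_closed(3) [OF gh]] unfolding eq(1) [symmetric] .
    show "- h + x \<in> H J \<Longrightarrow> - g + x \<in> H J" using H_closed(2) [OF gh] unfolding eq(2) [symmetric] .
  qed
  then show "{x \<in> G. - g + x \<in> H J} = {x \<in> G. - h + x \<in> H J}" by blast
qed

end

theorem theorem5p1:
  fixes d :: nat and n :: "nat \<Rightarrow> nat"
  assumes "d \<ge> 3"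
    and "\<forall>j\<in>{3..d}. n j \<ge> 5"
  shows "\<exists>(P :: nat ranked_poset) \<Phi>.
    finite (faces P) \<and> regular_polytope (int d) P \<and> flag P \<Phi> \<and>
    has_type (int d) P \<Phi> (\<lambda>j. torus44_order (n j)) \<and>
    Coset.order (aut_group P) = 2 ^ ((\<Sum>j = 3..d. n j) - 3 * (d - 3)) \<and>
    (d \<ge> 4 \<longrightarrow> flat (int d) P \<and> kl_flat (int d) P (int d - 4) (int d - 1)) \<and>
    FAP_cofaces (int d) P \<Phi> (int d - 4) \<and>
    FAP_cofaces (int d) P \<Phi> (int d - 3) \<and>
    FAP_faces (int d) P \<Phi> (int d - 1)"
proof -
  \<comment> \<open>The locale \<open>tower\<close> asks for an even lattice at every index, hence
    the trivial default.\<close>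
  define Lat where "Lat j = (if j \<in> {3..d} then lattice_order (n j) else {(0, 0)})" for j
  define Q where "Q j S \<longleftrightarrow> even_lattice (Lat j) \<and> finite S \<and> card S = 2 ^ n j \<and>
      (\<forall>w. \<exists>!u. u \<in> S \<and> - u + w \<in> trans44 (Lat j)) \<and> (\<forall>g. card {w \<in> S. linked g w} = 2 ^ (n j - 3))" for j S
  have "\<exists>S. Q j S" if j: "j \<in> {3..d}" for j
  proof -
    have n: "5 \<le> n j" and Lat: "Lat j = lattice_order (n j)" using assms(2) j by (auto simp: Lat_def)
    show ?thesis unfolding Q_def Lat by (rule sq_transversal [OF n]) blast
  qed
  then have "\<forall>j\<in>{3..d}. \<exists>S. Q j S" by blast
  from bchoice [OF this] obtain R where "\<forall>j\<in>{3..d}. Q j (R j)" by blast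
  then have R: "even_lattice (Lat j)" "finite (R j)" "card (R j) = 2 ^ n j"
    "\<exists>!u. u \<in> R j \<and> - u + w \<in> trans44 (Lat j)" "card {w \<in> R j. linked g w} = 2 ^ (n j - 3)"
    if "j \<in> {3..d}" for j w g
    using that unfolding Q_def by blast+
  interpret tower d Lat
  proof (rule tower.intro)
    show "even_lattice (Lat j)" for j
      using R(1) [of j] even_lattice_trivial by (cases "j \<in> {3..d}") (simp_all add: Lat_def)
  qed (use assms(1) in simp)
  have transversal: "linked_seqs d R \<subseteq> G" "\<And>g. g \<in> G \<Longrightarrow> \<exists>!x. x \<in> linked_seqs d R \<and> - x + g \<in> H {}"
    using linked_seqs_transversal [of R, OF R(4)] by blast+
  have seqs: "finite (linked_seqs d R)" "card (linked_seqs d R) = 2 ^ ((\<Sum>j = 3..d. n j) - 3 * (d - 3))"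
  proof -
    have "3 \<le> n j" if "j \<in> {3..d}" for j using bspec [OF assms(2) that] by simp
    then show "finite (linked_seqs d R)" "card (linked_seqs d R) = 2 ^ ((\<Sum>j = 3..d. n j) - 3 * (d - 3))"
      using card_linked_seqs [OF assms(1), of R n] R(2,3,5) by blast+
  qed
  \<comment> \<open>The rank is recorded because different ranks can have the same coset; for -1 and
    d it is all of \<open>G\<close>.\<close>
  define C where "C i g = (i, {x \<in> G. - g + x \<in> H (- {i})})" for i :: int and g
  \<comment> \<open>Representatives from the finite transversal already give all cosets, so there
    are finitely many faces and they can be numbered.\<close>
  define A where "A = (\<lambda>(i, g). C i g) ` ({-1..int d} \<times> linked_seqs d R)"
  have A: "C i g \<in> A" if i: "i \<in> {-1..int d}" and g: "g \<in> G" for i g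
  proof -
    obtain x where x: "x \<in> linked_seqs d R" "- x + g \<in> H {}" using transversal(2) [OF g] by blast
    then have "- x + g \<in> H (- {i})" by (auto simp: parabolic_def)
    then have "C i x = C i g" using coset_eq_iff [of x g "- {i}"] x(1) transversal(1) g by (auto simp: C_def)
    moreover have "(\<lambda>(i, g). C i g) (i, x) \<in> A" unfolding A_def using x(1) i by (intro imageI) simp
    ultimately show ?thesis by simp
  qed
  have "finite A" using seqs(1) by (simp add: A_def)
  then obtain enc :: "int \<times> (nat \<Rightarrow> sq) set \<Rightarrow> nat" where enc: "inj_on enc A"
    using finite_imp_inj_to_nat_seg by metis
  interpret tower_faces d Lat "\<lambda>i g. enc (C i g)"
  proof
    fix g h i j assume *: "g \<in> G" "h \<in> G" "i \<in> {-1..int d}" "j \<in> {-1..int d}"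
    have "enc (C i g) = enc (C j h) \<longleftrightarrow> C i g = C j h"
      using inj_on_eq_iff [OF enc] A * by blast
    also have "\<dots> \<longleftrightarrow> i = j \<and> - g + h \<in> H (- {i})"
      using coset_eq_iff [OF *(1,2), of "- {i}"] by (auto simp: C_def)
    finally show "enc (C i g) = enc (C j h) \<longleftrightarrow> i = j \<and> - g + h \<in> H (- {i})" .
  qed
  have "faces C.P \<subseteq> enc ` A"
  proof
    fix F assume "F \<in> faces C.P"
    then obtain i g where "i \<in> {-1..int d}" "g \<in> G" "F = enc (C i g)" by (rule C.faceE)
    then show "F \<in> enc ` A" using A by blast
  qed
  then have "finite (faces C.P)" using \<open>finite A\<close> finite_surj by blast
  moreover have "has_type (int d) C.P (C.Fl 0) (\<lambda>j. torus44_order (n j))"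
    unfolding has_type_def
  proof (intro allI impI)
    fix j assume "3 \<le> j \<and> int j \<le> int d"
    then have j: "j \<in> {3..d}" by simp
    then have "flag_face C.P (C.Fl 0) (int j - 4) = enc (C (int j - 4) 0)" "flag_face C.P (C.Fl 0) (int j) = enc (C (int j) 0)"
      by (intro C.flag_face_Fl0; simp)+
    then show "isomorphic (section_of C.P (flag_face C.P (C.Fl 0) (int j - 4)) (flag_face C.P (C.Fl 0) (int j))) (torus44_order (n j))"
      using section_isomorphic [OF j] j by (simp add: Lat_def lattice_order_def torus44_order_def)
  qed
  moreover have "Coset.order (aut_group C.P) = 2 ^ ((\<Sum>j = 3..d. n j) - 3 * (d - 3))"
    using C.order_aut [OF transversal] seqs(2) by simp
  moreover have "flat (int d) C.P \<and> kl_flat (int d) C.P (int d - 4) (int d - 1)" if "d \<ge> 4"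
    unfolding flat_def using kl_flat_P [of 0] kl_flat_P [of "int d - 4"] that by simp
  ultimately show ?thesis
    using C.regular_P C.flag_Fl0 fap_coface_4 fap_coface_3 fap_facets by blast
qed

end
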